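(* Let $\mathcal{V}$ be a locally presentable symmetric monoidal closed category. If $B$ is a bimonoid in $\mathcal{V}$ and $A$ is a commutative monoid in $\mathcal{V}$, then $P(B,A)$ has a canonical structure of a bimonoid; if moreover the bimonoid $B$ is cocommutative, then the bimonoid $P(B,A)$ is commutative. In particular, the finite dual $B^\circ=P(B,I)$ is a bimonoid, and it is commutative if $B$ is cocommutative.
   Context: For a comonoid $C$ and a monoid $A$ in $\mathcal{V}$, the internal hom $[C,A]$ has the convolution monoid structure. $P(B,A)$, the universal measuring comonoid of monoids $B,A$, is the comonoid with natural bijections $\mathbf{Mon}(\mathcal{V})(B,[C,A])\cong\mathbf{Comon}(\mathcal{V})(C,P(B,A))$ for comonoids $C$; it exists under the stated hypotheses. Let $\eta\colon B\to[P(B,A),A]$ be the monoid morphism corresponding to the identity of $P(B,A)$. The canonical bimonoid structure is the given comonoid structure together with: the multiplication $P(B,A)\otimes P(B,A)\to P(B,A)$, which is the comonoid morphism corresponding to the monoid morphism $$B\xrightarrow{\Delta}B\otimes B\xrightarrow{\eta\otimes\eta}[P(B,A),A]\otimes[P(B,A),A]\to[P(B,A)\otimes P(B,A),A\otimes A]\xrightarrow{[1,\mu_A]}[P(B,A)\otimes P(B,A),A];$$ and the unit $I\to P(B,A)$, which is the comonoid morphism corresponding to $B\xrightarrow{\varepsilon}I\xrightarrow{\iota_A}A\cong[I,A]$. *)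

theory Defs
  imports Main
begin

unbundle cardinal_syntax

section \<open>Categories, functors, colimits\<close>

record ('o, 'm) category_data =
  Obj :: "'o set"
  Mor :: "'m set"
  Dom :: "'m \<Rightarrow> 'o"
  Cod :: "'m \<Rightarrow> 'o"
  Id :: "'o \<Rightarrow> 'm"
  Comp :: "'m \<Rightarrow> 'm \<Rightarrow> 'm" (infixr "\<cdot>\<index>" 60)

definition hom :: "('o, 'm, 'z) category_data_scheme \<Rightarrow> 'o \<Rightarrow> 'o \<Rightarrow> 'm set" where
  "hom V x y = {f \<in> Mor V. Dom V f = x \<and> Cod V f = y}"

locale category =
  fixes V :: "('o, 'm, 'z) category_data_scheme" (structure)
  assumes Dom_in_Obj: "f \<in> Mor V \<Longrightarrow> Dom V f \<in> Obj V"
    and Cod_in_Obj: "f \<in> Mor V \<Longrightarrow> Cod V f \<in> Obj V"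
    and Id_in_hom: "x \<in> Obj V \<Longrightarrow> Id V x \<in> hom V x x"
    and Comp_in_hom: "f \<in> hom V x y \<Longrightarrow> g \<in> hom V y z \<Longrightarrow> g \<cdot> f \<in> hom V x z"
    and Comp_Id: "f \<in> hom V x y \<Longrightarrow> f \<cdot> Id V x = f"
    and Id_Comp: "f \<in> hom V x y \<Longrightarrow> Id V y \<cdot> f = f"
    and Comp_assoc: "f \<in> hom V w x \<Longrightarrow> g \<in> hom V x y \<Longrightarrow> h \<in> hom V y z \<Longrightarrow>
      (h \<cdot> g) \<cdot> f = h \<cdot> (g \<cdot> f)"

definition inverse_mors :: "('o, 'm, 'z) category_data_scheme \<Rightarrow> 'm \<Rightarrow> 'm \<Rightarrow> bool" where
  "inverse_mors V f g \<longleftrightarrow>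
     f \<in> Mor V \<and> g \<in> hom V (Cod V f) (Dom V f) \<and>
     g \<cdot>\<^bsub>V\<^esub> f = Id V (Dom V f) \<and> f \<cdot>\<^bsub>V\<^esub> g = Id V (Cod V f)"

definition iso_mor :: "('o, 'm, 'z) category_data_scheme \<Rightarrow> 'm \<Rightarrow> bool" where
  "iso_mor V f \<longleftrightarrow> (\<exists>g. inverse_mors V f g)"

definition inv_mor :: "('o, 'm, 'z) category_data_scheme \<Rightarrow> 'm \<Rightarrow> 'm" where
  "inv_mor V f = (THE g. inverse_mors V f g)"

definition is_functor ::
  "('i, 'j, 'y) category_data_scheme \<Rightarrow> ('o, 'm, 'z) category_data_scheme \<Rightarrow>
   ('i \<Rightarrow> 'o) \<Rightarrow> ('j \<Rightarrow> 'm) \<Rightarrow> bool" where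
  "is_functor J V Fo Fm \<longleftrightarrow>
     (\<forall>i \<in> Obj J. Fo i \<in> Obj V \<and> Fm (Id J i) = Id V (Fo i)) \<and>
     (\<forall>u \<in> Mor J. Fm u \<in> hom V (Fo (Dom J u)) (Fo (Cod J u))) \<and>
     (\<forall>u \<in> Mor J. \<forall>v \<in> Mor J. Cod J u = Dom J v \<longrightarrow>
        Fm (v \<cdot>\<^bsub>J\<^esub> u) = Fm v \<cdot>\<^bsub>V\<^esub> Fm u)"

definition is_cocone ::
  "('i, 'j, 'y) category_data_scheme \<Rightarrow> ('o, 'm, 'z) category_data_scheme \<Rightarrow>
   ('i \<Rightarrow> 'o) \<Rightarrow> ('j \<Rightarrow> 'm) \<Rightarrow> 'o \<Rightarrow> ('i \<Rightarrow> 'm) \<Rightarrow> bool" where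
  "is_cocone J V Fo Fm X c \<longleftrightarrow>
     X \<in> Obj V \<and>
     (\<forall>i \<in> Obj J. c i \<in> hom V (Fo i) X) \<and>
     (\<forall>u \<in> Mor J. c (Cod J u) \<cdot>\<^bsub>V\<^esub> Fm u = c (Dom J u))"

definition is_colimit ::
  "('i, 'j, 'y) category_data_scheme \<Rightarrow> ('o, 'm, 'z) category_data_scheme \<Rightarrow>
   ('i \<Rightarrow> 'o) \<Rightarrow> ('j \<Rightarrow> 'm) \<Rightarrow> 'o \<Rightarrow> ('i \<Rightarrow> 'm) \<Rightarrow> bool" where
  "is_colimit J V Fo Fm X c \<longleftrightarrow>
     is_cocone J V Fo Fm X c \<and>
     (\<forall>Y d. is_cocone J V Fo Fm Y d \<longrightarrow>
        (\<exists>!h. h \<in> hom V X Y \<and> (\<forall>i \<in> Obj J. h \<cdot>\<^bsub>V\<^esub> c i = d i)))"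


section \<open>Locally presentable categories\<close>

text \<open>
  Size is measured against a strongly inaccessible cardinal \<open>\<kappa>\<close>, which plays the role of a
  Grothendieck universe: a set is small if its cardinality is below \<open>\<kappa>\<close>. Since every small set
  is in bijection with a subset of the type \<open>'u\<close> carrying \<open>\<kappa>\<close>, it is enough to let the shapes of
  small diagrams, and the cardinals below \<open>\<kappa>\<close>, live on \<open>'u\<close>.
\<close>

definition inaccessible :: "'u rel \<Rightarrow> bool" where
  "inaccessible \<kappa> \<longleftrightarrow>
     Card_order \<kappa> \<and> natLeq <o \<kappa> \<and> regularCard \<kappa> \<and>
     (\<forall>S :: 'u set. |S| <o \<kappa> \<longrightarrow> |Pow S| <o \<kappa>)"

definition locally_small :: "'u rel \<Rightarrow> ('o, 'm, 'z) category_data_scheme \<Rightarrow> bool" where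
  "locally_small \<kappa> V \<longleftrightarrow> (\<forall>x \<in> Obj V. \<forall>y \<in> Obj V. |hom V x y| <o \<kappa>)"

definition cocomplete :: "'u rel \<Rightarrow> ('o, 'm, 'z) category_data_scheme \<Rightarrow> bool" where
  "cocomplete \<kappa> V \<longleftrightarrow>
     (\<forall>(J :: ('u, 'u) category_data) Fo Fm.
        category J \<and> |Obj J| <o \<kappa> \<and> |Mor J| <o \<kappa> \<and> is_functor J V Fo Fm \<longrightarrow>
        (\<exists>X c. is_colimit J V Fo Fm X c))"

definition poset_category :: "'i set \<Rightarrow> 'i rel \<Rightarrow> ('i, 'i \<times> 'i) category_data" where
  "poset_category D R =
     \<lparr>Obj = D, Mor = R, Dom = fst, Cod = snd, Id = (\<lambda>i. (i, i)),
      Comp = (\<lambda>v u. (fst u, snd v))\<rparr>"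

definition directed_poset :: "'l rel \<Rightarrow> 'i set \<Rightarrow> 'i rel \<Rightarrow> bool" where
  "directed_poset \<theta> D R \<longleftrightarrow>
     R \<subseteq> D \<times> D \<and> refl_on D R \<and> trans R \<and> antisym R \<and>
     (\<forall>S \<subseteq> D. |S| <o \<theta> \<longrightarrow> (\<exists>d \<in> D. \<forall>s \<in> S. (s, d) \<in> R))"

text \<open>
  The colimit in sets of \<open>i \<mapsto> hom(K, F i)\<close> is the disjoint union of these sets modulo the
  equivalence relation generated by \<open>(i, f) \<sim> (j, F u \<cdot> f)\<close> for \<open>u : i \<rightarrow> j\<close>. The functor
  \<open>hom(K, -)\<close> preserves the colimit cocone \<open>c\<close> with vertex \<open>X\<close> iff the comparison map from this
  quotient to \<open>hom(K, X)\<close>, sending the class of \<open>(i, f)\<close> to \<open>c i \<cdot> f\<close>, is a bijection.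
\<close>

definition hom_elements ::
  "('i, 'j, 'y) category_data_scheme \<Rightarrow> ('o, 'm, 'z) category_data_scheme \<Rightarrow>
   'o \<Rightarrow> ('i \<Rightarrow> 'o) \<Rightarrow> ('i \<times> 'm) set" where
  "hom_elements J V K Fo = (SIGMA i : Obj J. hom V K (Fo i))"

definition hom_step ::
  "('i, 'j, 'y) category_data_scheme \<Rightarrow> ('o, 'm, 'z) category_data_scheme \<Rightarrow>
   'o \<Rightarrow> ('i \<Rightarrow> 'o) \<Rightarrow> ('j \<Rightarrow> 'm) \<Rightarrow> ('i \<times> 'm) rel" where
  "hom_step J V K Fo Fm =
     {((Dom J u, f), (Cod J u, Fm u \<cdot>\<^bsub>V\<^esub> f)) | u f.
        u \<in> Mor J \<and> f \<in> hom V K (Fo (Dom J u))}"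

definition hom_preserves_colimit ::
  "('i, 'j, 'y) category_data_scheme \<Rightarrow> ('o, 'm, 'z) category_data_scheme \<Rightarrow>
   'o \<Rightarrow> ('i \<Rightarrow> 'o) \<Rightarrow> ('j \<Rightarrow> 'm) \<Rightarrow> 'o \<Rightarrow> ('i \<Rightarrow> 'm) \<Rightarrow> bool" where
  "hom_preserves_colimit J V K Fo Fm X c \<longleftrightarrow>
     bij_betw (\<lambda>q. the_elem ((\<lambda>(i, f). c i \<cdot>\<^bsub>V\<^esub> f) ` q))
       (hom_elements J V K Fo // (hom_step J V K Fo Fm \<union> (hom_step J V K Fo Fm)\<inverse>)\<^sup>*)
       (hom V K X)"

definition presentable ::
  "'u rel \<Rightarrow> 'u rel \<Rightarrow> ('o, 'm, 'z) category_data_scheme \<Rightarrow> 'o \<Rightarrow> bool" where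
  "presentable \<kappa> \<theta> V K \<longleftrightarrow>
     K \<in> Obj V \<and>
     (\<forall>(D :: 'u set) R Fo Fm X c.
        |D| <o \<kappa> \<and> directed_poset \<theta> D R \<and>
        is_functor (poset_category D R) V Fo Fm \<and>
        is_colimit (poset_category D R) V Fo Fm X c \<longrightarrow>
        hom_preserves_colimit (poset_category D R) V K Fo Fm X c)"

definition locally_presentable :: "'u rel \<Rightarrow> ('o, 'm, 'z) category_data_scheme \<Rightarrow> bool" where
  "locally_presentable \<kappa> V \<longleftrightarrow>
     category V \<and> locally_small \<kappa> V \<and> cocomplete \<kappa> V \<and>
     (\<exists>\<theta> :: 'u rel. Cinfinite \<theta> \<and> regularCard \<theta> \<and> \<theta> <o \<kappa> \<and>
       (\<exists>G \<subseteq> Obj V. |G| <o \<kappa> \<and> (\<forall>K \<in> G. presentable \<kappa> \<theta> V K) \<and>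
         (\<forall>X \<in> Obj V. \<exists>(D :: 'u set) R Fo Fm c.
            |D| <o \<kappa> \<and> directed_poset \<theta> D R \<and>
            is_functor (poset_category D R) V Fo Fm \<and> Fo ` D \<subseteq> G \<and>
            is_colimit (poset_category D R) V Fo Fm X c)))"


section \<open>Symmetric monoidal closed categories\<close>

text \<open>
  Closedness is the adjunction \<open>(- \<otimes> x) \<stileturn> [x, -]\<close>, given by its counit
  \<open>evl x y : [x, y] \<otimes> x \<rightarrow> y\<close>.
\<close>

record ('o, 'm) smcc_data = "('o, 'm) category_data" +
  tens :: "'o \<Rightarrow> 'o \<Rightarrow> 'o" (infixr "\<otimes>\<index>" 70)
  tens_mor :: "'m \<Rightarrow> 'm \<Rightarrow> 'm" (infixr "\<boxtimes>\<index>" 70)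
  unit_obj :: 'o ("\<I>\<index>")
  assoc :: "'o \<Rightarrow> 'o \<Rightarrow> 'o \<Rightarrow> 'm"
  lunit :: "'o \<Rightarrow> 'm"
  runit :: "'o \<Rightarrow> 'm"
  braid :: "'o \<Rightarrow> 'o \<Rightarrow> 'm"
  ihom :: "'o \<Rightarrow> 'o \<Rightarrow> 'o"
  evl :: "'o \<Rightarrow> 'o \<Rightarrow> 'm"

locale monoidal_category = category V
  for V :: "('o, 'm, 'z) smcc_data_scheme" (structure) +
  assumes tens_in_Obj: "x \<in> Obj V \<Longrightarrow> y \<in> Obj V \<Longrightarrow> x \<otimes> y \<in> Obj V"
    and tens_mor_in_hom: "f \<in> hom V x x' \<Longrightarrow> g \<in> hom V y y' \<Longrightarrow>
      f \<boxtimes> g \<in> hom V (x \<otimes> y) (x' \<otimes> y')"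
    and tens_Id: "x \<in> Obj V \<Longrightarrow> y \<in> Obj V \<Longrightarrow> Id V x \<boxtimes> Id V y = Id V (x \<otimes> y)"
    and tens_Comp: "f \<in> hom V x x' \<Longrightarrow> f' \<in> hom V x' x'' \<Longrightarrow>
      g \<in> hom V y y' \<Longrightarrow> g' \<in> hom V y' y'' \<Longrightarrow>
      (f' \<cdot> f) \<boxtimes> (g' \<cdot> g) = (f' \<boxtimes> g') \<cdot> (f \<boxtimes> g)"
    and unit_in_Obj: "\<I> \<in> Obj V"
    and assoc_in_hom: "x \<in> Obj V \<Longrightarrow> y \<in> Obj V \<Longrightarrow> z \<in> Obj V \<Longrightarrow>
      assoc V x y z \<in> hom V ((x \<otimes> y) \<otimes> z) (x \<otimes> (y \<otimes> z))"
    and assoc_iso: "x \<in> Obj V \<Longrightarrow> y \<in> Obj V \<Longrightarrow> z \<in> Obj V \<Longrightarrow> iso_mor V (assoc V x y z)"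
    and assoc_natural: "f \<in> hom V x x' \<Longrightarrow> g \<in> hom V y y' \<Longrightarrow> h \<in> hom V z z' \<Longrightarrow>
      assoc V x' y' z' \<cdot> ((f \<boxtimes> g) \<boxtimes> h) = (f \<boxtimes> (g \<boxtimes> h)) \<cdot> assoc V x y z"
    and lunit_in_hom: "x \<in> Obj V \<Longrightarrow> lunit V x \<in> hom V (\<I> \<otimes> x) x"
    and lunit_iso: "x \<in> Obj V \<Longrightarrow> iso_mor V (lunit V x)"
    and lunit_natural: "f \<in> hom V x x' \<Longrightarrow> lunit V x' \<cdot> (Id V \<I> \<boxtimes> f) = f \<cdot> lunit V x"
    and runit_in_hom: "x \<in> Obj V \<Longrightarrow> runit V x \<in> hom V (x \<otimes> \<I>) x"
    and runit_iso: "x \<in> Obj V \<Longrightarrow> iso_mor V (runit V x)"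
    and runit_natural: "f \<in> hom V x x' \<Longrightarrow> runit V x' \<cdot> (f \<boxtimes> Id V \<I>) = f \<cdot> runit V x"
    and pentagon: "w \<in> Obj V \<Longrightarrow> x \<in> Obj V \<Longrightarrow> y \<in> Obj V \<Longrightarrow> z \<in> Obj V \<Longrightarrow>
      assoc V w x (y \<otimes> z) \<cdot> assoc V (w \<otimes> x) y z =
      (Id V w \<boxtimes> assoc V x y z) \<cdot> assoc V w (x \<otimes> y) z \<cdot> (assoc V w x y \<boxtimes> Id V z)"
    and triangle: "x \<in> Obj V \<Longrightarrow> y \<in> Obj V \<Longrightarrow>
      (Id V x \<boxtimes> lunit V y) \<cdot> assoc V x \<I> y = runit V x \<boxtimes> Id V y"

locale symmetric_monoidal_category = monoidal_category V
  for V :: "('o, 'm, 'z) smcc_data_scheme" (structure) +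
  assumes braid_in_hom: "x \<in> Obj V \<Longrightarrow> y \<in> Obj V \<Longrightarrow> braid V x y \<in> hom V (x \<otimes> y) (y \<otimes> x)"
    and braid_natural: "f \<in> hom V x x' \<Longrightarrow> g \<in> hom V y y' \<Longrightarrow>
      braid V x' y' \<cdot> (f \<boxtimes> g) = (g \<boxtimes> f) \<cdot> braid V x y"
    and braid_braid: "x \<in> Obj V \<Longrightarrow> y \<in> Obj V \<Longrightarrow>
      braid V y x \<cdot> braid V x y = Id V (x \<otimes> y)"
    and hexagon: "x \<in> Obj V \<Longrightarrow> y \<in> Obj V \<Longrightarrow> z \<in> Obj V \<Longrightarrow>
      assoc V y z x \<cdot> braid V x (y \<otimes> z) \<cdot> assoc V x y z =
      (Id V y \<boxtimes> braid V x z) \<cdot> assoc V y x z \<cdot> (braid V x y \<boxtimes> Id V z)"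

locale symmetric_monoidal_closed_category = symmetric_monoidal_category V
  for V :: "('o, 'm, 'z) smcc_data_scheme" (structure) +
  assumes ihom_in_Obj: "x \<in> Obj V \<Longrightarrow> y \<in> Obj V \<Longrightarrow> ihom V x y \<in> Obj V"
    and evl_in_hom: "x \<in> Obj V \<Longrightarrow> y \<in> Obj V \<Longrightarrow> evl V x y \<in> hom V (ihom V x y \<otimes> x) y"
    and evl_universal: "x \<in> Obj V \<Longrightarrow> y \<in> Obj V \<Longrightarrow> z \<in> Obj V \<Longrightarrow> f \<in> hom V (z \<otimes> x) y \<Longrightarrow>
      \<exists>!g. g \<in> hom V z (ihom V x y) \<and> evl V x y \<cdot> (g \<boxtimes> Id V x) = f"


section \<open>Monoids, comonoids and bimonoids\<close>

record ('o, 'm) mon =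
  mcarr :: 'o
  mmult :: 'm
  munit :: 'm

record ('o, 'm) comon =
  ccarr :: 'o
  ccomult :: 'm
  ccounit :: 'm

record ('o, 'm) bimon =
  bcarr :: 'o
  bmult :: 'm
  bunit :: 'm
  bcomult :: 'm
  bcounit :: 'm

definition mon_of :: "('o, 'm) bimon \<Rightarrow> ('o, 'm) mon" where
  "mon_of B = \<lparr>mcarr = bcarr B, mmult = bmult B, munit = bunit B\<rparr>"

definition comon_of :: "('o, 'm) bimon \<Rightarrow> ('o, 'm) comon" where
  "comon_of B = \<lparr>ccarr = bcarr B, ccomult = bcomult B, ccounit = bcounit B\<rparr>"

context
  fixes V :: "('o, 'm, 'z) smcc_data_scheme" (structure)
begin

definition is_monoid :: "('o, 'm) mon \<Rightarrow> bool" where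
  "is_monoid M \<longleftrightarrow>
     (let a = mcarr M; \<mu> = mmult M; \<iota> = munit M in
        a \<in> Obj V \<and> \<mu> \<in> hom V (a \<otimes> a) a \<and> \<iota> \<in> hom V \<I> a \<and>
        \<mu> \<cdot> (\<mu> \<boxtimes> Id V a) = \<mu> \<cdot> (Id V a \<boxtimes> \<mu>) \<cdot> assoc V a a a \<and>
        \<mu> \<cdot> (\<iota> \<boxtimes> Id V a) = lunit V a \<and>
        \<mu> \<cdot> (Id V a \<boxtimes> \<iota>) = runit V a)"

definition commutative :: "('o, 'm) mon \<Rightarrow> bool" where
  "commutative M \<longleftrightarrow> mmult M \<cdot> braid V (mcarr M) (mcarr M) = mmult M"

definition is_comonoid :: "('o, 'm) comon \<Rightarrow> bool" where
  "is_comonoid C \<longleftrightarrow>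
     (let c = ccarr C; \<delta> = ccomult C; \<epsilon> = ccounit C in
        c \<in> Obj V \<and> \<delta> \<in> hom V c (c \<otimes> c) \<and> \<epsilon> \<in> hom V c \<I> \<and>
        assoc V c c c \<cdot> (\<delta> \<boxtimes> Id V c) \<cdot> \<delta> = (Id V c \<boxtimes> \<delta>) \<cdot> \<delta> \<and>
        lunit V c \<cdot> (\<epsilon> \<boxtimes> Id V c) \<cdot> \<delta> = Id V c \<and>
        runit V c \<cdot> (Id V c \<boxtimes> \<epsilon>) \<cdot> \<delta> = Id V c)"

definition cocommutative :: "('o, 'm) comon \<Rightarrow> bool" where
  "cocommutative C \<longleftrightarrow> braid V (ccarr C) (ccarr C) \<cdot> ccomult C = ccomult C"

definition mon_hom :: "('o, 'm) mon \<Rightarrow> ('o, 'm) mon \<Rightarrow> 'm set" where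
  "mon_hom M N =
     {f \<in> hom V (mcarr M) (mcarr N).
        f \<cdot> mmult M = mmult N \<cdot> (f \<boxtimes> f) \<and> f \<cdot> munit M = munit N}"

definition comon_hom :: "('o, 'm) comon \<Rightarrow> ('o, 'm) comon \<Rightarrow> 'm set" where
  "comon_hom C D =
     {f \<in> hom V (ccarr C) (ccarr D).
        ccomult D \<cdot> f = (f \<boxtimes> f) \<cdot> ccomult C \<and> ccounit D \<cdot> f = ccounit C}"

definition unit_mon :: "('o, 'm) mon" where
  "unit_mon = \<lparr>mcarr = \<I>, mmult = lunit V \<I>, munit = Id V \<I>\<rparr>"

definition unit_comon :: "('o, 'm) comon" where
  "unit_comon = \<lparr>ccarr = \<I>, ccomult = inv_mor V (lunit V \<I>), ccounit = Id V \<I>\<rparr>"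

text \<open>The canonical isomorphism \<open>(a \<otimes> b) \<otimes> (c \<otimes> d) \<rightarrow> (a \<otimes> c) \<otimes> (b \<otimes> d)\<close>.\<close>

definition interchange :: "'o \<Rightarrow> 'o \<Rightarrow> 'o \<Rightarrow> 'o \<Rightarrow> 'm" where
  "interchange a b c d =
     inv_mor V (assoc V a c (b \<otimes> d)) \<cdot>
     (Id V a \<boxtimes> (assoc V c b d \<cdot> (braid V b c \<boxtimes> Id V d) \<cdot> inv_mor V (assoc V b c d))) \<cdot>
     assoc V a b (c \<otimes> d)"

definition tens_mon :: "('o, 'm) mon \<Rightarrow> ('o, 'm) mon \<Rightarrow> ('o, 'm) mon" where
  "tens_mon M N =
     \<lparr>mcarr = mcarr M \<otimes> mcarr N,
      mmult = (mmult M \<boxtimes> mmult N) \<cdot> interchange (mcarr M) (mcarr N) (mcarr M) (mcarr N),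
      munit = (munit M \<boxtimes> munit N) \<cdot> inv_mor V (lunit V \<I>)\<rparr>"

definition tens_comon :: "('o, 'm) comon \<Rightarrow> ('o, 'm) comon \<Rightarrow> ('o, 'm) comon" where
  "tens_comon C D =
     \<lparr>ccarr = ccarr C \<otimes> ccarr D,
      ccomult = interchange (ccarr C) (ccarr C) (ccarr D) (ccarr D) \<cdot> (ccomult C \<boxtimes> ccomult D),
      ccounit = lunit V \<I> \<cdot> (ccounit C \<boxtimes> ccounit D)\<rparr>"

definition is_bimonoid :: "('o, 'm) bimon \<Rightarrow> bool" where
  "is_bimonoid B \<longleftrightarrow>
     is_monoid (mon_of B) \<and> is_comonoid (comon_of B) \<and>
     bcomult B \<in> mon_hom (mon_of B) (tens_mon (mon_of B) (mon_of B)) \<and>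
     bcounit B \<in> mon_hom (mon_of B) unit_mon"


section \<open>Convolution and universal measuring comonoids\<close>

text \<open>The transpose \<open>z \<rightarrow> [x, y]\<close> of \<open>f : z \<otimes> x \<rightarrow> y\<close>.\<close>

definition transpose :: "'o \<Rightarrow> 'o \<Rightarrow> 'o \<Rightarrow> 'm \<Rightarrow> 'm" where
  "transpose z x y f =
     (THE g. g \<in> hom V z (ihom V x y) \<and> evl V x y \<cdot> (g \<boxtimes> Id V x) = f)"

text \<open>\<open>[f, g] : [x, y] \<rightarrow> [x', y']\<close> for \<open>f : x' \<rightarrow> x\<close> and \<open>g : y \<rightarrow> y'\<close>.\<close>

definition ihom_mor :: "'m \<Rightarrow> 'm \<Rightarrow> 'm" where
  "ihom_mor f g =
     (let x = Cod V f; x' = Dom V f; y = Dom V g; y' = Cod V g in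
        transpose (ihom V x y) x' y' (g \<cdot> evl V x y \<cdot> (Id V (ihom V x y) \<boxtimes> f)))"

text \<open>The canonical morphism \<open>[x, y] \<otimes> [x', y'] \<rightarrow> [x \<otimes> x', y \<otimes> y']\<close>.\<close>

definition ihom_tens :: "'o \<Rightarrow> 'o \<Rightarrow> 'o \<Rightarrow> 'o \<Rightarrow> 'm" where
  "ihom_tens x y x' y' =
     transpose (ihom V x y \<otimes> ihom V x' y') (x \<otimes> x') (y \<otimes> y')
       ((evl V x y \<boxtimes> evl V x' y') \<cdot> interchange (ihom V x y) (ihom V x' y') x x')"

text \<open>The canonical isomorphism \<open>y \<rightarrow> [I, y]\<close>.\<close>

definition to_ihom_unit :: "'o \<Rightarrow> 'm" where
  "to_ihom_unit y = transpose y \<I> y (runit V y)"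

text \<open>The unit of \<open>[C, A]\<close> is \<open>I \<cong> [I, I] \<rightarrow> [C, A]\<close>, induced by the counit of \<open>C\<close> and the unit
  of \<open>A\<close>.\<close>

definition convolution :: "('o, 'm) comon \<Rightarrow> ('o, 'm) mon \<Rightarrow> ('o, 'm) mon" where
  "convolution C A =
     \<lparr>mcarr = ihom V (ccarr C) (mcarr A),
      mmult = ihom_mor (ccomult C) (mmult A) \<cdot>
        ihom_tens (ccarr C) (mcarr A) (ccarr C) (mcarr A),
      munit = ihom_mor (ccounit C) (munit A) \<cdot> to_ihom_unit \<I>\<rparr>"

text \<open>
  \<open>P\<close> is the universal measuring comonoid \<open>P(B, A)\<close>, exhibited by a family of bijections
  \<open>\<Phi> C : Comon(C, P) \<rightarrow> Mon(B, [C, A])\<close> natural in the comonoid \<open>C\<close>.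
\<close>

definition universal_measuring_comonoid ::
  "('o, 'm) mon \<Rightarrow> ('o, 'm) mon \<Rightarrow> ('o, 'm) comon \<Rightarrow>
   (('o, 'm) comon \<Rightarrow> 'm \<Rightarrow> 'm) \<Rightarrow> bool" where
  "universal_measuring_comonoid B A P \<Phi> \<longleftrightarrow>
     is_comonoid P \<and>
     (\<forall>C. is_comonoid C \<longrightarrow>
        bij_betw (\<Phi> C) (comon_hom C P) (mon_hom B (convolution C A))) \<and>
     (\<forall>C D. is_comonoid C \<and> is_comonoid D \<longrightarrow>
        (\<forall>h \<in> comon_hom D C. \<forall>g \<in> comon_hom C P.
           \<Phi> D (g \<cdot> h) = ihom_mor h (Id V (mcarr A)) \<cdot> \<Phi> C g))"

text \<open>The finite dual is \<open>B\<degree> = P(B, I)\<close>.\<close>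

definition finite_dual ::
  "('o, 'm) mon \<Rightarrow> ('o, 'm) comon \<Rightarrow> (('o, 'm) comon \<Rightarrow> 'm \<Rightarrow> 'm) \<Rightarrow> bool" where
  "finite_dual B P \<Phi> \<longleftrightarrow> universal_measuring_comonoid B unit_mon P \<Phi>"

text \<open>The morphisms \<open>B \<rightarrow> [P \<otimes> P, A]\<close> and \<open>B \<rightarrow> [I, A]\<close> that correspond to the multiplication and
  unit of \<open>P\<close>; here \<open>\<eta> = \<Phi> P (Id P) : B \<rightarrow> [P, A]\<close>.\<close>

definition measuring_mult ::
  "('o, 'm) bimon \<Rightarrow> ('o, 'm) mon \<Rightarrow> ('o, 'm) comon \<Rightarrow>
   (('o, 'm) comon \<Rightarrow> 'm \<Rightarrow> 'm) \<Rightarrow> 'm" where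
  "measuring_mult B A P \<Phi> =
     (let p = ccarr P; a = mcarr A; \<eta> = \<Phi> P (Id V p) in
        ihom_mor (Id V (p \<otimes> p)) (mmult A) \<cdot> ihom_tens p a p a \<cdot> (\<eta> \<boxtimes> \<eta>) \<cdot> bcomult B)"

definition measuring_unit :: "('o, 'm) bimon \<Rightarrow> ('o, 'm) mon \<Rightarrow> 'm" where
  "measuring_unit B A = to_ihom_unit (mcarr A) \<cdot> munit A \<cdot> bcounit B"

definition canonical_bimonoid ::
  "('o, 'm) bimon \<Rightarrow> ('o, 'm) mon \<Rightarrow> ('o, 'm) comon \<Rightarrow>
   (('o, 'm) comon \<Rightarrow> 'm \<Rightarrow> 'm) \<Rightarrow> ('o, 'm) bimon" where
  "canonical_bimonoid B A P \<Phi> =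
     \<lparr>bcarr = ccarr P,
      bmult = the_inv_into (comon_hom (tens_comon P P) P) (\<Phi> (tens_comon P P))
        (measuring_mult B A P \<Phi>),
      bunit = the_inv_into (comon_hom unit_comon P) (\<Phi> unit_comon) (measuring_unit B A),
      bcomult = ccomult P,
      bcounit = ccounit P\<rparr>"

text \<open>
  The inverse images in \<open>canonical_bimonoid\<close> are meaningful only if the two morphisms above are
  morphisms of monoids, so this is part of the claim.
\<close>

definition has_canonical_bimonoid_structure ::
  "('o, 'm) bimon \<Rightarrow> ('o, 'm) mon \<Rightarrow> ('o, 'm) comon \<Rightarrow>
   (('o, 'm) comon \<Rightarrow> 'm \<Rightarrow> 'm) \<Rightarrow> bool" where
  "has_canonical_bimonoid_structure B A P \<Phi> \<longleftrightarrow>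
     is_comonoid (tens_comon P P) \<and>
     measuring_mult B A P \<Phi> \<in> mon_hom (mon_of B) (convolution (tens_comon P P) A) \<and>
     is_comonoid unit_comon \<and>
     measuring_unit B A \<in> mon_hom (mon_of B) (convolution unit_comon A) \<and>
     is_bimonoid (canonical_bimonoid B A P \<Phi>)"

end

end

theory Submission
  imports Defs
begin

text \<open>
  By closedness, monoid morphisms \<open>B \<rightarrow> [C, A]\<close> are the same as measuring morphisms \<open>B \<otimes> C \<rightarrow> A\<close>, and
  the universal one \<open>\<psi> : B \<otimes> P \<rightarrow> A\<close> makes \<open>g \<mapsto> \<psi> \<cdot> (1 \<otimes> g)\<close> injective on comonoid morphisms
  \<open>C \<rightarrow> P\<close>. The multiplication \<open>m\<close> and unit \<open>u\<close> of \<open>P\<close> are comonoid morphisms by construction, which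
  is the compatibility part of the bimonoid axioms; associativity, unitality and commutativity are
  equations between comonoid morphisms into \<open>P\<close>, so they may be checked after composing with \<open>\<psi>\<close>,
  where they reduce to the (co)monoid laws of \<open>A\<close> and \<open>B\<close>. The remaining rebracketings and
  permutations of tensor factors are settled by a coherence theorem: a canonical morphism
  between shapes with distinct leaves is determined by its domain and codomain.
\<close>

section \<open>Computing in monoidal categories\<close>

text \<open>Two difficulties shape the development. The first is order: expanding a product of
  measuring morphisms at \<open>x y\<close> with \<open>x, y\<close> in \<open>B\<close> yields four
  values in \<open>A\<close> whose middle two stand in the wrong order, and commutativity of
  \<open>A\<close> is what exchanges them. For commutativity of \<open>P\<close> the two values must
  be exchanged in \<open>A\<close> and the two halves of the coproduct exchanged in
  \<open>B\<close>, hence the extra assumption on \<open>B\<close>. The second is bookkeeping: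
  nothing is strict, so regroupings of up to eight factors are genuine isomorphisms, and the objects
  in them repeat. With repeated objects, domain and codomain do not determine a canonical morphism:
  \<open>braid V x x\<close> and the identity of \<open>x \<otimes> x\<close> are both canonical.
  Formal leaves are therefore numbers used once each, and repetition enters only through the
  environment that interprets them. For coherence itself, shapes are flattened to right-nested
  lists, so that only a permutation of names is left; its relations come down to the Yang-Baxter
  equation and to \<open>swap\<close> being an involution.\<close>

context category
begin

lemma hom_iff: "f \<in> hom V x y \<longleftrightarrow> f \<in> Mor V \<and> Dom V f = x \<and> Cod V f = y"
  by (simp add: hom_def)

lemma Mor_in_hom: "f \<in> Mor V \<Longrightarrow> f \<in> hom V (Dom V f) (Cod V f)"
  by (simp add: hom_def)

lemma Id_simps [simp]:
  assumes "x \<in> Obj V"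
  shows "Id V x \<in> Mor V" "Dom V (Id V x) = x" "Cod V (Id V x) = x"
  using Id_in_hom[OF assms] by (auto simp: hom_def)

lemma Comp_simps [simp]:
  assumes "f \<in> Mor V" "g \<in> Mor V" "Cod V f = Dom V g"
  shows "g \<cdot> f \<in> Mor V" "Dom V (g \<cdot> f) = Dom V f" "Cod V (g \<cdot> f) = Cod V g"
  using Comp_in_hom[of f "Dom V f" "Dom V g" g "Cod V g"] assms by (auto simp: hom_def)

lemma Mor_Obj [simp]:
  assumes "f \<in> Mor V"
  shows "Dom V f \<in> Obj V" "Cod V f \<in> Obj V"
  using assms Dom_in_Obj Cod_in_Obj by auto

lemma Comp_Id_simp [simp]: "f \<in> Mor V \<Longrightarrow> Dom V f = x \<Longrightarrow> f \<cdot> Id V x = f"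
  using Comp_Id[OF Mor_in_hom] by blast

lemma Id_Comp_simp [simp]: "f \<in> Mor V \<Longrightarrow> Cod V f = x \<Longrightarrow> Id V x \<cdot> f = f"
  using Id_Comp[OF Mor_in_hom] by blast

lemma Comp_assoc_simp [simp]:
  assumes "f \<in> Mor V" "g \<in> Mor V" "h \<in> Mor V" "Cod V f = Dom V g" "Cod V g = Dom V h"
  shows "(h \<cdot> g) \<cdot> f = h \<cdot> (g \<cdot> f)"
  using Comp_assoc[of f "Dom V f" "Dom V g" g "Dom V h" h "Cod V h"] assms by (auto simp: hom_def)

text \<open>Composites are kept nested to the right, where a two-factor rule
  \<open>g \<cdot> f = k\<close> no longer matches once a further morphism stands to the right of
  \<open>f\<close>. This form supplies the missing tail; the \<open>_extend\<close> lemmas below are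
  instances of it.\<close>

lemma Comp_extend:
  assumes "g \<cdot> f = k" "f \<in> Mor V" "g \<in> Mor V" "Cod V f = Dom V g" "h \<in> Mor V" "Cod V h = Dom V f"
  shows "g \<cdot> (f \<cdot> h) = k \<cdot> h"
  using Comp_assoc_simp[of h f g] assms by simp

lemma inverse_mors_unique:
  assumes "inverse_mors V f g" "inverse_mors V f g'"
  shows "g = g'"
proof -
  note ms = assms[unfolded inverse_mors_def hom_iff]
  have "g = g \<cdot> (f \<cdot> g')" using ms by simp
  also have "\<dots> = (g \<cdot> f) \<cdot> g'" by (rule Comp_assoc_simp[symmetric]) (use ms in auto)
  also have "\<dots> = g'" using ms by (metis Id_Comp_simp)
  finally show ?thesis .
qed

lemma inv_mor_eq: "inverse_mors V f g \<Longrightarrow> inv_mor V f = g"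
  unfolding inv_mor_def by (rule the_equality) (auto intro: inverse_mors_unique)

lemma iso_inverse: "iso_mor V f \<Longrightarrow> inverse_mors V f (inv_mor V f)"
  unfolding iso_mor_def using inv_mor_eq by metis

lemma iso_simps:
  assumes "iso_mor V f"
  shows "inv_mor V f \<in> Mor V" "Dom V (inv_mor V f) = Cod V f" "Cod V (inv_mor V f) = Dom V f"
    "inv_mor V f \<cdot> f = Id V (Dom V f)" "f \<cdot> inv_mor V f = Id V (Cod V f)"
  using iso_inverse[OF assms] by (auto simp: inverse_mors_def hom_def)

lemma iso_Mor: "iso_mor V f \<Longrightarrow> f \<in> Mor V"
  by (auto simp: iso_mor_def inverse_mors_def)

lemma iso_cancel:
  assumes "iso_mor V f" "h \<in> Mor V"
  shows "Cod V h = Dom V f \<Longrightarrow> inv_mor V f \<cdot> (f \<cdot> h) = h"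
    "Cod V h = Cod V f \<Longrightarrow> f \<cdot> (inv_mor V f \<cdot> h) = h"
proof -
  note [simp] = iso_simps[OF assms(1)] iso_Mor[OF assms(1)] assms(2)
  show "Cod V h = Dom V f \<Longrightarrow> inv_mor V f \<cdot> (f \<cdot> h) = h"
    by (subst Comp_extend[OF iso_simps(4)[OF assms(1)]]) simp_all
  show "Cod V h = Cod V f \<Longrightarrow> f \<cdot> (inv_mor V f \<cdot> h) = h"
    by (subst Comp_extend[OF iso_simps(5)[OF assms(1)]]) simp_all
qed

lemma iso_monic:
  assumes "f \<cdot> g = f \<cdot> h" "iso_mor V f" "g \<in> Mor V" "h \<in> Mor V" "Cod V g = Dom V f" "Cod V h = Dom V f"
  shows "g = h"
  using iso_cancel(1)[of f g] iso_cancel(1)[of f h] assms by metis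

lemma iso_epic:
  assumes "g \<cdot> f = h \<cdot> f" "iso_mor V f" "g \<in> Mor V" "h \<in> Mor V" "Dom V g = Cod V f" "Dom V h = Cod V f"
  shows "g = h"
proof -
  have "(g \<cdot> f) \<cdot> inv_mor V f = (h \<cdot> f) \<cdot> inv_mor V f" using assms(1) by simp
  then show ?thesis using assms(2-) iso_simps[OF assms(2)] iso_Mor[OF assms(2)] by simp
qed

lemma Comp_iso [simp]:
  assumes "iso_mor V f" "iso_mor V g" "Cod V f = Dom V g"
  shows "iso_mor V (g \<cdot> f)"
proof -
  note [simp] = iso_simps[OF assms(1)] iso_simps[OF assms(2)] iso_Mor[OF assms(1)] iso_Mor[OF assms(2)]
    iso_cancel[OF assms(1)] iso_cancel[OF assms(2)]
  have "inverse_mors V (g \<cdot> f) (inv_mor V f \<cdot> inv_mor V g)"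
    using assms(3) by (simp add: inverse_mors_def hom_iff)
  then show ?thesis by (auto simp: iso_mor_def)
qed

lemma inv_mor_iso: "iso_mor V f \<Longrightarrow> iso_mor V (inv_mor V f)"
  using iso_simps[of f] iso_Mor[of f] by (auto simp: iso_mor_def[of V "inv_mor V f"] inverse_mors_def hom_iff)

end

section \<open>Monoidal categories: consequences of pentagon and triangle\<close>

context monoidal_category
begin

abbreviation assoc_inv where "assoc_inv x y z \<equiv> inv_mor V (assoc V x y z)"
abbreviation lunit_inv where "lunit_inv x \<equiv> inv_mor V (lunit V x)"
abbreviation runit_inv where "runit_inv x \<equiv> inv_mor V (runit V x)"

lemma tens_Obj [simp]: "x \<in> Obj V \<Longrightarrow> y \<in> Obj V \<Longrightarrow> x \<otimes> y \<in> Obj V"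
  by (rule tens_in_Obj)

lemma unit_Obj [simp]: "\<I> \<in> Obj V"
  by (rule unit_in_Obj)

lemma tens_mor_simps [simp]:
  assumes "f \<in> Mor V" "g \<in> Mor V"
  shows "f \<boxtimes> g \<in> Mor V" "Dom V (f \<boxtimes> g) = Dom V f \<otimes> Dom V g" "Cod V (f \<boxtimes> g) = Cod V f \<otimes> Cod V g"
  using tens_mor_in_hom[OF Mor_in_hom Mor_in_hom, OF assms] by (auto simp: hom_def)

lemma tens_Id_simp [simp]: "x \<in> Obj V \<Longrightarrow> y \<in> Obj V \<Longrightarrow> Id V x \<boxtimes> Id V y = Id V (x \<otimes> y)"
  by (rule tens_Id)

text \<open>Oriented so that parallel tensors merge: both sides of a calculation normalise to one
  tensor of composites, and \<open>simp\<close> can check a step that splits a tensor in order to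
  expose a factor.\<close>

lemma tens_Comp_simp [simp]:
  assumes "f \<in> Mor V" "f' \<in> Mor V" "g \<in> Mor V" "g' \<in> Mor V" "Cod V f = Dom V f'" "Cod V g = Dom V g'"
  shows "(f' \<boxtimes> g') \<cdot> (f \<boxtimes> g) = (f' \<cdot> f) \<boxtimes> (g' \<cdot> g)"
  using tens_Comp[of f "Dom V f" "Dom V f'" f' "Cod V f'" g "Dom V g" "Dom V g'" g' "Cod V g'"] assms
  by (auto simp: hom_def)

lemma tens_Comp_extend [simp]:
  assumes "f \<in> Mor V" "f' \<in> Mor V" "g \<in> Mor V" "g' \<in> Mor V" "Cod V f = Dom V f'" "Cod V g = Dom V g'"
    "k \<in> Mor V" "Cod V k = Dom V f \<otimes> Dom V g"
  shows "(f' \<boxtimes> g') \<cdot> ((f \<boxtimes> g) \<cdot> k) = ((f' \<cdot> f) \<boxtimes> (g' \<cdot> g)) \<cdot> k"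
  by (rule Comp_extend[OF tens_Comp_simp]) (use assms in simp_all)

lemma assoc_simps [simp]:
  assumes "x \<in> Obj V" "y \<in> Obj V" "z \<in> Obj V"
  shows "assoc V x y z \<in> Mor V" "Dom V (assoc V x y z) = (x \<otimes> y) \<otimes> z"
    "Cod V (assoc V x y z) = x \<otimes> (y \<otimes> z)" "iso_mor V (assoc V x y z)"
  using assoc_in_hom[OF assms] assoc_iso[OF assms] by (auto simp: hom_def)

lemma lunit_simps [simp]:
  assumes "x \<in> Obj V"
  shows "lunit V x \<in> Mor V" "Dom V (lunit V x) = \<I> \<otimes> x" "Cod V (lunit V x) = x"
    "iso_mor V (lunit V x)"
  using lunit_in_hom[OF assms] lunit_iso[OF assms] by (auto simp: hom_def)

lemma runit_simps [simp]:
  assumes "x \<in> Obj V"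
  shows "runit V x \<in> Mor V" "Dom V (runit V x) = x \<otimes> \<I>" "Cod V (runit V x) = x"
    "iso_mor V (runit V x)"
  using runit_in_hom[OF assms] runit_iso[OF assms] by (auto simp: hom_def)

lemma inv_simps [simp]:
  assumes "x \<in> Obj V"
  shows "y \<in> Obj V \<Longrightarrow> z \<in> Obj V \<Longrightarrow> assoc_inv x y z \<in> Mor V"
    "y \<in> Obj V \<Longrightarrow> z \<in> Obj V \<Longrightarrow> Dom V (assoc_inv x y z) = x \<otimes> (y \<otimes> z)"
    "y \<in> Obj V \<Longrightarrow> z \<in> Obj V \<Longrightarrow> Cod V (assoc_inv x y z) = (x \<otimes> y) \<otimes> z"
    "y \<in> Obj V \<Longrightarrow> z \<in> Obj V \<Longrightarrow> assoc_inv x y z \<cdot> assoc V x y z = Id V ((x \<otimes> y) \<otimes> z)"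
    "y \<in> Obj V \<Longrightarrow> z \<in> Obj V \<Longrightarrow> assoc V x y z \<cdot> assoc_inv x y z = Id V (x \<otimes> (y \<otimes> z))"
    "lunit_inv x \<in> Mor V" "Dom V (lunit_inv x) = x" "Cod V (lunit_inv x) = \<I> \<otimes> x"
    "lunit_inv x \<cdot> lunit V x = Id V (\<I> \<otimes> x)" "lunit V x \<cdot> lunit_inv x = Id V x"
    "runit_inv x \<in> Mor V" "Dom V (runit_inv x) = x" "Cod V (runit_inv x) = x \<otimes> \<I>"
    "runit_inv x \<cdot> runit V x = Id V (x \<otimes> \<I>)" "runit V x \<cdot> runit_inv x = Id V x"
  using assms by (simp_all add: iso_simps)

lemma inv_cancel [simp]:
  assumes "x \<in> Obj V" "h \<in> Mor V"
  shows "y \<in> Obj V \<Longrightarrow> z \<in> Obj V \<Longrightarrow> Cod V h = (x \<otimes> y) \<otimes> z \<Longrightarrow> assoc_inv x y z \<cdot> (assoc V x y z \<cdot> h) = h"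
    "y \<in> Obj V \<Longrightarrow> z \<in> Obj V \<Longrightarrow> Cod V h = x \<otimes> (y \<otimes> z) \<Longrightarrow> assoc V x y z \<cdot> (assoc_inv x y z \<cdot> h) = h"
    "Cod V h = \<I> \<otimes> x \<Longrightarrow> lunit_inv x \<cdot> (lunit V x \<cdot> h) = h"
    "Cod V h = x \<Longrightarrow> lunit V x \<cdot> (lunit_inv x \<cdot> h) = h"
    "Cod V h = x \<otimes> \<I> \<Longrightarrow> runit_inv x \<cdot> (runit V x \<cdot> h) = h"
    "Cod V h = x \<Longrightarrow> runit V x \<cdot> (runit_inv x \<cdot> h) = h"
  using assms by (simp_all add: iso_cancel)

lemma assoc_nat:
  assumes "f \<in> Mor V" "g \<in> Mor V" "h \<in> Mor V" "Cod V f = x" "Cod V g = y" "Cod V h = z"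
  shows "assoc V x y z \<cdot> ((f \<boxtimes> g) \<boxtimes> h) = (f \<boxtimes> (g \<boxtimes> h)) \<cdot> assoc V (Dom V f) (Dom V g) (Dom V h)"
  using assoc_natural[OF Mor_in_hom Mor_in_hom Mor_in_hom] assms by auto

lemma lunit_nat: "f \<in> Mor V \<Longrightarrow> Cod V f = x \<Longrightarrow> lunit V x \<cdot> (Id V \<I> \<boxtimes> f) = f \<cdot> lunit V (Dom V f)"
  using lunit_natural[OF Mor_in_hom] by auto

lemma runit_nat: "f \<in> Mor V \<Longrightarrow> Cod V f = x \<Longrightarrow> runit V x \<cdot> (f \<boxtimes> Id V \<I>) = f \<cdot> runit V (Dom V f)"
  using runit_natural[OF Mor_in_hom] by auto

lemma tens_iso [simp]:
  assumes "iso_mor V f" "iso_mor V g"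
  shows "iso_mor V (f \<boxtimes> g)"
proof -
  note [simp] = iso_simps[OF assms(1)] iso_simps[OF assms(2)] iso_Mor[OF assms(1)] iso_Mor[OF assms(2)]
  have "inverse_mors V (f \<boxtimes> g) (inv_mor V f \<boxtimes> inv_mor V g)"
    by (simp add: inverse_mors_def hom_iff)
  then show ?thesis by (auto simp: iso_mor_def)
qed

lemma Id_iso [simp]: "x \<in> Obj V \<Longrightarrow> iso_mor V (Id V x)"
  by (auto simp: iso_mor_def inverse_mors_def hom_iff intro!: exI[of _ "Id V x"])

text \<open>\<open>runit\<close> is a natural isomorphism from \<open>- \<otimes> \<I>\<close> to
  the identity functor, so tensoring with \<open>\<I>\<close> is faithful. The unit laws below are
  derived after such a tensoring, where the coherence axioms apply.\<close>

lemma tens_unit_faithful: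
  assumes "f \<boxtimes> Id V \<I> = g \<boxtimes> Id V \<I>" "f \<in> Mor V" "g \<in> Mor V" "Dom V f = Dom V g" "Cod V f = Cod V g"
  shows "f = g"
proof (rule iso_epic[where f = "runit V (Dom V f)"])
  show "f \<cdot> runit V (Dom V f) = g \<cdot> runit V (Dom V f)"
    using runit_nat[of f "Cod V f"] runit_nat[of g "Cod V f"] assms by simp
qed (use assms in auto)

lemma unit_tens_faithful:
  assumes "Id V \<I> \<boxtimes> f = Id V \<I> \<boxtimes> g" "f \<in> Mor V" "g \<in> Mor V" "Dom V f = Dom V g" "Cod V f = Cod V g"
  shows "f = g"
proof (rule iso_epic[where f = "lunit V (Dom V f)"])
  show "f \<cdot> lunit V (Dom V f) = g \<cdot> lunit V (Dom V f)"
    using lunit_nat[of f "Cod V f"] lunit_nat[of g "Cod V f"] assms by simp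
qed (use assms in auto)

lemma pentagon_extend:
  assumes "w \<in> Obj V" "x \<in> Obj V" "y \<in> Obj V" "z \<in> Obj V"
    and "k \<in> Mor V" "Cod V k = ((w \<otimes> x) \<otimes> y) \<otimes> z"
  shows "assoc V w x (y \<otimes> z) \<cdot> assoc V (w \<otimes> x) y z \<cdot> k =
      (Id V w \<boxtimes> assoc V x y z) \<cdot> assoc V w (x \<otimes> y) z \<cdot> (assoc V w x y \<boxtimes> Id V z) \<cdot> k"
  by (subst Comp_extend[OF pentagon]) (use assms in simp_all)

lemma triangle_extend:
  assumes "x \<in> Obj V" "y \<in> Obj V" "k \<in> Mor V" "Cod V k = (x \<otimes> \<I>) \<otimes> y"
  shows "(Id V x \<boxtimes> lunit V y) \<cdot> assoc V x \<I> y \<cdot> k = (runit V x \<boxtimes> Id V y) \<cdot> k"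
  by (subst Comp_extend[OF triangle]) (use assms in simp_all)

lemma assoc_nat_extend:
  assumes "f \<in> Mor V" "g \<in> Mor V" "h \<in> Mor V" "Cod V f = x" "Cod V g = y" "Cod V h = z"
    and "k \<in> Mor V" "Cod V k = (Dom V f \<otimes> Dom V g) \<otimes> Dom V h"
  shows "assoc V x y z \<cdot> ((f \<boxtimes> g) \<boxtimes> h) \<cdot> k =
    (f \<boxtimes> (g \<boxtimes> h)) \<cdot> assoc V (Dom V f) (Dom V g) (Dom V h) \<cdot> k"
  by (subst Comp_extend[OF assoc_nat[OF assms(1-6)]]) (use assms in auto)

text \<open>Kelly's argument: after tensoring with \<open>\<I>\<close> on the left, the pentagon for
  \<open>\<I>, \<I>, x, y\<close> and two triangles give the equation up to the isomorphism
  \<open>?k\<close>, which is cancelled.\<close>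

lemma lunit_tens:
  assumes [simp]: "x \<in> Obj V" "y \<in> Obj V"
  shows "lunit V (x \<otimes> y) \<cdot> assoc V \<I> x y = lunit V x \<boxtimes> Id V y"
proof (rule unit_tens_faithful)
  let ?k = "assoc V \<I> (\<I> \<otimes> x) y \<cdot> (assoc V \<I> \<I> x \<boxtimes> Id V y)"
  have "(Id V \<I> \<boxtimes> (lunit V (x \<otimes> y) \<cdot> assoc V \<I> x y)) \<cdot> ?k
      = (Id V \<I> \<boxtimes> lunit V (x \<otimes> y)) \<cdot> assoc V \<I> \<I> (x \<otimes> y) \<cdot> assoc V (\<I> \<otimes> \<I>) x y"
    by (simp add: pentagon)
  also have "\<dots> = (runit V \<I> \<boxtimes> (Id V x \<boxtimes> Id V y)) \<cdot> assoc V (\<I> \<otimes> \<I>) x y"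
    by (simp add: triangle_extend)
  also have "\<dots> = assoc V \<I> x y \<cdot> ((runit V \<I> \<boxtimes> Id V x) \<boxtimes> Id V y)"
    by (subst assoc_nat) simp_all
  also have "\<dots> = assoc V \<I> x y \<cdot> ((Id V \<I> \<boxtimes> lunit V x) \<boxtimes> Id V y) \<cdot> (assoc V \<I> \<I> x \<boxtimes> Id V y)"
    by (simp add: triangle)
  also have "\<dots> = (Id V \<I> \<boxtimes> (lunit V x \<boxtimes> Id V y)) \<cdot> ?k"
    by (subst assoc_nat_extend) simp_all
  finally show "Id V \<I> \<boxtimes> (lunit V (x \<otimes> y) \<cdot> assoc V \<I> x y) = Id V \<I> \<boxtimes> (lunit V x \<boxtimes> Id V y)"
    by (rule iso_epic) simp_all
qed simp_all

text \<open>Mirror image of \<open>lunit_tens\<close>, from the pentagon for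
  \<open>x, y, \<I>, \<I>\<close>; here \<open>assoc V x y \<I>\<close> is cancelled on the
  left.\<close>

lemma runit_tens:
  assumes [simp]: "x \<in> Obj V" "y \<in> Obj V"
  shows "(Id V x \<boxtimes> runit V y) \<cdot> assoc V x y \<I> = runit V (x \<otimes> y)"
proof (rule tens_unit_faithful)
  have "assoc V x y \<I> \<cdot> (runit V (x \<otimes> y) \<boxtimes> Id V \<I>)
      = assoc V x y \<I> \<cdot> ((Id V x \<boxtimes> Id V y) \<boxtimes> lunit V \<I>) \<cdot> assoc V (x \<otimes> y) \<I> \<I>"
    by (simp add: triangle)
  also have "\<dots> = (Id V x \<boxtimes> (Id V y \<boxtimes> lunit V \<I>)) \<cdot> assoc V x y (\<I> \<otimes> \<I>) \<cdot> assoc V (x \<otimes> y) \<I> \<I>"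
    by (subst assoc_nat_extend) simp_all
  also have "\<dots> = (Id V x \<boxtimes> ((Id V y \<boxtimes> lunit V \<I>) \<cdot> assoc V y \<I> \<I>)) \<cdot> assoc V x (y \<otimes> \<I>) \<I>
      \<cdot> (assoc V x y \<I> \<boxtimes> Id V \<I>)"
    by (simp add: pentagon)
  also have "\<dots> = (Id V x \<boxtimes> (runit V y \<boxtimes> Id V \<I>)) \<cdot> assoc V x (y \<otimes> \<I>) \<I> \<cdot> (assoc V x y \<I> \<boxtimes> Id V \<I>)"
    by (simp add: triangle)
  also have "\<dots> = assoc V x y \<I> \<cdot> ((Id V x \<boxtimes> runit V y) \<boxtimes> Id V \<I>) \<cdot> (assoc V x y \<I> \<boxtimes> Id V \<I>)"
    by (subst assoc_nat_extend) simp_all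
  finally have "assoc V x y \<I> \<cdot> (runit V (x \<otimes> y) \<boxtimes> Id V \<I>)
    = assoc V x y \<I> \<cdot> (((Id V x \<boxtimes> runit V y) \<cdot> assoc V x y \<I>) \<boxtimes> Id V \<I>)"
    by simp
  then have "runit V (x \<otimes> y) \<boxtimes> Id V \<I> = ((Id V x \<boxtimes> runit V y) \<cdot> assoc V x y \<I>) \<boxtimes> Id V \<I>"
    by (rule iso_monic) simp_all
  then show "((Id V x \<boxtimes> runit V y) \<cdot> assoc V x y \<I>) \<boxtimes> Id V \<I> = runit V (x \<otimes> y) \<boxtimes> Id V \<I>" ..
qed simp_all

text \<open>Naturality of \<open>lunit\<close> at \<open>lunit V \<I>\<close> identifies
  \<open>lunit V (\<I> \<otimes> \<I>)\<close> with
  \<open>Id V \<I> \<boxtimes> lunit V \<I>\<close>; \<open>lunit_tens\<close> and the triangle then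
  evaluate the same composite with the associator.\<close>

lemma lunit_runit_unit: "lunit V \<I> = runit V \<I>"
proof (rule tens_unit_faithful)
  have "lunit V \<I> \<cdot> lunit V (\<I> \<otimes> \<I>) = lunit V \<I> \<cdot> (Id V \<I> \<boxtimes> lunit V \<I>)"
    by (simp add: lunit_nat)
  then have "lunit V (\<I> \<otimes> \<I>) = Id V \<I> \<boxtimes> lunit V \<I>"
    by (rule iso_monic) simp_all
  then show "lunit V \<I> \<boxtimes> Id V \<I> = runit V \<I> \<boxtimes> Id V \<I>"
    using lunit_tens[of \<I> \<I>] triangle[of \<I> \<I>] by (metis unit_Obj)
qed simp_all

end

section \<open>Symmetry: adjacent transpositions in right-nested tensor products\<close>

context symmetric_monoidal_category
begin

lemma braid_simps [simp]:
  assumes "x \<in> Obj V" "y \<in> Obj V"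
  shows "braid V x y \<in> Mor V" "Dom V (braid V x y) = x \<otimes> y" "Cod V (braid V x y) = y \<otimes> x"
    "braid V y x \<cdot> braid V x y = Id V (x \<otimes> y)"
  using braid_in_hom[OF assms] braid_braid[OF assms] by (auto simp: hom_def)

lemma braid_cancel [simp]:
  assumes "x \<in> Obj V" "y \<in> Obj V" "k \<in> Mor V" "Cod V k = x \<otimes> y"
  shows "braid V y x \<cdot> braid V x y \<cdot> k = k"
  by (subst Comp_extend[OF braid_simps(4)]) (use assms in simp_all)

lemma braid_nat:
  assumes "f \<in> Mor V" "g \<in> Mor V" "Cod V f = x" "Cod V g = y"
  shows "braid V x y \<cdot> (f \<boxtimes> g) = (g \<boxtimes> f) \<cdot> braid V (Dom V f) (Dom V g)"
  using braid_natural[OF Mor_in_hom Mor_in_hom] assms by auto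

text \<open>The hexagon for \<open>x, \<I>, \<I>\<close> with the unit isomorphisms applied; the
  surplus factor \<open>braid V x \<I>\<close> is removed by its inverse
  \<open>braid V \<I> x\<close>.\<close>

lemma lunit_braid:
  assumes [simp]: "x \<in> Obj V"
  shows "lunit V x \<cdot> braid V x \<I> = runit V x"
proof (rule tens_unit_faithful)
  have "braid V x \<I> \<cdot> (runit V x \<boxtimes> Id V \<I>)
      = (braid V x \<I> \<cdot> (Id V x \<boxtimes> lunit V \<I>)) \<cdot> assoc V x \<I> \<I>"
    by (simp add: triangle)
  also have "\<dots> = (lunit V \<I> \<boxtimes> Id V x) \<cdot> braid V x (\<I> \<otimes> \<I>) \<cdot> assoc V x \<I> \<I>"
    by (subst braid_nat) simp_all
  also have "\<dots> = lunit V (\<I> \<otimes> x) \<cdot> assoc V \<I> \<I> x \<cdot> braid V x (\<I> \<otimes> \<I>) \<cdot> assoc V x \<I> \<I>"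
    by (subst lunit_tens[symmetric]) simp_all
  also have "\<dots> = (lunit V (\<I> \<otimes> x) \<cdot> (Id V \<I> \<boxtimes> braid V x \<I>)) \<cdot> assoc V \<I> x \<I> \<cdot> (braid V x \<I> \<boxtimes> Id V \<I>)"
    by (simp add: hexagon)
  also have "\<dots> = braid V x \<I> \<cdot> (lunit V (x \<otimes> \<I>) \<cdot> assoc V \<I> x \<I>) \<cdot> (braid V x \<I> \<boxtimes> Id V \<I>)"
    by (subst lunit_nat) simp_all
  also have "\<dots> = braid V x \<I> \<cdot> ((lunit V x \<cdot> braid V x \<I>) \<boxtimes> Id V \<I>)"
    by (subst lunit_tens) simp_all
  finally have "braid V \<I> x \<cdot> braid V x \<I> \<cdot> (runit V x \<boxtimes> Id V \<I>)
      = braid V \<I> x \<cdot> braid V x \<I> \<cdot> ((lunit V x \<cdot> braid V x \<I>) \<boxtimes> Id V \<I>)"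
    by (rule arg_cong)
  then show "(lunit V x \<cdot> braid V x \<I>) \<boxtimes> Id V \<I> = runit V x \<boxtimes> Id V \<I>"
    by simp
qed simp_all

lemma runit_braid: "x \<in> Obj V \<Longrightarrow> runit V x \<cdot> braid V \<I> x = lunit V x"
  by (subst lunit_braid[symmetric]) simp_all

text \<open>The transposition of the first two factors of a right-nested product. With the tail
  \<open>z\<close> explicit it serves as the generator for permutations of products indexed by
  lists.\<close>

definition swap where
  "swap x y z = assoc V y x z \<cdot> (braid V x y \<boxtimes> Id V z) \<cdot> assoc_inv x y z"

lemma swap_simps [simp]:
  assumes "x \<in> Obj V" "y \<in> Obj V" "z \<in> Obj V"
  shows "swap x y z \<in> Mor V" "Dom V (swap x y z) = x \<otimes> (y \<otimes> z)"
    "Cod V (swap x y z) = y \<otimes> (x \<otimes> z)" "swap y x z \<cdot> swap x y z = Id V (x \<otimes> (y \<otimes> z))"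
  using assms by (simp_all add: swap_def)

lemma swap_cancel [simp]:
  assumes "x \<in> Obj V" "y \<in> Obj V" "z \<in> Obj V" "k \<in> Mor V" "Cod V k = x \<otimes> (y \<otimes> z)"
  shows "swap y x z \<cdot> swap x y z \<cdot> k = k"
  by (subst Comp_extend[OF swap_simps(4)]) (use assms in simp_all)

lemma swap_iso [simp]:
  assumes "x \<in> Obj V" "y \<in> Obj V" "z \<in> Obj V"
  shows "iso_mor V (swap x y z)"
proof -
  have "inverse_mors V (swap x y z) (swap y x z)"
    using assms by (simp add: inverse_mors_def hom_iff)
  then show ?thesis by (auto simp: iso_mor_def)
qed

lemma swap_nat:
  assumes [simp]: "f \<in> Mor V" "g \<in> Mor V" "h \<in> Mor V" and c: "Cod V f = x" "Cod V g = y" "Cod V h = z"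
  shows "swap x y z \<cdot> (f \<boxtimes> (g \<boxtimes> h)) = (g \<boxtimes> (f \<boxtimes> h)) \<cdot> swap (Dom V f) (Dom V g) (Dom V h)"
proof (rule iso_epic)
  have [simp]: "x \<in> Obj V" "y \<in> Obj V" "z \<in> Obj V" using c by auto
  note [simp] = c
  let ?a = "assoc V (Dom V f) (Dom V g) (Dom V h)"
  have "(swap x y z \<cdot> (f \<boxtimes> (g \<boxtimes> h))) \<cdot> ?a
      = swap x y z \<cdot> assoc V x y z \<cdot> ((f \<boxtimes> g) \<boxtimes> h)"
    by (simp add: assoc_nat)
  also have "\<dots> = assoc V y x z \<cdot> ((braid V x y \<cdot> (f \<boxtimes> g)) \<boxtimes> h)"
    by (simp add: swap_def)
  also have "\<dots> = assoc V y x z \<cdot> ((g \<boxtimes> f) \<boxtimes> h) \<cdot> (braid V (Dom V f) (Dom V g) \<boxtimes> Id V (Dom V h))"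
    by (simp add: braid_nat)
  also have "\<dots> = (g \<boxtimes> (f \<boxtimes> h)) \<cdot> assoc V (Dom V g) (Dom V f) (Dom V h) \<cdot>
      (braid V (Dom V f) (Dom V g) \<boxtimes> Id V (Dom V h))"
    by (subst assoc_nat_extend) simp_all
  also have "\<dots> = ((g \<boxtimes> (f \<boxtimes> h)) \<cdot> swap (Dom V f) (Dom V g) (Dom V h)) \<cdot> ?a"
    by (simp add: swap_def)
  finally show "(swap x y z \<cdot> (f \<boxtimes> (g \<boxtimes> h))) \<cdot> ?a
    = ((g \<boxtimes> (f \<boxtimes> h)) \<cdot> swap (Dom V f) (Dom V g) (Dom V h)) \<cdot> ?a" .
qed (use c in auto)

lemma swap_nat_extend:
  assumes "f \<in> Mor V" "g \<in> Mor V" "h \<in> Mor V" "Cod V f = x" "Cod V g = y" "Cod V h = z"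
    and "k \<in> Mor V" "Cod V k = Dom V f \<otimes> (Dom V g \<otimes> Dom V h)"
  shows "swap x y z \<cdot> (f \<boxtimes> (g \<boxtimes> h)) \<cdot> k
    = (g \<boxtimes> (f \<boxtimes> h)) \<cdot> swap (Dom V f) (Dom V g) (Dom V h) \<cdot> k"
  by (subst Comp_extend[OF swap_nat[OF assms(1-6)]]) (use assms in auto)

lemma braid_tens:
  assumes [simp]: "x \<in> Obj V" "y \<in> Obj V" "z \<in> Obj V"
  shows "assoc V y z x \<cdot> braid V x (y \<otimes> z) = (Id V y \<boxtimes> braid V x z) \<cdot> swap x y z"
proof (rule iso_epic)
  show "(assoc V y z x \<cdot> braid V x (y \<otimes> z)) \<cdot> assoc V x y z
    = ((Id V y \<boxtimes> braid V x z) \<cdot> swap x y z) \<cdot> assoc V x y z"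
    by (simp add: hexagon swap_def)
qed simp_all

text \<open>The hexagon tensored with \<open>t\<close>: passing \<open>b \<otimes> c\<close> is
  passing \<open>b\<close> and then \<open>c\<close>. Pentagons carry it over to right-nested
  products.\<close>

lemma swap_tens_right:
  assumes [simp]: "a \<in> Obj V" "b \<in> Obj V" "c \<in> Obj V" "t \<in> Obj V"
  shows "assoc V b c (a \<otimes> t) \<cdot> swap a (b \<otimes> c) t
    = (Id V b \<boxtimes> swap a c t) \<cdot> swap a b (c \<otimes> t) \<cdot> (Id V a \<boxtimes> assoc V b c t)"
proof (rule iso_epic)
  let ?k = "assoc V a (b \<otimes> c) t \<cdot> (assoc V a b c \<boxtimes> Id V t)"
  let ?l = "assoc V b (a \<otimes> c) t \<cdot> ((assoc V b a c \<cdot> (braid V a b \<boxtimes> Id V c)) \<boxtimes> Id V t)"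
  have "(assoc V b c (a \<otimes> t) \<cdot> swap a (b \<otimes> c) t) \<cdot> ?k
      = assoc V b c (a \<otimes> t) \<cdot> assoc V (b \<otimes> c) a t \<cdot> ((braid V a (b \<otimes> c) \<cdot> assoc V a b c) \<boxtimes> Id V t)"
    by (simp add: swap_def)
  also have "\<dots> = (Id V b \<boxtimes> assoc V c a t) \<cdot> assoc V b (c \<otimes> a) t \<cdot>
       ((assoc V b c a \<cdot> braid V a (b \<otimes> c) \<cdot> assoc V a b c) \<boxtimes> Id V t)"
    by (simp add: pentagon_extend)
  also have "\<dots> = (Id V b \<boxtimes> assoc V c a t) \<cdot> assoc V b (c \<otimes> a) t \<cdot> ((Id V b \<boxtimes> braid V a c) \<boxtimes> Id V t) \<cdot>
       ((assoc V b a c \<cdot> (braid V a b \<boxtimes> Id V c)) \<boxtimes> Id V t)"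
    by (simp add: hexagon)
  also have "\<dots> = (Id V b \<boxtimes> (assoc V c a t \<cdot> (braid V a c \<boxtimes> Id V t))) \<cdot> ?l"
    by (subst assoc_nat_extend) simp_all
  also have "\<dots> = (Id V b \<boxtimes> swap a c t) \<cdot> (Id V b \<boxtimes> assoc V a c t) \<cdot> assoc V b (a \<otimes> c) t \<cdot> 
      (assoc V b a c \<boxtimes> Id V t) \<cdot> ((braid V a b \<boxtimes> Id V c) \<boxtimes> Id V t)"
    by (simp add: swap_def)
  also have "\<dots> = (Id V b \<boxtimes> swap a c t) \<cdot> assoc V b a (c \<otimes> t) \<cdot> assoc V (b \<otimes> a) c t \<cdot>
      ((braid V a b \<boxtimes> Id V c) \<boxtimes> Id V t)"
    by (subst pentagon_extend) simp_all
  also have "\<dots> = (Id V b \<boxtimes> swap a c t) \<cdot> swap a b (c \<otimes> t) \<cdot> assoc V a b (c \<otimes> t) \<cdot> assoc V (a \<otimes> b) c t"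
    by (simp add: swap_def assoc_nat)
  also have "\<dots> = ((Id V b \<boxtimes> swap a c t) \<cdot> swap a b (c \<otimes> t) \<cdot> (Id V a \<boxtimes> assoc V b c t)) \<cdot> ?k"
    by (simp add: pentagon)
  finally show "(assoc V b c (a \<otimes> t) \<cdot> swap a (b \<otimes> c) t) \<cdot> ?k
      = ((Id V b \<boxtimes> swap a c t) \<cdot> swap a b (c \<otimes> t) \<cdot> (Id V a \<boxtimes> assoc V b c t)) \<cdot> ?k" .
qed simp_all

text \<open>The other hexagon comes from symmetry: precomposed with
  \<open>swap y (x \<otimes> s) t\<close>, the inverse of \<open>swap (x \<otimes> s) y t\<close>,
  the claim follows from \<open>swap_tens_right\<close> because the remaining swaps cancel in
  pairs.\<close>

lemma swap_tens_left:
  assumes [simp]: "x \<in> Obj V" "s \<in> Obj V" "y \<in> Obj V" "t \<in> Obj V"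
  shows "(Id V y \<boxtimes> assoc V x s t) \<cdot> swap (x \<otimes> s) y t
    = swap x y (s \<otimes> t) \<cdot> (Id V x \<boxtimes> swap s y t) \<cdot> assoc V x s (y \<otimes> t)"
proof (rule iso_epic)
  have "(swap x y (s \<otimes> t) \<cdot> (Id V x \<boxtimes> swap s y t) \<cdot> assoc V x s (y \<otimes> t)) \<cdot> swap y (x \<otimes> s) t
    = swap x y (s \<otimes> t) \<cdot> (Id V x \<boxtimes> swap s y t) \<cdot> 
        (Id V x \<boxtimes> swap y s t) \<cdot> swap y x (s \<otimes> t) \<cdot> (Id V y \<boxtimes> assoc V x s t)"
    by (simp add: swap_tens_right)
  also have "\<dots> = ((Id V y \<boxtimes> assoc V x s t) \<cdot> swap (x \<otimes> s) y t) \<cdot> swap y (x \<otimes> s) t"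
    by simp
  finally show "((Id V y \<boxtimes> assoc V x s t) \<cdot> swap (x \<otimes> s) y t) \<cdot> swap y (x \<otimes> s) t = 
    (swap x y (s \<otimes> t) \<cdot> (Id V x \<boxtimes> swap s y t) \<cdot> assoc V x s (y \<otimes> t)) \<cdot> swap y (x \<otimes> s) t" ..
qed simp_all

text \<open>Passing \<open>b \<otimes> c\<close> is natural in that object: this is naturality of
  \<open>swap\<close> at \<open>braid V b c\<close>, with both passages split by
  \<open>swap_tens_right\<close>.\<close>

lemma yang_baxter:
  assumes [simp]: "a \<in> Obj V" "b \<in> Obj V" "c \<in> Obj V" "t \<in> Obj V"
  shows "(Id V c \<boxtimes> swap a b t) \<cdot> swap a c (b \<otimes> t) \<cdot> (Id V a \<boxtimes> swap b c t)
    = swap b c (a \<otimes> t) \<cdot> (Id V b \<boxtimes> swap a c t) \<cdot> swap a b (c \<otimes> t)"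
proof -
  let ?i = "Id V a \<boxtimes> assoc_inv b c t"
  have "(Id V c \<boxtimes> swap a b t) \<cdot> swap a c (b \<otimes> t) \<cdot> (Id V a \<boxtimes> swap b c t)
      = ((Id V c \<boxtimes> swap a b t) \<cdot> swap a c (b \<otimes> t) \<cdot> (Id V a \<boxtimes> assoc V c b t)) \<cdot>
        (Id V a \<boxtimes> (braid V b c \<boxtimes> Id V t)) \<cdot> ?i"
    by (simp add: swap_def)
  also have "\<dots> = assoc V c b (a \<otimes> t) \<cdot> swap a (c \<otimes> b) t \<cdot> (Id V a \<boxtimes> (braid V b c \<boxtimes> Id V t)) \<cdot> ?i"
    by (subst swap_tens_right[symmetric]) simp_all
  also have "\<dots> = assoc V c b (a \<otimes> t) \<cdot> (braid V b c \<boxtimes> Id V (a \<otimes> t)) \<cdot> swap a (b \<otimes> c) t \<cdot> ?i"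
    by (subst swap_nat_extend) simp_all
  also have "\<dots> = swap b c (a \<otimes> t) \<cdot> (assoc V b c (a \<otimes> t) \<cdot> swap a (b \<otimes> c) t) \<cdot> ?i"
    by (simp add: swap_def)
  also have "\<dots> = swap b c (a \<otimes> t) \<cdot> (Id V b \<boxtimes> swap a c t) \<cdot> swap a b (c \<otimes> t)"
    by (subst swap_tens_right) simp_all
  finally show ?thesis .
qed

lemma swap_assoc:
  assumes [simp]: "i \<in> Obj V" "j \<in> Obj V" "t \<in> Obj V" "u \<in> Obj V"
  shows "(Id V i \<boxtimes> assoc V j t u) \<cdot> assoc V i (j \<otimes> t) u \<cdot> (swap j i t \<boxtimes> Id V u)
    = swap j i (t \<otimes> u) \<cdot> (Id V j \<boxtimes> assoc V i t u) \<cdot> assoc V j (i \<otimes> t) u"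
proof (rule iso_epic)
  let ?k = "assoc V j i t \<boxtimes> Id V u"
  have "((Id V i \<boxtimes> assoc V j t u) \<cdot> assoc V i (j \<otimes> t) u \<cdot> (swap j i t \<boxtimes> Id V u)) \<cdot> ?k
     = (Id V i \<boxtimes> assoc V j t u) \<cdot> assoc V i (j \<otimes> t) u \<cdot> (assoc V i j t \<boxtimes> Id V u) \<cdot> 
        ((braid V j i \<boxtimes> Id V t) \<boxtimes> Id V u)"
    by (simp add: swap_def)
  also have "\<dots> = assoc V i j (t \<otimes> u) \<cdot> assoc V (i \<otimes> j) t u \<cdot> ((braid V j i \<boxtimes> Id V t) \<boxtimes> Id V u)"
    by (subst pentagon_extend) simp_all
  also have "\<dots> = swap j i (t \<otimes> u) \<cdot> assoc V j i (t \<otimes> u) \<cdot> assoc V (j \<otimes> i) t u"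
    by (simp add: swap_def assoc_nat)
  also have "\<dots> = (swap j i (t \<otimes> u) \<cdot> (Id V j \<boxtimes> assoc V i t u) \<cdot> assoc V j (i \<otimes> t) u) \<cdot> ?k"
    by (simp add: pentagon)
  finally show "((Id V i \<boxtimes> assoc V j t u) \<cdot> assoc V i (j \<otimes> t) u \<cdot> (swap j i t \<boxtimes> Id V u)) \<cdot> ?k
    = (swap j i (t \<otimes> u) \<cdot> (Id V j \<boxtimes> assoc V i t u) \<cdot> assoc V j (i \<otimes> t) u) \<cdot> ?k" .
qed simp_all

lemma swap_unit:
  assumes [simp]: "y \<in> Obj V" "t \<in> Obj V"
  shows "(Id V y \<boxtimes> lunit V t) \<cdot> swap \<I> y t = lunit V (y \<otimes> t)"
proof (rule iso_epic)
  show "((Id V y \<boxtimes> lunit V t) \<cdot> swap \<I> y t) \<cdot> assoc V \<I> y t = lunit V (y \<otimes> t) \<cdot> assoc V \<I> y t"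
    by (simp add: swap_def triangle_extend runit_braid lunit_tens)
qed simp_all

end

section \<open>Coherence for symmetric monoidal categories\<close>

datatype 'i shape = Leaf 'i | Unit | Node "'i shape" "'i shape"

primrec leaves :: "'i shape \<Rightarrow> 'i list" where
  "leaves (Leaf i) = [i]"
| "leaves Unit = []"
| "leaves (Node s t) = leaves s @ leaves t"

text \<open>Formal canonical morphisms; \<open>composable\<close> singles out the well-typed ones.
  The braiding has no inverse constructor because \<open>CBraid t s\<close> denotes the inverse of
  \<open>CBraid s t\<close>.\<close>

datatype 'i canon =
    CId "'i shape"
  | CAssoc "'i shape" "'i shape" "'i shape" | CAssocInv "'i shape" "'i shape" "'i shape"
  | CLunit "'i shape" | CLunitInv "'i shape"
  | CRunit "'i shape" | CRunitInv "'i shape"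
  | CBraid "'i shape" "'i shape"
  | CComp "'i canon" "'i canon"
  | CTens "'i canon" "'i canon"

primrec cdom :: "'i canon \<Rightarrow> 'i shape" where
  "cdom (CId s) = s"
| "cdom (CAssoc s t u) = Node (Node s t) u"
| "cdom (CAssocInv s t u) = Node s (Node t u)"
| "cdom (CLunit s) = Node Unit s"
| "cdom (CLunitInv s) = s"
| "cdom (CRunit s) = Node s Unit"
| "cdom (CRunitInv s) = s"
| "cdom (CBraid s t) = Node s t"
| "cdom (CComp d c) = cdom c"
| "cdom (CTens c d) = Node (cdom c) (cdom d)"

primrec ccod :: "'i canon \<Rightarrow> 'i shape" where
  "ccod (CId s) = s"
| "ccod (CAssoc s t u) = Node s (Node t u)"
| "ccod (CAssocInv s t u) = Node (Node s t) u"
| "ccod (CLunit s) = s"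
| "ccod (CLunitInv s) = Node Unit s"
| "ccod (CRunit s) = s"
| "ccod (CRunitInv s) = Node s Unit"
| "ccod (CBraid s t) = Node t s"
| "ccod (CComp d c) = ccod d"
| "ccod (CTens c d) = Node (ccod c) (ccod d)"

primrec composable :: "'i canon \<Rightarrow> bool" where
  "composable (CId s) = True"
| "composable (CAssoc s t u) = True"
| "composable (CAssocInv s t u) = True"
| "composable (CLunit s) = True"
| "composable (CLunitInv s) = True"
| "composable (CRunit s) = True"
| "composable (CRunitInv s) = True"
| "composable (CBraid s t) = True"
| "composable (CComp d c) = (composable d \<and> composable c \<and> ccod c = cdom d)"
| "composable (CTens c d) = (composable c \<and> composable d)"

lemma set_leaves_ccod: "composable c \<Longrightarrow> set (leaves (ccod c)) = set (leaves (cdom c))"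
  by (induction c) auto

lemma distinct_leaves_ccod:
  "composable c \<Longrightarrow> distinct (leaves (cdom c)) \<Longrightarrow> distinct (leaves (ccod c))"
proof (induction c)
  case (CTens c d)
  then show ?case using set_leaves_ccod[of c] set_leaves_ccod[of d] by auto
qed auto

context symmetric_monoidal_category
begin

primrec sem :: "('i \<Rightarrow> 'o) \<Rightarrow> 'i shape \<Rightarrow> 'o" where
  "sem e (Leaf i) = e i"
| "sem e Unit = \<I>"
| "sem e (Node s t) = sem e s \<otimes> sem e t"

primrec sem_mor :: "('i \<Rightarrow> 'o) \<Rightarrow> 'i canon \<Rightarrow> 'm" where
  "sem_mor e (CId s) = Id V (sem e s)"
| "sem_mor e (CAssoc s t u) = assoc V (sem e s) (sem e t) (sem e u)"
| "sem_mor e (CAssocInv s t u) = assoc_inv (sem e s) (sem e t) (sem e u)"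
| "sem_mor e (CLunit s) = lunit V (sem e s)"
| "sem_mor e (CLunitInv s) = lunit_inv (sem e s)"
| "sem_mor e (CRunit s) = runit V (sem e s)"
| "sem_mor e (CRunitInv s) = runit_inv (sem e s)"
| "sem_mor e (CBraid s t) = braid V (sem e s) (sem e t)"
| "sem_mor e (CComp d c) = sem_mor e d \<cdot> sem_mor e c"
| "sem_mor e (CTens c d) = sem_mor e c \<boxtimes> sem_mor e d"

context
  fixes e :: "'i \<Rightarrow> 'o"
  assumes e_Obj [simp]: "\<And>i. e i \<in> Obj V"
begin

section \<open>Permutations of tensor products indexed by lists of names\<close>

primrec tens_list :: "'i list \<Rightarrow> 'o" where
  "tens_list [] = \<I>"
| "tens_list (i # is) = e i \<otimes> tens_list is"

lemma tens_list_Obj [simp]: "tens_list is \<in> Obj V"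
  by (induction "is") simp_all

text \<open>\<open>pull i is\<close> is meaningful only if \<open>i\<close> occurs in \<open>is\<close>.\<close>

primrec pull :: "'i \<Rightarrow> 'i list \<Rightarrow> 'm" where
  "pull i [] = Id V \<I>"
| "pull i (j # is) = (if i = j then Id V (e i \<otimes> tens_list is)
     else swap (e j) (e i) (tens_list (remove1 i is)) \<cdot> (Id V (e j) \<boxtimes> pull i is))"

lemma pull_simps [simp]:
  assumes "i \<in> set is"
  shows "pull i is \<in> Mor V" "Dom V (pull i is) = tens_list is"
    "Cod V (pull i is) = e i \<otimes> tens_list (remove1 i is)"
proof -
  have "i \<in> set is \<Longrightarrow> pull i is \<in> Mor V \<and> Dom V (pull i is) = tens_list is \<and>
    Cod V (pull i is) = e i \<otimes> tens_list (remove1 i is)"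
    by (induction "is") auto
  then show "pull i is \<in> Mor V" "Dom V (pull i is) = tens_list is"
    "Cod V (pull i is) = e i \<otimes> tens_list (remove1 i is)" using assms by auto
qed

text \<open>The content lies in a head \<open>k\<close> different from both names, where the step is
  the Yang-Baxter equation for \<open>e k\<close>, \<open>e i\<close> and \<open>e j\<close>. For
  \<open>k = i\<close> the claim is the definition of \<open>pull\<close>, for \<open>k = j\<close>
  it is involutivity of \<open>swap\<close>.\<close>

lemma pull_pull:
  assumes "i \<noteq> j" "i \<in> set is" "j \<in> set is"
  shows "swap (e i) (e j) (tens_list (remove1 i (remove1 j is))) \<cdot>
      (Id V (e i) \<boxtimes> pull j (remove1 i is)) \<cdot> pull i is
    = (Id V (e j) \<boxtimes> pull i (remove1 j is)) \<cdot> pull j is"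
  using assms
proof (induction "is")
  case (Cons k xs)
  consider "k = i" | "k = j" | "k \<noteq> i" "k \<noteq> j" by auto
  then show ?case
  proof cases
    case 1
    then show ?thesis using Cons.prems by simp
  next
    case 2
    then show ?thesis using Cons.prems by simp
  next
    case 3
    let ?t = "tens_list (remove1 i (remove1 j xs))"
    let ?ti = "tens_list (remove1 i xs)" and ?tj = "tens_list (remove1 j xs)"
    have [simp]: "i \<in> set xs" "j \<in> set xs" "i \<noteq> j" "j \<noteq> i" using Cons.prems 3 by auto
    have [simp]: "i \<in> set (remove1 j xs)" "j \<in> set (remove1 i xs)" by (simp_all add: in_set_remove1)
    note [simp] = remove1_commute[of j i xs]
    \<comment> \<open>The induction hypothesis with its leading \<open>swap\<close> moved to the
      other side, so that substituting it produces the left side of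
      \<open>yang_baxter\<close>.\<close>
    have IH: "(Id V (e i) \<boxtimes> pull j (remove1 i xs)) \<cdot> pull i xs
      = swap (e j) (e i) ?t \<cdot> (Id V (e j) \<boxtimes> pull i (remove1 j xs)) \<cdot> pull j xs" (is "?l = _ \<cdot> ?r")
      using arg_cong[OF Cons.IH, of "\<lambda>x. swap (e j) (e i) ?t \<cdot> x"] by simp
    have "swap (e i) (e j) (e k \<otimes> ?t) \<cdot> (Id V (e i) \<boxtimes> swap (e k) (e j) ?t) \<cdot>
        (Id V (e i) \<boxtimes> (Id V (e k) \<boxtimes> pull j (remove1 i xs))) \<cdot> swap (e k) (e i) ?ti \<cdot> (Id V (e k) \<boxtimes> pull i xs)
      = swap (e i) (e j) (e k \<otimes> ?t) \<cdot> (Id V (e i) \<boxtimes> swap (e k) (e j) ?t) \<cdot>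
         swap (e k) (e i) (e j \<otimes> ?t) \<cdot> (Id V (e k) \<boxtimes> ?l)"
      using swap_nat_extend[of "Id V (e k)" "Id V (e i)" "pull j (remove1 i xs)" "e k" "e i" "e j \<otimes> ?t"
          "Id V (e k) \<boxtimes> pull i xs"]
      by (simp del: tens_Comp_extend add: tens_Comp_extend[symmetric])
    also have "\<dots> = swap (e i) (e j) (e k \<otimes> ?t) \<cdot> ((Id V (e i) \<boxtimes> swap (e k) (e j) ?t) \<cdot>
         swap (e k) (e i) (e j \<otimes> ?t) \<cdot> (Id V (e k) \<boxtimes> swap (e j) (e i) ?t)) \<cdot> (Id V (e k) \<boxtimes> ?r)"
      unfolding IH by simp
    also have "\<dots> = (Id V (e j) \<boxtimes> swap (e k) (e i) ?t) \<cdot> swap (e k) (e j) (e i \<otimes> ?t) \<cdot> (Id V (e k) \<boxtimes> ?r)"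
      by (subst yang_baxter) simp_all
    also have "\<dots> = (Id V (e j) \<boxtimes> swap (e k) (e i) ?t) \<cdot> swap (e k) (e j) (e i \<otimes> ?t) \<cdot>
         (Id V (e k) \<boxtimes> (Id V (e j) \<boxtimes> pull i (remove1 j xs))) \<cdot> (Id V (e k) \<boxtimes> pull j xs)"
      by simp
    also have "\<dots> = (Id V (e j) \<boxtimes> swap (e k) (e i) ?t) \<cdot> (Id V (e j) \<boxtimes> (Id V (e k) \<boxtimes> pull i (remove1 j xs))) \<cdot>
        swap (e k) (e j) ?tj \<cdot> (Id V (e k) \<boxtimes> pull j xs)"
      by (subst swap_nat_extend) simp_all
    finally show ?thesis using 3 by simp
  qed
qed simp

text \<open>Selection sort with the target list as first argument: its entries are pulled out of the
  source one after the other. As a function of the two lists only, it serves as the normal form of a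
  permutation.\<close>

primrec perm_mor :: "'i list \<Rightarrow> 'i list \<Rightarrow> 'm" where
  "perm_mor [] xs = Id V \<I>"
| "perm_mor (y # ys) xs = (Id V (e y) \<boxtimes> perm_mor ys (remove1 y xs)) \<cdot> pull y xs"

text \<open>Without repetitions the permutation taking \<open>xs\<close> to \<open>ys\<close> is
  unique, so the pair of lists can stand for it.\<close>

definition rearranges :: "'i list \<Rightarrow> 'i list \<Rightarrow> bool" where
  "rearranges xs ys \<longleftrightarrow> distinct xs \<and> distinct ys \<and> set xs = set ys"

lemma rearranges_Cons:
  assumes "rearranges xs (y # ys)"
  shows "y \<in> set xs" "rearranges (remove1 y xs) ys"
  using assms by (auto simp: rearranges_def)

lemma rearranges_Nil: "rearranges xs [] \<longleftrightarrow> xs = []"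
  by (auto simp: rearranges_def)

lemma rearranges_remove1:
  assumes "rearranges xs ys"
  shows "rearranges (remove1 z xs) (remove1 z ys)"
  using assms by (auto simp: rearranges_def)

lemma perm_mor_simps [simp]:
  assumes "rearranges xs ys"
  shows "perm_mor ys xs \<in> Mor V" "Dom V (perm_mor ys xs) = tens_list xs"
    "Cod V (perm_mor ys xs) = tens_list ys"
proof -
  have "rearranges xs ys \<Longrightarrow> perm_mor ys xs \<in> Mor V \<and> Dom V (perm_mor ys xs) = tens_list xs \<and>
    Cod V (perm_mor ys xs) = tens_list ys"
  proof (induction ys arbitrary: xs)
    case (Cons y ys)
    then show ?case using rearranges_Cons[OF Cons.prems] by simp
  qed (simp add: rearranges_Nil)
  then show "perm_mor ys xs \<in> Mor V" "Dom V (perm_mor ys xs) = tens_list xs"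
    "Cod V (perm_mor ys xs) = tens_list ys" using assms by auto
qed

lemma perm_mor_refl: "perm_mor xs xs = Id V (tens_list xs)"
  by (induction xs) simp_all

text \<open>Rearranging the list first does not affect which factor is pulled out. If
  \<open>z\<close> is not the head of \<open>ys\<close>, its pull meets that of the head
  \<open>y\<close>, and \<open>pull_pull\<close> exchanges the two.\<close>

lemma pull_perm_mor:
  assumes "rearranges xs ys" "z \<in> set ys"
  shows "pull z ys \<cdot> perm_mor ys xs
    = (Id V (e z) \<boxtimes> perm_mor (remove1 z ys) (remove1 z xs)) \<cdot> pull z xs"
  using assms
proof (induction ys arbitrary: xs)
  case (Cons y ys)
  note r [simp] = rearranges_Cons[OF Cons.prems(1)]
  show ?case
  proof (cases "y = z")
    case True
    then show ?thesis using r by simp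
  next
    case False
    have [simp]: "z \<in> set ys" "z \<noteq> y" "y \<noteq> z" using Cons.prems False by auto
    have [simp]: "z \<in> set xs" "z \<in> set (remove1 y xs)" "y \<in> set (remove1 z xs)"
      using Cons.prems(1) by (auto simp: rearranges_def)
    note [simp] = rearranges_remove1[OF r(2), of z] remove1_commute[of y z xs]
    let ?p = "perm_mor (remove1 z ys) (remove1 z (remove1 y xs))"
    let ?t = "tens_list (remove1 z (remove1 y xs))"
    have "pull z (y # ys) \<cdot> perm_mor (y # ys) xs
      = swap (e y) (e z) (tens_list (remove1 z ys)) \<cdot>
         (Id V (e y) \<boxtimes> (pull z ys \<cdot> perm_mor ys (remove1 y xs))) \<cdot> pull y xs"
      by simp
    also have "\<dots> = swap (e y) (e z) (tens_list (remove1 z ys)) \<cdot>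
         (Id V (e y) \<boxtimes> (Id V (e z) \<boxtimes> ?p)) \<cdot> (Id V (e y) \<boxtimes> pull z (remove1 y xs)) \<cdot> pull y xs"
      by (subst Cons.IH) simp_all
    also have "\<dots> = (Id V (e z) \<boxtimes> (Id V (e y) \<boxtimes> ?p)) \<cdot> swap (e y) (e z) ?t \<cdot>
        (Id V (e y) \<boxtimes> pull z (remove1 y xs)) \<cdot> pull y xs"
      by (subst swap_nat_extend) simp_all
    also have "\<dots> = (Id V (e z) \<boxtimes> (Id V (e y) \<boxtimes> ?p)) \<cdot> (Id V (e z) \<boxtimes> pull y (remove1 z xs)) \<cdot> pull z xs"
      using pull_pull[of y z xs] by simp
    finally show ?thesis using False by simp
  qed
qed simp

text \<open>Induction on the final list: the selection of its head is moved back through the first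
  rearrangement by \<open>pull_perm_mor\<close>. This is what makes the normal form of a composite
  independent of the intermediate list.\<close>

lemma perm_mor_Comp:
  assumes "rearranges xs ys" "rearranges ys zs"
  shows "perm_mor zs ys \<cdot> perm_mor ys xs = perm_mor zs xs"
  using assms
proof (induction zs arbitrary: xs ys)
  case Nil
  then show ?case by (simp add: rearranges_Nil)
next
  case (Cons z zs)
  note [simp] = rearranges_Cons[OF Cons.prems(2)] Cons.prems(1) rearranges_remove1[OF Cons.prems(1), of z]
  have [simp]: "z \<in> set xs" using Cons.prems by (auto simp: rearranges_def)
  have "perm_mor (z # zs) ys \<cdot> perm_mor ys xs
    = (Id V (e z) \<boxtimes> perm_mor zs (remove1 z ys)) \<cdot> pull z ys \<cdot> perm_mor ys xs"
    by simp
  also have "\<dots> = (Id V (e z) \<boxtimes> (perm_mor zs (remove1 z ys) \<cdot> perm_mor (remove1 z ys) (remove1 z xs))) \<cdot> pull z xs"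
    by (simp add: pull_perm_mor)
  also have "\<dots> = perm_mor (z # zs) xs" by (simp add: Cons.IH)
  finally show ?case .
qed

section \<open>Concatenation of lists against the tensor product\<close>

primrec append_mor :: "'i list \<Rightarrow> 'i list \<Rightarrow> 'm" where
  "append_mor [] ys = lunit V (tens_list ys)"
| "append_mor (x # xs) ys = (Id V (e x) \<boxtimes> append_mor xs ys) \<cdot> assoc V (e x) (tens_list xs) (tens_list ys)"

lemma append_mor_simps [simp]:
  "append_mor xs ys \<in> Mor V" "Dom V (append_mor xs ys) = tens_list xs \<otimes> tens_list ys"
  "Cod V (append_mor xs ys) = tens_list (xs @ ys)" "iso_mor V (append_mor xs ys)"
proof -
  have "append_mor xs ys \<in> Mor V \<and> Dom V (append_mor xs ys) = tens_list xs \<otimes> tens_list ys \<and>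
    Cod V (append_mor xs ys) = tens_list (xs @ ys) \<and> iso_mor V (append_mor xs ys)"
    by (induction xs) auto
  then show "append_mor xs ys \<in> Mor V" "Dom V (append_mor xs ys) = tens_list xs \<otimes> tens_list ys"
    "Cod V (append_mor xs ys) = tens_list (xs @ ys)" "iso_mor V (append_mor xs ys)" by auto
qed

lemma pull_append_left:
  assumes "i \<in> set xs"
  shows "pull i (xs @ ys) \<cdot> append_mor xs ys = (Id V (e i) \<boxtimes> append_mor (remove1 i xs) ys) \<cdot>
    assoc V (e i) (tens_list (remove1 i xs)) (tens_list ys) \<cdot> (pull i xs \<boxtimes> Id V (tens_list ys))"
  using assms
proof (induction xs)
  case (Cons j xs)
  show ?case
  proof (cases "i = j")
    case False
    then have [simp]: "i \<in> set xs" "i \<noteq> j" "j \<noteq> i" "remove1 i (xs @ ys) = remove1 i xs @ ys"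
      using Cons.prems by (auto simp: remove1_append)
    let ?t = "tens_list (remove1 i xs)" and ?u = "tens_list ys" and ?a = "append_mor (remove1 i xs) ys"
    have "pull i ((j # xs) @ ys) \<cdot> append_mor (j # xs) ys
      = swap (e j) (e i) (tens_list (remove1 i xs @ ys)) \<cdot>
        (Id V (e j) \<boxtimes> (pull i (xs @ ys) \<cdot> append_mor xs ys)) \<cdot> assoc V (e j) (tens_list xs) ?u"
      by simp
    also have "\<dots> = swap (e j) (e i) (tens_list (remove1 i xs @ ys)) \<cdot> (Id V (e j) \<boxtimes> (Id V (e i) \<boxtimes> ?a)) \<cdot>
       (Id V (e j) \<boxtimes> assoc V (e i) ?t ?u) \<cdot> (Id V (e j) \<boxtimes> (pull i xs \<boxtimes> Id V ?u)) \<cdot> assoc V (e j) (tens_list xs) ?u"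
      by (subst Cons.IH) simp_all
    also have "\<dots> = (Id V (e i) \<boxtimes> (Id V (e j) \<boxtimes> ?a)) \<cdot> swap (e j) (e i) (?t \<otimes> ?u) \<cdot>
       (Id V (e j) \<boxtimes> assoc V (e i) ?t ?u) \<cdot> (Id V (e j) \<boxtimes> (pull i xs \<boxtimes> Id V ?u)) \<cdot> assoc V (e j) (tens_list xs) ?u"
      by (subst swap_nat_extend) simp_all
    also have "\<dots> = (Id V (e i) \<boxtimes> (Id V (e j) \<boxtimes> ?a)) \<cdot> (swap (e j) (e i) (?t \<otimes> ?u) \<cdot>
       (Id V (e j) \<boxtimes> assoc V (e i) ?t ?u) \<cdot> assoc V (e j) (e i \<otimes> ?t) ?u) \<cdot> ((Id V (e j) \<boxtimes> pull i xs) \<boxtimes> Id V ?u)"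
      using assoc_nat[of "Id V (e j)" "pull i xs" "Id V ?u"] by simp
    also have "\<dots> = (Id V (e i) \<boxtimes> (Id V (e j) \<boxtimes> ?a)) \<cdot> ((Id V (e i) \<boxtimes> assoc V (e j) ?t ?u) \<cdot>
       assoc V (e i) (e j \<otimes> ?t) ?u \<cdot> (swap (e j) (e i) ?t \<boxtimes> Id V ?u)) \<cdot> ((Id V (e j) \<boxtimes> pull i xs) \<boxtimes> Id V ?u)"
      by (subst swap_assoc) simp_all
    finally show ?thesis by simp
  qed simp
qed simp

text \<open>Passing all of \<open>xs\<close> is a single \<open>swap\<close> by
  \<open>tens_list xs\<close>: each induction step absorbs one more factor through
  \<open>swap_tens_left\<close>. Since \<open>y \<notin> set xs\<close>, \<open>pull\<close> takes
  the displayed occurrence of \<open>y\<close>.\<close>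

lemma pull_append_right:
  assumes "y \<notin> set xs"
  shows "pull y (xs @ y # ys) \<cdot> append_mor xs (y # ys)
    = (Id V (e y) \<boxtimes> append_mor xs ys) \<cdot> swap (tens_list xs) (e y) (tens_list ys)"
  using assms
proof (induction xs)
  case Nil
  then show ?case by (simp add: swap_unit)
next
  case (Cons x xs)
  then have [simp]: "y \<notin> set xs" "y \<noteq> x" "x \<noteq> y" "remove1 y (xs @ y # ys) = xs @ ys"
    by (auto simp: remove1_append)
  let ?t = "tens_list xs" and ?u = "tens_list ys"
  have "pull y ((x # xs) @ y # ys) \<cdot> append_mor (x # xs) (y # ys)
    = swap (e x) (e y) (tens_list (xs @ ys)) \<cdot> (Id V (e x) \<boxtimes> (pull y (xs @ y # ys) \<cdot> append_mor xs (y # ys))) \<cdot>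
       assoc V (e x) ?t (e y \<otimes> ?u)"
    by simp
  also have "\<dots> = swap (e x) (e y) (tens_list (xs @ ys)) \<cdot> (Id V (e x) \<boxtimes> (Id V (e y) \<boxtimes> append_mor xs ys)) \<cdot>
      (Id V (e x) \<boxtimes> swap ?t (e y) ?u) \<cdot> assoc V (e x) ?t (e y \<otimes> ?u)"
    by (subst Cons.IH) simp_all
  also have "\<dots> = (Id V (e y) \<boxtimes> (Id V (e x) \<boxtimes> append_mor xs ys)) \<cdot> (swap (e x) (e y) (?t \<otimes> ?u) \<cdot>
      (Id V (e x) \<boxtimes> swap ?t (e y) ?u) \<cdot> assoc V (e x) ?t (e y \<otimes> ?u))"
    by (subst swap_nat_extend) simp_all
  also have "\<dots> = (Id V (e y) \<boxtimes> append_mor (x # xs) ys) \<cdot> swap (tens_list (x # xs)) (e y) ?u"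
    by (subst swap_tens_left[symmetric]) simp_all
  finally show ?case .
qed

text \<open>Induction on \<open>xs'\<close> with \<open>pull_append_left\<close>, because the names
  of \<open>xs'\<close> are selected from the front part. Disjointness keeps the concatenated lists
  free of repetitions, so that \<open>perm_mor\<close> between them is meaningful.\<close>

lemma append_mor_natural:
  assumes "rearranges xs xs'" "rearranges ys ys'" "set xs \<inter> set ys = {}"
  shows "append_mor xs' ys' \<cdot> (perm_mor xs' xs \<boxtimes> perm_mor ys' ys)
    = perm_mor (xs' @ ys') (xs @ ys) \<cdot> append_mor xs ys"
  using assms
proof (induction xs' arbitrary: xs)
  case Nil
  then show ?case by (simp add: rearranges_Nil lunit_nat)
next
  case (Cons x xs')
  note [simp] = rearranges_Cons[OF Cons.prems(1)] Cons.prems(2)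
  have r: "remove1 x (xs @ ys) = remove1 x xs @ ys" by (simp add: remove1_append)
  have d: "set (remove1 x xs) \<inter> set ys = {}" using Cons.prems(3) set_remove1_subset[of x xs] by blast
  have [simp]: "rearranges (remove1 x xs @ ys) (xs' @ ys')"
    using rearranges_Cons(2)[OF Cons.prems(1)] Cons.prems(2) d by (auto simp: rearranges_def)
  let ?t = "tens_list (remove1 x xs)" and ?u = "tens_list ys"
  have "append_mor (x # xs') ys' \<cdot> (perm_mor (x # xs') xs \<boxtimes> perm_mor ys' ys)
    = (Id V (e x) \<boxtimes> append_mor xs' ys') \<cdot> assoc V (e x) (tens_list xs') (tens_list ys') \<cdot>
      ((Id V (e x) \<boxtimes> perm_mor xs' (remove1 x xs)) \<boxtimes> perm_mor ys' ys) \<cdot> (pull x xs \<boxtimes> Id V ?u)"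
    by simp
  also have "\<dots> = (Id V (e x) \<boxtimes> (append_mor xs' ys' \<cdot> (perm_mor xs' (remove1 x xs) \<boxtimes> perm_mor ys' ys))) \<cdot>
      assoc V (e x) ?t ?u \<cdot> (pull x xs \<boxtimes> Id V ?u)"
    by (subst assoc_nat_extend) simp_all
  also have "\<dots> = (Id V (e x) \<boxtimes> perm_mor (xs' @ ys') (remove1 x xs @ ys)) \<cdot> (Id V (e x) \<boxtimes> append_mor (remove1 x xs) ys) \<cdot>
      assoc V (e x) ?t ?u \<cdot> (pull x xs \<boxtimes> Id V ?u)"
    by (subst Cons.IH) (use d in simp_all)
  also have "\<dots> = perm_mor ((x # xs') @ ys') (xs @ ys) \<cdot> append_mor xs ys"
    using pull_append_left[of x xs ys] by (simp add: r)
  finally show ?case .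
qed

text \<open>Concatenation is strictly associative, so the associator has to become an identity on
  normal forms. The induction has \<open>lunit_tens\<close> as its base and the pentagon as its
  step.\<close>

lemma append_mor_assoc:
  "append_mor xs (ys @ zs) \<cdot> (Id V (tens_list xs) \<boxtimes> append_mor ys zs) \<cdot>
      assoc V (tens_list xs) (tens_list ys) (tens_list zs)
    = append_mor (xs @ ys) zs \<cdot> (append_mor xs ys \<boxtimes> Id V (tens_list zs))"
proof (induction xs)
  case Nil
  have "lunit V (tens_list (ys @ zs)) \<cdot> (Id V \<I> \<boxtimes> append_mor ys zs) \<cdot> assoc V \<I> (tens_list ys) (tens_list zs)
    = append_mor ys zs \<cdot> lunit V (tens_list ys \<otimes> tens_list zs) \<cdot> assoc V \<I> (tens_list ys) (tens_list zs)"
    by (subst Comp_extend[OF lunit_nat]) simp_all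
  then show ?case by (simp add: lunit_tens)
next
  case (Cons x xs)
  let ?x = "tens_list xs" and ?y = "tens_list ys" and ?z = "tens_list zs"
  have "append_mor (x # xs) (ys @ zs) \<cdot> (Id V (tens_list (x # xs)) \<boxtimes> append_mor ys zs) \<cdot>
      assoc V (tens_list (x # xs)) ?y ?z
    = (Id V (e x) \<boxtimes> append_mor xs (ys @ zs)) \<cdot> assoc V (e x) ?x (tens_list (ys @ zs)) \<cdot> 
       ((Id V (e x) \<boxtimes> Id V ?x) \<boxtimes> append_mor ys zs) \<cdot> assoc V (e x \<otimes> ?x) ?y ?z"
    by simp
  also have "\<dots> = (Id V (e x) \<boxtimes> append_mor xs (ys @ zs)) \<cdot> (Id V (e x) \<boxtimes> (Id V ?x \<boxtimes> append_mor ys zs)) \<cdot>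
       assoc V (e x) ?x (?y \<otimes> ?z) \<cdot> assoc V (e x \<otimes> ?x) ?y ?z"
    by (subst assoc_nat_extend) simp_all
  also have "\<dots> = (Id V (e x) \<boxtimes> (append_mor xs (ys @ zs) \<cdot> (Id V ?x \<boxtimes> append_mor ys zs) \<cdot> assoc V ?x ?y ?z)) \<cdot>
       assoc V (e x) (?x \<otimes> ?y) ?z \<cdot> (assoc V (e x) ?x ?y \<boxtimes> Id V ?z)"
    by (simp add: pentagon)
  also have "\<dots> = (Id V (e x) \<boxtimes> append_mor (xs @ ys) zs) \<cdot> (Id V (e x) \<boxtimes> (append_mor xs ys \<boxtimes> Id V ?z)) \<cdot>
       assoc V (e x) (?x \<otimes> ?y) ?z \<cdot> (assoc V (e x) ?x ?y \<boxtimes> Id V ?z)"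
    by (subst Cons.IH) simp_all
  also have "\<dots> = append_mor ((x # xs) @ ys) zs \<cdot> (append_mor (x # xs) ys \<boxtimes> Id V ?z)"
    using assoc_nat_extend[of "Id V (e x)" "append_mor xs ys" "Id V ?z" "e x" "tens_list (xs @ ys)" ?z
        "assoc V (e x) ?x ?y \<boxtimes> Id V ?z"] by simp
  finally show ?case .
qed

lemma append_mor_Nil: "append_mor xs [] = runit V (tens_list xs)"
  by (induction xs) (simp_all add: lunit_runit_unit runit_tens)

text \<open>Induction on \<open>ys\<close>. The hexagon in the form \<open>braid_tens\<close> splits
  the braiding with \<open>e y \<otimes> tens_list ys\<close> into a \<open>swap\<close> with
  \<open>e y\<close>, which is a \<open>pull\<close> by \<open>pull_append_right\<close>, and the
  braiding with \<open>tens_list ys\<close>.\<close>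

lemma append_mor_braid:
  assumes "distinct (xs @ ys)"
  shows "append_mor ys xs \<cdot> braid V (tens_list xs) (tens_list ys)
    = perm_mor (ys @ xs) (xs @ ys) \<cdot> append_mor xs ys"
  using assms
proof (induction ys)
  case Nil
  then show ?case by (simp add: lunit_braid append_mor_Nil perm_mor_refl)
next
  case (Cons y ys)
  have r [simp]: "remove1 y (xs @ y # ys) = xs @ ys" "y \<in> set (xs @ y # ys)" "y \<notin> set xs"
    using Cons.prems by (auto simp: remove1_append)
  have p [simp]: "rearranges (xs @ ys) (ys @ xs)" using Cons.prems by (auto simp: rearranges_def)
  let ?x = "tens_list xs" and ?y = "tens_list ys"
  have "append_mor (y # ys) xs \<cdot> braid V ?x (tens_list (y # ys))
    = (Id V (e y) \<boxtimes> append_mor ys xs) \<cdot> assoc V (e y) ?y ?x \<cdot> braid V ?x (e y \<otimes> ?y)"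
    by simp
  also have "\<dots> = (Id V (e y) \<boxtimes> (append_mor ys xs \<cdot> braid V ?x ?y)) \<cdot> swap ?x (e y) ?y"
    by (simp add: braid_tens)
  also have "\<dots> = (Id V (e y) \<boxtimes> perm_mor (ys @ xs) (xs @ ys)) \<cdot> (Id V (e y) \<boxtimes> append_mor xs ys) \<cdot> swap ?x (e y) ?y"
    by (subst Cons.IH) (use Cons.prems in simp_all)
  also have "\<dots> = (Id V (e y) \<boxtimes> perm_mor (ys @ xs) (xs @ ys)) \<cdot> pull y (xs @ y # ys) \<cdot> append_mor xs (y # ys)"
    by (subst pull_append_right) simp_all
  also have "\<dots> = perm_mor ((y # ys) @ xs) (xs @ y # ys) \<cdot> append_mor xs (y # ys)"
    using r(2) by simp
  finally show ?case .
qed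

section \<open>Normal forms of shapes and of canonical morphisms\<close>

lemma sem_Obj [simp]: "sem e s \<in> Obj V"
  by (induction s) simp_all

text \<open>Products over lists end in \<open>\<I>\<close>, so a single leaf is sent to
  \<open>e i \<otimes> \<I>\<close> and needs \<open>runit_inv\<close>.\<close>

primrec flatten :: "'i shape \<Rightarrow> 'm" where
  "flatten (Leaf i) = runit_inv (e i)"
| "flatten Unit = Id V \<I>"
| "flatten (Node s t) = append_mor (leaves s) (leaves t) \<cdot> (flatten s \<boxtimes> flatten t)"

lemma flatten_simps [simp]:
  "flatten s \<in> Mor V" "Dom V (flatten s) = sem e s" "Cod V (flatten s) = tens_list (leaves s)"
  "iso_mor V (flatten s)"
proof -
  have "flatten s \<in> Mor V \<and> Dom V (flatten s) = sem e s \<and> Cod V (flatten s) = tens_list (leaves s) \<and>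
    iso_mor V (flatten s)"
    by (induction s) (auto simp: inv_mor_iso)
  then show "flatten s \<in> Mor V" "Dom V (flatten s) = sem e s" "Cod V (flatten s) = tens_list (leaves s)"
    "iso_mor V (flatten s)" by auto
qed

lemma sem_mor_simps [simp]:
  assumes "composable c"
  shows "sem_mor e c \<in> Mor V" "Dom V (sem_mor e c) = sem e (cdom c)" "Cod V (sem_mor e c) = sem e (ccod c)"
proof -
  have "composable c \<Longrightarrow>
    sem_mor e c \<in> Mor V \<and> Dom V (sem_mor e c) = sem e (cdom c) \<and> Cod V (sem_mor e c) = sem e (ccod c)"
    by (induction c) auto
  then show "sem_mor e c \<in> Mor V" "Dom V (sem_mor e c) = sem e (cdom c)" "Cod V (sem_mor e c) = sem e (ccod c)"
    using assms by auto
qed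

lemma rearranges_leaves:
  "composable c \<Longrightarrow> distinct (leaves (cdom c)) \<Longrightarrow> rearranges (leaves (cdom c)) (leaves (ccod c))"
  by (simp add: rearranges_def set_leaves_ccod distinct_leaves_ccod)

lemma flatten_assoc:
  "flatten (Node s (Node t u)) \<cdot> assoc V (sem e s) (sem e t) (sem e u) = flatten (Node (Node s t) u)"
proof -
  let ?s = "leaves s" and ?t = "leaves t" and ?u = "leaves u"
  have "flatten (Node s (Node t u)) \<cdot> assoc V (sem e s) (sem e t) (sem e u)
    = append_mor ?s (?t @ ?u) \<cdot> (Id V (tens_list ?s) \<boxtimes> append_mor ?t ?u) \<cdot> 
       (flatten s \<boxtimes> (flatten t \<boxtimes> flatten u)) \<cdot> assoc V (sem e s) (sem e t) (sem e u)"
    by simp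
  also have "\<dots> = (append_mor ?s (?t @ ?u) \<cdot> (Id V (tens_list ?s) \<boxtimes> append_mor ?t ?u) \<cdot> 
       assoc V (tens_list ?s) (tens_list ?t) (tens_list ?u)) \<cdot> ((flatten s \<boxtimes> flatten t) \<boxtimes> flatten u)"
    using assoc_nat[of "flatten s" "flatten t" "flatten u"] by simp
  also have "\<dots> = flatten (Node (Node s t) u)"
    by (subst append_mor_assoc) simp
  finally show ?thesis .
qed

lemma flatten_lunit: "flatten s \<cdot> lunit V (sem e s) = flatten (Node Unit s)"
  by (simp add: lunit_nat)

lemma flatten_runit: "flatten s \<cdot> runit V (sem e s) = flatten (Node s Unit)"
  by (simp add: append_mor_Nil runit_nat)

text \<open>Conjugated by \<open>flatten\<close>, associators and unitors become identities and
  braidings become block permutations; \<open>perm_mor_Comp\<close> and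
  \<open>append_mor_natural\<close> handle composition and tensor. The resulting normal form depends
  on \<open>c\<close> only through its two shapes.\<close>

lemma flatten_natural:
  assumes "composable c" "distinct (leaves (cdom c))"
  shows "flatten (ccod c) \<cdot> sem_mor e c = perm_mor (leaves (ccod c)) (leaves (cdom c)) \<cdot> flatten (cdom c)"
  using assms
proof (induction c)
  case (CId s)
  then show ?case by (simp add: perm_mor_refl)
next
  case (CAssoc s t u)
  then show ?case using flatten_assoc[of s t u] by (simp add: perm_mor_refl del: flatten.simps)
next
  case (CAssocInv s t u)
  then show ?case
    using flatten_assoc[of s t u, symmetric] by (simp add: perm_mor_refl del: flatten.simps)
next
  case (CLunit s)
  then show ?case using flatten_lunit[of s] by (simp add: perm_mor_refl del: flatten.simps)
next
  case (CLunitInv s)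
  then show ?case using flatten_lunit[of s, symmetric] by (simp add: perm_mor_refl del: flatten.simps)
next
  case (CRunit s)
  then show ?case using flatten_runit[of s] by (simp add: perm_mor_refl del: flatten.simps)
next
  case (CRunitInv s)
  then show ?case using flatten_runit[of s, symmetric] by (simp add: perm_mor_refl del: flatten.simps)
next
  case (CBraid s t)
  have [simp]: "rearranges (leaves s @ leaves t) (leaves t @ leaves s)"
    using CBraid by (auto simp: rearranges_def)
  have "flatten (Node t s) \<cdot> braid V (sem e s) (sem e t)
    = append_mor (leaves t) (leaves s) \<cdot> (flatten t \<boxtimes> flatten s) \<cdot> braid V (sem e s) (sem e t)"
    by simp
  also have "\<dots> = (append_mor (leaves t) (leaves s) \<cdot> braid V (tens_list (leaves s)) (tens_list (leaves t))) \<cdot>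
      (flatten s \<boxtimes> flatten t)"
    using braid_nat[of "flatten s" "flatten t"] by simp
  also have "\<dots> = perm_mor (leaves t @ leaves s) (leaves s @ leaves t) \<cdot> flatten (Node s t)"
    by (subst append_mor_braid) (use CBraid in simp_all)
  finally show ?case by simp
next
  case (CComp d c)
  then have c: "composable c" "composable d" "ccod c = cdom d" "distinct (leaves (cdom c))" by auto
  \<comment> \<open>The premise for \<open>d\<close> lives at the intermediate shape; canonical
    morphisms preserve distinctness of leaves.\<close>
  have "distinct (leaves (cdom d))" using distinct_leaves_ccod[OF c(1,4)] c(3) by simp
  note r = rearranges_leaves[OF c(1,4)] rearranges_leaves[OF c(2) this]
  have IHd: "flatten (ccod d) \<cdot> sem_mor e d = perm_mor (leaves (ccod d)) (leaves (cdom d)) \<cdot> flatten (cdom d)"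
    by (rule CComp.IH) fact+
  have IHc: "flatten (cdom d) \<cdot> sem_mor e c = perm_mor (leaves (cdom d)) (leaves (cdom c)) \<cdot> flatten (cdom c)"
    using CComp.IH(2) c by simp
  have "flatten (ccod d) \<cdot> sem_mor e d \<cdot> sem_mor e c
    = perm_mor (leaves (ccod d)) (leaves (cdom d)) \<cdot> flatten (cdom d) \<cdot> sem_mor e c"
    by (subst Comp_extend[OF IHd]) (use c r in simp_all)
  also have "\<dots> = (perm_mor (leaves (ccod d)) (leaves (cdom d)) \<cdot> perm_mor (leaves (cdom d)) (leaves (cdom c))) \<cdot> flatten (cdom c)"
    unfolding IHc using c r by simp
  also have "\<dots> = perm_mor (leaves (ccod d)) (leaves (cdom c)) \<cdot> flatten (cdom c)"
    by (subst perm_mor_Comp) (use c r in simp_all)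
  finally show ?case by simp
next
  case (CTens c d)
  then have c [simp]: "composable c" "composable d" "distinct (leaves (cdom c))" "distinct (leaves (cdom d))"
    and i: "set (leaves (cdom c)) \<inter> set (leaves (cdom d)) = {}" by auto
  note r [simp] = rearranges_leaves[OF c(1,3)] rearranges_leaves[OF c(2,4)]
  have [simp]: "rearranges (leaves (cdom c) @ leaves (cdom d)) (leaves (ccod c) @ leaves (ccod d))"
    using r i by (auto simp: rearranges_def)
  have "flatten (ccod (CTens c d)) \<cdot> sem_mor e (CTens c d)
    = append_mor (leaves (ccod c)) (leaves (ccod d)) \<cdot> 
       ((flatten (ccod c) \<cdot> sem_mor e c) \<boxtimes> (flatten (ccod d) \<cdot> sem_mor e d))"
    by simp
  also have "\<dots> = (append_mor (leaves (ccod c)) (leaves (ccod d)) \<cdot>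
      (perm_mor (leaves (ccod c)) (leaves (cdom c)) \<boxtimes> perm_mor (leaves (ccod d)) (leaves (cdom d)))) \<cdot>
       (flatten (cdom c) \<boxtimes> flatten (cdom d))"
    by (simp add: CTens.IH)
  also have "\<dots> = perm_mor (leaves (ccod (CTens c d))) (leaves (cdom (CTens c d))) \<cdot> flatten (cdom (CTens c d))"
    by (subst append_mor_natural) (use i in simp_all)
  finally show ?case .
qed

text \<open>Both morphisms have the same \<open>perm_mor\<close> as normal form, and
  \<open>flatten\<close> of the codomain is an isomorphism.\<close>

lemma canonical_unique:
  assumes "composable c" "composable d" "cdom c = cdom d" "ccod c = ccod d" "distinct (leaves (cdom c))"
  shows "sem_mor e c = sem_mor e d"
proof (rule iso_monic)
  show "flatten (ccod c) \<cdot> sem_mor e c = flatten (ccod c) \<cdot> sem_mor e d"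
    using flatten_natural[of c] flatten_natural[of d] assms by simp
qed (use assms in simp_all)

end

text \<open>Leaves are positions in \<open>xs\<close>, hence distinct even when objects repeat in
  \<open>xs\<close>. The default \<open>\<I>\<close> lets every index denote an object, as
  \<open>canonical_unique\<close> requires.\<close>

definition env :: "'o list \<Rightarrow> nat \<Rightarrow> 'o" where
  "env xs i = (if i < length xs then xs ! i else \<I>)"

text \<open>To use it, both sides of an identity are written as \<open>canon\<close> expressions
  over numbered leaves; \<open>simp\<close> evaluates \<open>sem_mor\<close> and discharges the
  conditions on shapes.\<close>

theorem coherence:
  assumes "set xs \<subseteq> Obj V"
    and "composable c" "composable d" "cdom c = cdom d" "ccod c = ccod d" "distinct (leaves (cdom c))"
  shows "sem_mor (env xs) c = sem_mor (env xs) d"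
proof (rule canonical_unique)
  show "env xs i \<in> Obj V" for i using assms(1) nth_mem[of i xs] by (auto simp: env_def)
qed (use assms in auto)

end

section \<open>The interchange isomorphism\<close>

text \<open>The syntactic copy of \<open>interchange\<close>, kept as a unit by
  \<open>sem_mor_CInter\<close> so that evaluating an expression gives \<open>interchange\<close>
  back and not its associators and braidings.\<close>

definition CInter :: "'i shape \<Rightarrow> 'i shape \<Rightarrow> 'i shape \<Rightarrow> 'i shape \<Rightarrow> 'i canon" where
  "CInter s t u v =
     CComp (CAssocInv s u (Node t v))
       (CComp (CTens (CId s) (CComp (CAssoc u t v) (CComp (CTens (CBraid t u) (CId v)) (CAssocInv t u v))))
         (CAssoc s t (Node u v)))"

lemma CInter_simps [simp]:
  "composable (CInter s t u v)"
  "cdom (CInter s t u v) = Node (Node s t) (Node u v)"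
  "ccod (CInter s t u v) = Node (Node s u) (Node t v)"
  by (simp_all add: CInter_def)

context symmetric_monoidal_category
begin

lemma sem_mor_CInter [simp]:
  "sem_mor e (CInter s t u v) = interchange V (sem e s) (sem e t) (sem e u) (sem e v)"
  by (simp add: CInter_def interchange_def)

lemma interchange_swap:
  "interchange V a b c d = assoc_inv a c (b \<otimes> d) \<cdot> (Id V a \<boxtimes> swap b c d) \<cdot> assoc V a b (c \<otimes> d)"
  by (simp add: interchange_def swap_def)

lemma interchange_simps [simp]:
  assumes "a \<in> Obj V" "b \<in> Obj V" "c \<in> Obj V" "d \<in> Obj V"
  shows "interchange V a b c d \<in> Mor V" "Dom V (interchange V a b c d) = (a \<otimes> b) \<otimes> (c \<otimes> d)"
    "Cod V (interchange V a b c d) = (a \<otimes> c) \<otimes> (b \<otimes> d)"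
  using assms by (simp_all add: interchange_swap)

lemma interchange_nat:
  assumes [simp]: "f \<in> Mor V" "g \<in> Mor V" "h \<in> Mor V" "k \<in> Mor V"
    and c: "Cod V f = a" "Cod V g = b" "Cod V h = c" "Cod V k = d"
  shows "interchange V a b c d \<cdot> ((f \<boxtimes> g) \<boxtimes> (h \<boxtimes> k))
    = ((f \<boxtimes> h) \<boxtimes> (g \<boxtimes> k)) \<cdot> interchange V (Dom V f) (Dom V g) (Dom V h) (Dom V k)"
proof (rule iso_monic)
  have [simp]: "a \<in> Obj V" "b \<in> Obj V" "c \<in> Obj V" "d \<in> Obj V" using c by auto
  note [simp] = c
  let ?a = "Dom V f" and ?b = "Dom V g" and ?c = "Dom V h" and ?d = "Dom V k"
  have "assoc V a c (b \<otimes> d) \<cdot> interchange V a b c d \<cdot> ((f \<boxtimes> g) \<boxtimes> (h \<boxtimes> k))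
    = (Id V a \<boxtimes> swap b c d) \<cdot> (f \<boxtimes> (g \<boxtimes> (h \<boxtimes> k))) \<cdot> assoc V ?a ?b (?c \<otimes> ?d)"
    by (simp add: interchange_swap assoc_nat del: tens_Comp_extend)
  also have "\<dots> = (f \<boxtimes> (h \<boxtimes> (g \<boxtimes> k))) \<cdot> (Id V ?a \<boxtimes> swap ?b ?c ?d) \<cdot> assoc V ?a ?b (?c \<otimes> ?d)"
    by (simp add: swap_nat)
  also have "\<dots> = (f \<boxtimes> (h \<boxtimes> (g \<boxtimes> k))) \<cdot> assoc V ?a ?c (?b \<otimes> ?d) \<cdot> interchange V ?a ?b ?c ?d"
    by (simp add: interchange_swap)
  also have "\<dots> = assoc V a c (b \<otimes> d) \<cdot> ((f \<boxtimes> h) \<boxtimes> (g \<boxtimes> k)) \<cdot> interchange V ?a ?b ?c ?d"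
    by (subst assoc_nat_extend) simp_all
  finally show "assoc V a c (b \<otimes> d) \<cdot> interchange V a b c d \<cdot> ((f \<boxtimes> g) \<boxtimes> (h \<boxtimes> k))
    = assoc V a c (b \<otimes> d) \<cdot> ((f \<boxtimes> h) \<boxtimes> (g \<boxtimes> k)) \<cdot> interchange V ?a ?b ?c ?d" .
qed (use c in auto)

lemma interchange_nat_extend:
  assumes "f \<in> Mor V" "g \<in> Mor V" "h \<in> Mor V" "k \<in> Mor V"
    and "Cod V f = a" "Cod V g = b" "Cod V h = c" "Cod V k = d"
    and "l \<in> Mor V" "Cod V l = (Dom V f \<otimes> Dom V g) \<otimes> (Dom V h \<otimes> Dom V k)"
  shows "interchange V a b c d \<cdot> ((f \<boxtimes> g) \<boxtimes> (h \<boxtimes> k)) \<cdot> l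
    = ((f \<boxtimes> h) \<boxtimes> (g \<boxtimes> k)) \<cdot> interchange V (Dom V f) (Dom V g) (Dom V h) (Dom V k) \<cdot> l"
  by (subst Comp_extend[OF interchange_nat[OF assms(1-8)]]) (use assms in auto)

text \<open>Naturality read from right to left. The domains are equational premises so that the
  objects of \<open>interchange\<close> match as they are written and not as
  \<open>Dom V f\<close>.\<close>

lemma interchange_nat_rev:
  assumes "f \<in> Mor V" "g \<in> Mor V" "h \<in> Mor V" "k \<in> Mor V"
    and "Dom V f = a" "Dom V g = b" "Dom V h = c" "Dom V k = d"
    and "l \<in> Mor V" "Cod V l = (a \<otimes> b) \<otimes> (c \<otimes> d)"
  shows "((f \<boxtimes> h) \<boxtimes> (g \<boxtimes> k)) \<cdot> interchange V a b c d \<cdot> l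
    = interchange V (Cod V f) (Cod V g) (Cod V h) (Cod V k) \<cdot> ((f \<boxtimes> g) \<boxtimes> (h \<boxtimes> k)) \<cdot> l"
  using interchange_nat_extend[OF assms(1-4) refl refl refl refl, of l] assms(5-) by simp

section \<open>Coherence identities for the interchange\<close>

lemma interchange_assoc:
  assumes "a \<in> Obj V" "b \<in> Obj V" "c \<in> Obj V" "a' \<in> Obj V" "b' \<in> Obj V" "c' \<in> Obj V"
  shows "(assoc V a b c \<boxtimes> assoc V a' b' c') \<cdot> interchange V (a \<otimes> b) (a' \<otimes> b') c c' \<cdot>
      (interchange V a a' b b' \<boxtimes> Id V (c \<otimes> c'))
    = interchange V a a' (b \<otimes> c) (b' \<otimes> c') \<cdot> (Id V (a \<otimes> a') \<boxtimes> interchange V b b' c c') \<cdot>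
      assoc V (a \<otimes> a') (b \<otimes> b') (c \<otimes> c')"
  using coherence[of "[a, b, c, a', b', c']"
      "CComp (CTens (CAssoc (Leaf 0) (Leaf 1) (Leaf 2)) (CAssoc (Leaf 3) (Leaf 4) (Leaf 5)))
        (CComp (CInter (Node (Leaf 0) (Leaf 1)) (Node (Leaf 3) (Leaf 4)) (Leaf 2) (Leaf 5))
          (CTens (CInter (Leaf 0) (Leaf 3) (Leaf 1) (Leaf 4)) (CId (Node (Leaf 2) (Leaf 5)))))"
      "CComp (CInter (Leaf 0) (Leaf 3) (Node (Leaf 1) (Leaf 2)) (Node (Leaf 4) (Leaf 5)))
        (CComp (CTens (CId (Node (Leaf 0) (Leaf 3))) (CInter (Leaf 1) (Leaf 4) (Leaf 2) (Leaf 5)))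
          (CAssoc (Node (Leaf 0) (Leaf 3)) (Node (Leaf 1) (Leaf 4)) (Node (Leaf 2) (Leaf 5))))"]
    assms
  by (simp add: env_def)

lemma interchange_coassoc:
  assumes "a \<in> Obj V" "a' \<in> Obj V" "a'' \<in> Obj V" "b \<in> Obj V" "b' \<in> Obj V" "b'' \<in> Obj V"
  shows "assoc V (a \<otimes> b) (a' \<otimes> b') (a'' \<otimes> b'') \<cdot> (interchange V a a' b b' \<boxtimes> Id V (a'' \<otimes> b'')) \<cdot>
      interchange V (a \<otimes> a') a'' (b \<otimes> b') b''
    = (Id V (a \<otimes> b) \<boxtimes> interchange V a' a'' b' b'') \<cdot> interchange V a (a' \<otimes> a'') b (b' \<otimes> b'') \<cdot>
      (assoc V a a' a'' \<boxtimes> assoc V b b' b'')"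
  using coherence[of "[a, a', a'', b, b', b'']"
      "CComp (CAssoc (Node (Leaf 0) (Leaf 3)) (Node (Leaf 1) (Leaf 4)) (Node (Leaf 2) (Leaf 5)))
        (CComp (CTens (CInter (Leaf 0) (Leaf 1) (Leaf 3) (Leaf 4)) (CId (Node (Leaf 2) (Leaf 5))))
          (CInter (Node (Leaf 0) (Leaf 1)) (Leaf 2) (Node (Leaf 3) (Leaf 4)) (Leaf 5)))"
      "CComp (CTens (CId (Node (Leaf 0) (Leaf 3))) (CInter (Leaf 1) (Leaf 2) (Leaf 4) (Leaf 5)))
        (CComp (CInter (Leaf 0) (Node (Leaf 1) (Leaf 2)) (Leaf 3) (Node (Leaf 4) (Leaf 5)))
          (CTens (CAssoc (Leaf 0) (Leaf 1) (Leaf 2)) (CAssoc (Leaf 3) (Leaf 4) (Leaf 5))))"]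
    assms
  by (simp add: env_def)

text \<open>To be read with \<open>m, m'\<close> and \<open>n, n'\<close> as the coproducts of two
  elements of \<open>B\<close>, and \<open>c, d\<close> and \<open>c', d'\<close> as those of the
  arguments of two measuring morphisms. The left side groups by measuring morphism; the right side
  groups by element of \<open>B\<close> and then exchanges the middle factors.\<close>

lemma interchange_interchange:
  assumes "m \<in> Obj V" "n \<in> Obj V" "c \<in> Obj V" "d \<in> Obj V"
    "m' \<in> Obj V" "n' \<in> Obj V" "c' \<in> Obj V" "d' \<in> Obj V"
  shows "(interchange V m n c d \<boxtimes> interchange V m' n' c' d') \<cdot>
      interchange V (m \<otimes> n) (m' \<otimes> n') (c \<otimes> d) (c' \<otimes> d') \<cdot>
      (interchange V m m' n n' \<boxtimes> Id V ((c \<otimes> d) \<otimes> (c' \<otimes> d')))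
    = interchange V (m \<otimes> c) (m' \<otimes> c') (n \<otimes> d) (n' \<otimes> d') \<cdot>
      (interchange V m m' c c' \<boxtimes> interchange V n n' d d') \<cdot>
      interchange V (m \<otimes> m') (n \<otimes> n') (c \<otimes> c') (d \<otimes> d') \<cdot>
      (Id V ((m \<otimes> m') \<otimes> (n \<otimes> n')) \<boxtimes> interchange V c d c' d')"
  using coherence[of "[m, n, c, d, m', n', c', d']"
      "CComp (CTens (CInter (Leaf 0) (Leaf 1) (Leaf 2) (Leaf 3)) (CInter (Leaf 4) (Leaf 5) (Leaf 6) (Leaf 7)))
        (CComp (CInter (Node (Leaf 0) (Leaf 1)) (Node (Leaf 4) (Leaf 5)) (Node (Leaf 2) (Leaf 3)) (Node (Leaf 6) (Leaf 7)))
          (CTens (CInter (Leaf 0) (Leaf 4) (Leaf 1) (Leaf 5))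
            (CId (Node (Node (Leaf 2) (Leaf 3)) (Node (Leaf 6) (Leaf 7))))))"
      "CComp (CInter (Node (Leaf 0) (Leaf 2)) (Node (Leaf 4) (Leaf 6)) (Node (Leaf 1) (Leaf 3)) (Node (Leaf 5) (Leaf 7)))
        (CComp (CTens (CInter (Leaf 0) (Leaf 4) (Leaf 2) (Leaf 6)) (CInter (Leaf 1) (Leaf 5) (Leaf 3) (Leaf 7)))
          (CComp (CInter (Node (Leaf 0) (Leaf 4)) (Node (Leaf 1) (Leaf 5)) (Node (Leaf 2) (Leaf 6)) (Node (Leaf 3) (Leaf 7)))
            (CTens (CId (Node (Node (Leaf 0) (Leaf 4)) (Node (Leaf 1) (Leaf 5))))
              (CInter (Leaf 2) (Leaf 3) (Leaf 6) (Leaf 7)))))"]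
    assms
  by (simp add: env_def)

lemma interchange_braid:
  assumes "a \<in> Obj V" "b \<in> Obj V" "c \<in> Obj V" "d \<in> Obj V"
  shows "interchange V c d a b \<cdot> braid V (a \<otimes> b) (c \<otimes> d) = (braid V a c \<boxtimes> braid V b d) \<cdot> interchange V a b c d"
  using coherence[of "[a, b, c, d]"
      "CComp (CInter (Leaf 2) (Leaf 3) (Leaf 0) (Leaf 1)) (CBraid (Node (Leaf 0) (Leaf 1)) (Node (Leaf 2) (Leaf 3)))"
      "CComp (CTens (CBraid (Leaf 0) (Leaf 2)) (CBraid (Leaf 1) (Leaf 3))) (CInter (Leaf 0) (Leaf 1) (Leaf 2) (Leaf 3))"]
    assms
  by (simp add: env_def)

lemma braid_interchange:
  assumes "a \<in> Obj V" "b \<in> Obj V" "c \<in> Obj V" "d \<in> Obj V"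
  shows "braid V (a \<otimes> c) (b \<otimes> d) \<cdot> interchange V a b c d = interchange V b a d c \<cdot> (braid V a b \<boxtimes> braid V c d)"
  using coherence[of "[a, b, c, d]"
      "CComp (CBraid (Node (Leaf 0) (Leaf 2)) (Node (Leaf 1) (Leaf 3))) (CInter (Leaf 0) (Leaf 1) (Leaf 2) (Leaf 3))"
      "CComp (CInter (Leaf 1) (Leaf 0) (Leaf 3) (Leaf 2)) (CTens (CBraid (Leaf 0) (Leaf 1)) (CBraid (Leaf 2) (Leaf 3)))"]
    assms
  by (simp add: env_def)

lemma lunit_interchange:
  assumes "c \<in> Obj V" "d \<in> Obj V"
  shows "lunit V (c \<otimes> d) \<cdot> (lunit V \<I> \<boxtimes> Id V (c \<otimes> d)) \<cdot> interchange V \<I> c \<I> d = lunit V c \<boxtimes> lunit V d"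
  using coherence[of "[c, d]"
      "CComp (CLunit (Node (Leaf 0) (Leaf 1))) (CComp (CTens (CLunit Unit) (CId (Node (Leaf 0) (Leaf 1))))
        (CInter Unit (Leaf 0) Unit (Leaf 1)))"
      "CTens (CLunit (Leaf 0)) (CLunit (Leaf 1))"]
    assms
  by (simp add: env_def)

lemma runit_interchange:
  assumes "c \<in> Obj V" "d \<in> Obj V"
  shows "runit V (c \<otimes> d) \<cdot> (Id V (c \<otimes> d) \<boxtimes> lunit V \<I>) \<cdot> interchange V c \<I> d \<I> = runit V c \<boxtimes> runit V d"
  using coherence[of "[c, d]"
      "CComp (CRunit (Node (Leaf 0) (Leaf 1))) (CComp (CTens (CId (Node (Leaf 0) (Leaf 1))) (CLunit Unit))
        (CInter (Leaf 0) Unit (Leaf 1) Unit))"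
      "CTens (CRunit (Leaf 0)) (CRunit (Leaf 1))"]
    assms
  by (simp add: env_def)

lemma interchange_lunit:
  assumes "c \<in> Obj V" "d \<in> Obj V"
  shows "(lunit V c \<boxtimes> lunit V d) \<cdot> interchange V \<I> \<I> c d \<cdot> (lunit_inv \<I> \<boxtimes> Id V (c \<otimes> d)) = lunit V (c \<otimes> d)"
  using coherence[of "[c, d]"
      "CComp (CTens (CLunit (Leaf 0)) (CLunit (Leaf 1))) (CComp (CInter Unit Unit (Leaf 0) (Leaf 1))
        (CTens (CLunitInv Unit) (CId (Node (Leaf 0) (Leaf 1)))))"
      "CLunit (Node (Leaf 0) (Leaf 1))"]
    assms
  by (simp add: env_def)

lemma interchange_runit:
  assumes "c \<in> Obj V" "d \<in> Obj V"
  shows "(runit V c \<boxtimes> runit V d) \<cdot> interchange V c d \<I> \<I> \<cdot> (Id V (c \<otimes> d) \<boxtimes> lunit_inv \<I>) = runit V (c \<otimes> d)"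
  using coherence[of "[c, d]"
      "CComp (CTens (CRunit (Leaf 0)) (CRunit (Leaf 1))) (CComp (CInter (Leaf 0) (Leaf 1) Unit Unit)
        (CTens (CId (Node (Leaf 0) (Leaf 1))) (CLunitInv Unit)))"
      "CRunit (Node (Leaf 0) (Leaf 1))"]
    assms
  by (simp add: env_def)

section \<open>Monoids and comonoids\<close>

lemma is_comonoidD:
  assumes "is_comonoid V C"
  shows "ccarr C \<in> Obj V"
    and "ccomult C \<in> Mor V" "Dom V (ccomult C) = ccarr C" "Cod V (ccomult C) = ccarr C \<otimes> ccarr C"
    and "ccounit C \<in> Mor V" "Dom V (ccounit C) = ccarr C" "Cod V (ccounit C) = \<I>"
    and "assoc V (ccarr C) (ccarr C) (ccarr C) \<cdot> (ccomult C \<boxtimes> Id V (ccarr C)) \<cdot> ccomult C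
      = (Id V (ccarr C) \<boxtimes> ccomult C) \<cdot> ccomult C"
    and "lunit V (ccarr C) \<cdot> (ccounit C \<boxtimes> Id V (ccarr C)) \<cdot> ccomult C = Id V (ccarr C)"
    and "runit V (ccarr C) \<cdot> (Id V (ccarr C) \<boxtimes> ccounit C) \<cdot> ccomult C = Id V (ccarr C)"
  using assms by (auto simp: is_comonoid_def Let_def hom_def)

lemma is_monoidD:
  assumes "is_monoid V M"
  shows "mcarr M \<in> Obj V"
    and "mmult M \<in> Mor V" "Dom V (mmult M) = mcarr M \<otimes> mcarr M" "Cod V (mmult M) = mcarr M"
    and "munit M \<in> Mor V" "Dom V (munit M) = \<I>" "Cod V (munit M) = mcarr M"
    and "mmult M \<cdot> (mmult M \<boxtimes> Id V (mcarr M))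
      = mmult M \<cdot> (Id V (mcarr M) \<boxtimes> mmult M) \<cdot> assoc V (mcarr M) (mcarr M) (mcarr M)"
    and "mmult M \<cdot> (munit M \<boxtimes> Id V (mcarr M)) = lunit V (mcarr M)"
    and "mmult M \<cdot> (Id V (mcarr M) \<boxtimes> munit M) = runit V (mcarr M)"
  using assms by (auto simp: is_monoid_def Let_def hom_def)

lemma comon_homD:
  assumes "f \<in> comon_hom V C D"
  shows "f \<in> Mor V" "Dom V f = ccarr C" "Cod V f = ccarr D"
    "ccomult D \<cdot> f = (f \<boxtimes> f) \<cdot> ccomult C" "ccounit D \<cdot> f = ccounit C"
  using assms by (auto simp: comon_hom_def hom_def)

lemma tens_comon_simps [simp]:
  "ccarr (tens_comon V C D) = ccarr C \<otimes> ccarr D"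
  "ccomult (tens_comon V C D) = interchange V (ccarr C) (ccarr C) (ccarr D) (ccarr D) \<cdot> (ccomult C \<boxtimes> ccomult D)"
  "ccounit (tens_comon V C D) = lunit V \<I> \<cdot> (ccounit C \<boxtimes> ccounit D)"
  by (simp_all add: tens_comon_def)

lemma unit_comon_simps [simp]:
  "ccarr (unit_comon V) = \<I>" "ccomult (unit_comon V) = lunit_inv \<I>" "ccounit (unit_comon V) = Id V \<I>"
  by (simp_all add: unit_comon_def)

text \<open>Coassociativity concerns shapes built from \<open>Unit\<close> alone, so there are no
  leaves and the empty environment suffices.\<close>

lemma is_comonoid_unit: "is_comonoid V (unit_comon V)"
  using coherence[of "[]" "CComp (CAssoc Unit Unit Unit) (CComp (CTens (CLunitInv Unit) (CId Unit)) (CLunitInv Unit))"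
      "CComp (CTens (CId Unit) (CLunitInv Unit)) (CLunitInv Unit)"]
  by (simp add: is_comonoid_def Let_def hom_iff lunit_runit_unit[symmetric])

text \<open>\<open>interchange_coassoc\<close> reduces coassociativity to that of \<open>C\<close>
  and \<open>D\<close> side by side; \<open>lunit_interchange\<close> and
  \<open>runit_interchange\<close> do the same for the counit laws.\<close>

lemma is_comonoid_tens:
  assumes "is_comonoid V C" "is_comonoid V D"
  shows "is_comonoid V (tens_comon V C D)"
proof -
  define c d \<gamma> \<delta> \<epsilon> \<zeta> where defs: "c = ccarr C" "d = ccarr D" "\<gamma> = ccomult C" "\<delta> = ccomult D"
    "\<epsilon> = ccounit C" "\<zeta> = ccounit D"
  note C = is_comonoidD[OF assms(1), folded defs] and D = is_comonoidD[OF assms(2), folded defs]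
  note [simp] = C(1-7) D(1-7)
  let ?t = "interchange V c c d d \<cdot> (\<gamma> \<boxtimes> \<delta>)"
  have "assoc V (c \<otimes> d) (c \<otimes> d) (c \<otimes> d) \<cdot> (?t \<boxtimes> Id V (c \<otimes> d)) \<cdot> ?t
    = assoc V (c \<otimes> d) (c \<otimes> d) (c \<otimes> d) \<cdot> (interchange V c c d d \<boxtimes> Id V (c \<otimes> d)) \<cdot>
      ((\<gamma> \<boxtimes> \<delta>) \<boxtimes> (Id V c \<boxtimes> Id V d)) \<cdot> interchange V c c d d \<cdot> (\<gamma> \<boxtimes> \<delta>)"
    by simp
  also have "\<dots> = (assoc V (c \<otimes> d) (c \<otimes> d) (c \<otimes> d) \<cdot> (interchange V c c d d \<boxtimes> Id V (c \<otimes> d)) \<cdot>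
      interchange V (c \<otimes> c) c (d \<otimes> d) d) \<cdot> ((\<gamma> \<boxtimes> Id V c) \<boxtimes> (\<delta> \<boxtimes> Id V d)) \<cdot> (\<gamma> \<boxtimes> \<delta>)"
    by (subst interchange_nat_rev) simp_all
  also have "\<dots> = (Id V (c \<otimes> d) \<boxtimes> interchange V c c d d) \<cdot> interchange V c (c \<otimes> c) d (d \<otimes> d) \<cdot>
      ((assoc V c c c \<cdot> (\<gamma> \<boxtimes> Id V c) \<cdot> \<gamma>) \<boxtimes> (assoc V d d d \<cdot> (\<delta> \<boxtimes> Id V d) \<cdot> \<delta>))"
    by (subst interchange_coassoc) simp_all
  also have "\<dots> = (Id V (c \<otimes> d) \<boxtimes> interchange V c c d d) \<cdot> interchange V c (c \<otimes> c) d (d \<otimes> d) \<cdot>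
      ((Id V c \<boxtimes> \<gamma>) \<boxtimes> (Id V d \<boxtimes> \<delta>)) \<cdot> (\<gamma> \<boxtimes> \<delta>)"
    by (simp add: C(8) D(8))
  also have "\<dots> = (Id V (c \<otimes> d) \<boxtimes> interchange V c c d d) \<cdot> ((Id V c \<boxtimes> Id V d) \<boxtimes> (\<gamma> \<boxtimes> \<delta>)) \<cdot> ?t"
    by (subst interchange_nat_extend) simp_all
  finally have 1: "assoc V (c \<otimes> d) (c \<otimes> d) (c \<otimes> d) \<cdot> (?t \<boxtimes> Id V (c \<otimes> d)) \<cdot> ?t = (Id V (c \<otimes> d) \<boxtimes> ?t) \<cdot> ?t"
    by simp
  have "lunit V (c \<otimes> d) \<cdot> ((lunit V \<I> \<cdot> (\<epsilon> \<boxtimes> \<zeta>)) \<boxtimes> Id V (c \<otimes> d)) \<cdot> ?t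
    = lunit V (c \<otimes> d) \<cdot> (lunit V \<I> \<boxtimes> Id V (c \<otimes> d)) \<cdot> ((\<epsilon> \<boxtimes> \<zeta>) \<boxtimes> (Id V c \<boxtimes> Id V d)) \<cdot> ?t"
    by simp
  also have "\<dots> = (lunit V (c \<otimes> d) \<cdot> (lunit V \<I> \<boxtimes> Id V (c \<otimes> d)) \<cdot> interchange V \<I> c \<I> d) \<cdot>
      ((\<epsilon> \<boxtimes> Id V c) \<boxtimes> (\<zeta> \<boxtimes> Id V d)) \<cdot> (\<gamma> \<boxtimes> \<delta>)"
    by (subst interchange_nat_rev) simp_all
  also have "\<dots> = Id V (c \<otimes> d)"
    by (subst lunit_interchange) (simp_all add: C(9) D(9))
  finally have 2: "lunit V (c \<otimes> d) \<cdot> ((lunit V \<I> \<cdot> (\<epsilon> \<boxtimes> \<zeta>)) \<boxtimes> Id V (c \<otimes> d)) \<cdot> ?t = Id V (c \<otimes> d)" .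
  have "runit V (c \<otimes> d) \<cdot> (Id V (c \<otimes> d) \<boxtimes> (lunit V \<I> \<cdot> (\<epsilon> \<boxtimes> \<zeta>))) \<cdot> ?t
    = runit V (c \<otimes> d) \<cdot> (Id V (c \<otimes> d) \<boxtimes> lunit V \<I>) \<cdot> ((Id V c \<boxtimes> Id V d) \<boxtimes> (\<epsilon> \<boxtimes> \<zeta>)) \<cdot> ?t"
    by simp
  also have "\<dots> = (runit V (c \<otimes> d) \<cdot> (Id V (c \<otimes> d) \<boxtimes> lunit V \<I>) \<cdot> interchange V c \<I> d \<I>) \<cdot>
      ((Id V c \<boxtimes> \<epsilon>) \<boxtimes> (Id V d \<boxtimes> \<zeta>)) \<cdot> (\<gamma> \<boxtimes> \<delta>)"
    by (subst interchange_nat_rev) simp_all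
  also have "\<dots> = Id V (c \<otimes> d)"
    by (subst runit_interchange) (simp_all add: C(10) D(10))
  finally have 3: "runit V (c \<otimes> d) \<cdot> (Id V (c \<otimes> d) \<boxtimes> (lunit V \<I> \<cdot> (\<epsilon> \<boxtimes> \<zeta>))) \<cdot> ?t = Id V (c \<otimes> d)" .
  show ?thesis
    unfolding is_comonoid_def Let_def tens_comon_simps defs[symmetric] using 1 2 3 by (simp add: hom_iff)
qed

lemma Id_comon_hom: "is_comonoid V C \<Longrightarrow> Id V (ccarr C) \<in> comon_hom V C C"
  using is_comonoidD[of C] by (simp add: comon_hom_def hom_iff)

lemma Comp_comon_hom:
  assumes "is_comonoid V C" "is_comonoid V D" "is_comonoid V E" "f \<in> comon_hom V C D" "g \<in> comon_hom V D E"
  shows "g \<cdot> f \<in> comon_hom V C E"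
proof -
  note [simp] = is_comonoidD(1-7)[OF assms(1)] is_comonoidD(1-7)[OF assms(2)] is_comonoidD(1-7)[OF assms(3)]
    comon_homD[OF assms(4)] comon_homD[OF assms(5)]
  have "ccomult E \<cdot> g \<cdot> f = (g \<boxtimes> g) \<cdot> ccomult D \<cdot> f"
    by (subst Comp_extend[OF comon_homD(4)[OF assms(5)]]) simp_all
  moreover have "ccounit E \<cdot> g \<cdot> f = ccounit D \<cdot> f"
    by (subst Comp_extend[OF comon_homD(5)[OF assms(5)]]) simp_all
  ultimately show ?thesis by (simp add: comon_hom_def hom_iff)
qed

lemma tens_comon_hom:
  assumes "is_comonoid V C" "is_comonoid V D" "is_comonoid V C'" "is_comonoid V D'"
    and "f \<in> comon_hom V C C'" "g \<in> comon_hom V D D'"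
  shows "f \<boxtimes> g \<in> comon_hom V (tens_comon V C D) (tens_comon V C' D')"
proof -
  note [simp] = is_comonoidD(1-7)[OF assms(1)] is_comonoidD(1-7)[OF assms(2)] is_comonoidD(1-7)[OF assms(3)]
    is_comonoidD(1-7)[OF assms(4)] comon_homD[OF assms(5)] comon_homD[OF assms(6)]
  have "interchange V (ccarr C') (ccarr C') (ccarr D') (ccarr D') \<cdot> ((f \<boxtimes> f) \<boxtimes> (g \<boxtimes> g)) \<cdot> (ccomult C \<boxtimes> ccomult D)
    = ((f \<boxtimes> g) \<boxtimes> (f \<boxtimes> g)) \<cdot> interchange V (ccarr C) (ccarr C) (ccarr D) (ccarr D) \<cdot> (ccomult C \<boxtimes> ccomult D)"
    by (subst interchange_nat_extend) simp_all
  then show ?thesis by (simp add: comon_hom_def hom_iff)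
qed

text \<open>The laws for the multiplication of \<open>P\<close> involve structure isomorphisms,
  while \<open>comon_hom_eqI\<close> compares comonoid morphisms only. This lemma and its analogues
  for \<open>lunit\<close>, \<open>runit\<close> and \<open>braid\<close> make it
  applicable.\<close>

lemma assoc_comon_hom:
  assumes "is_comonoid V C" "is_comonoid V D" "is_comonoid V E"
  shows "assoc V (ccarr C) (ccarr D) (ccarr E)
    \<in> comon_hom V (tens_comon V (tens_comon V C D) E) (tens_comon V C (tens_comon V D E))"
proof -
  define c d e \<gamma> \<delta> \<eta> where defs: "c = ccarr C" "d = ccarr D" "e = ccarr E"
    "\<gamma> = ccomult C" "\<delta> = ccomult D" "\<eta> = ccomult E"
  define \<epsilon>c \<epsilon>d \<epsilon>e where defs': "\<epsilon>c = ccounit C" "\<epsilon>d = ccounit D" "\<epsilon>e = ccounit E"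
  note [simp] = is_comonoidD(1-7)[OF assms(1), folded defs defs'] is_comonoidD(1-7)[OF assms(2), folded defs defs']
    is_comonoidD(1-7)[OF assms(3), folded defs defs']
  have "(interchange V c c (d \<otimes> e) (d \<otimes> e) \<cdot> (\<gamma> \<boxtimes> (interchange V d d e e \<cdot> (\<delta> \<boxtimes> \<eta>)))) \<cdot> assoc V c d e
    = interchange V c c (d \<otimes> e) (d \<otimes> e) \<cdot> (Id V (c \<otimes> c) \<boxtimes> interchange V d d e e) \<cdot>
      (\<gamma> \<boxtimes> (\<delta> \<boxtimes> \<eta>)) \<cdot> assoc V c d e"
    by simp
  also have "\<dots> = (interchange V c c (d \<otimes> e) (d \<otimes> e) \<cdot> (Id V (c \<otimes> c) \<boxtimes> interchange V d d e e) \<cdot>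
      assoc V (c \<otimes> c) (d \<otimes> d) (e \<otimes> e)) \<cdot> ((\<gamma> \<boxtimes> \<delta>) \<boxtimes> \<eta>)"
    using assoc_nat[of \<gamma> \<delta> \<eta>] by simp
  also have "\<dots> = (assoc V c d e \<boxtimes> assoc V c d e) \<cdot> interchange V (c \<otimes> d) (c \<otimes> d) e e \<cdot>
      ((interchange V c c d d \<cdot> (\<gamma> \<boxtimes> \<delta>)) \<boxtimes> \<eta>)"
    by (subst interchange_assoc[symmetric]) simp_all
  finally have 1: "(interchange V c c (d \<otimes> e) (d \<otimes> e) \<cdot> (\<gamma> \<boxtimes> (interchange V d d e e \<cdot> (\<delta> \<boxtimes> \<eta>)))) \<cdot> assoc V c d e
    = (assoc V c d e \<boxtimes> assoc V c d e) \<cdot> interchange V (c \<otimes> d) (c \<otimes> d) e e \<cdot>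
      ((interchange V c c d d \<cdot> (\<gamma> \<boxtimes> \<delta>)) \<boxtimes> \<eta>)" .
  have "(lunit V \<I> \<cdot> (\<epsilon>c \<boxtimes> (lunit V \<I> \<cdot> (\<epsilon>d \<boxtimes> \<epsilon>e)))) \<cdot> assoc V c d e
    = lunit V \<I> \<cdot> (Id V \<I> \<boxtimes> lunit V \<I>) \<cdot> (\<epsilon>c \<boxtimes> (\<epsilon>d \<boxtimes> \<epsilon>e)) \<cdot> assoc V c d e"
    by simp
  also have "\<dots> = lunit V \<I> \<cdot> (Id V \<I> \<boxtimes> lunit V \<I>) \<cdot> assoc V \<I> \<I> \<I> \<cdot> ((\<epsilon>c \<boxtimes> \<epsilon>d) \<boxtimes> \<epsilon>e)"
    by (subst assoc_nat) simp_all
  also have "\<dots> = lunit V \<I> \<cdot> ((lunit V \<I> \<cdot> (\<epsilon>c \<boxtimes> \<epsilon>d)) \<boxtimes> \<epsilon>e)"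
    by (subst triangle_extend) (simp_all add: lunit_runit_unit)
  finally have 2: "(lunit V \<I> \<cdot> (\<epsilon>c \<boxtimes> (lunit V \<I> \<cdot> (\<epsilon>d \<boxtimes> \<epsilon>e)))) \<cdot> assoc V c d e
    = lunit V \<I> \<cdot> ((lunit V \<I> \<cdot> (\<epsilon>c \<boxtimes> \<epsilon>d)) \<boxtimes> \<epsilon>e)" .
  show ?thesis
    unfolding comon_hom_def mem_Collect_eq tens_comon_simps defs[symmetric] defs'[symmetric]
    using 1 2 by (simp add: hom_iff)
qed

lemma lunit_comon_hom:
  assumes "is_comonoid V C"
  shows "lunit V (ccarr C) \<in> comon_hom V (tens_comon V (unit_comon V) C) C"
proof -
  define c \<gamma> \<epsilon> where defs: "c = ccarr C" "\<gamma> = ccomult C" "\<epsilon> = ccounit C"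
  note [simp] = is_comonoidD(1-7)[OF assms(1), folded defs]
  have "\<gamma> \<cdot> lunit V c = lunit V (c \<otimes> c) \<cdot> (Id V \<I> \<boxtimes> \<gamma>)"
    by (simp add: lunit_nat)
  also have "\<dots> = (lunit V c \<boxtimes> lunit V c) \<cdot> interchange V \<I> \<I> c c \<cdot> (lunit_inv \<I> \<boxtimes> \<gamma>)"
    by (subst interchange_lunit[symmetric]) simp_all
  finally have "\<gamma> \<cdot> lunit V c = \<dots>" .
  moreover have "\<epsilon> \<cdot> lunit V c = lunit V \<I> \<cdot> (Id V \<I> \<boxtimes> \<epsilon>)"
    by (simp add: lunit_nat)
  ultimately show ?thesis
    by (simp add: comon_hom_def hom_iff defs[symmetric])
qed

lemma runit_comon_hom:
  assumes "is_comonoid V C"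
  shows "runit V (ccarr C) \<in> comon_hom V (tens_comon V C (unit_comon V)) C"
proof -
  define c \<gamma> \<epsilon> where defs: "c = ccarr C" "\<gamma> = ccomult C" "\<epsilon> = ccounit C"
  note [simp] = is_comonoidD(1-7)[OF assms(1), folded defs]
  have "\<gamma> \<cdot> runit V c = runit V (c \<otimes> c) \<cdot> (\<gamma> \<boxtimes> Id V \<I>)"
    by (simp add: runit_nat)
  also have "\<dots> = (runit V c \<boxtimes> runit V c) \<cdot> interchange V c c \<I> \<I> \<cdot> (\<gamma> \<boxtimes> lunit_inv \<I>)"
    by (subst interchange_runit[symmetric]) simp_all
  finally have "\<gamma> \<cdot> runit V c = \<dots>" .
  moreover have "\<epsilon> \<cdot> runit V c = lunit V \<I> \<cdot> (\<epsilon> \<boxtimes> Id V \<I>)"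
    by (simp add: runit_nat lunit_runit_unit)
  ultimately show ?thesis
    by (simp add: comon_hom_def hom_iff defs[symmetric])
qed

lemma lunit_braid_unit: "lunit V \<I> \<cdot> braid V \<I> \<I> = lunit V \<I>"
  using lunit_braid[of \<I>] by (simp add: lunit_runit_unit)

lemma braid_comon_hom:
  assumes "is_comonoid V C" "is_comonoid V D"
  shows "braid V (ccarr C) (ccarr D) \<in> comon_hom V (tens_comon V C D) (tens_comon V D C)"
proof -
  define c d \<gamma> \<delta> \<epsilon> \<zeta> where defs: "c = ccarr C" "d = ccarr D" "\<gamma> = ccomult C" "\<delta> = ccomult D"
    "\<epsilon> = ccounit C" "\<zeta> = ccounit D"
  note [simp] = is_comonoidD(1-7)[OF assms(1), folded defs] is_comonoidD(1-7)[OF assms(2), folded defs]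
  have "(interchange V d d c c \<cdot> (\<delta> \<boxtimes> \<gamma>)) \<cdot> braid V c d
    = (interchange V d d c c \<cdot> braid V (c \<otimes> c) (d \<otimes> d)) \<cdot> (\<gamma> \<boxtimes> \<delta>)"
    by (simp add: braid_nat)
  also have "\<dots> = (braid V c d \<boxtimes> braid V c d) \<cdot> interchange V c c d d \<cdot> (\<gamma> \<boxtimes> \<delta>)"
    by (subst interchange_braid) simp_all
  finally have 1: "(interchange V d d c c \<cdot> (\<delta> \<boxtimes> \<gamma>)) \<cdot> braid V c d = \<dots>" .
  have "(lunit V \<I> \<cdot> (\<zeta> \<boxtimes> \<epsilon>)) \<cdot> braid V c d = (lunit V \<I> \<cdot> braid V \<I> \<I>) \<cdot> (\<epsilon> \<boxtimes> \<zeta>)"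
    by (simp add: braid_nat)
  then have 2: "(lunit V \<I> \<cdot> (\<zeta> \<boxtimes> \<epsilon>)) \<cdot> braid V c d = lunit V \<I> \<cdot> (\<epsilon> \<boxtimes> \<zeta>)"
    by (simp only: lunit_braid_unit)
  show ?thesis
    using 1 2 by (simp add: comon_hom_def hom_iff defs[symmetric])
qed

lemma is_monoid_unit: "is_monoid V (unit_mon V)"
  using triangle[of \<I> \<I>] by (simp add: is_monoid_def unit_mon_def Let_def hom_iff lunit_runit_unit)

lemma commutative_unit: "commutative V (unit_mon V)"
  by (simp add: commutative_def unit_mon_def lunit_braid_unit)

text \<open>In other words, the multiplication of a commutative monoid is a monoid morphism.\<close>

lemma commutative_interchange:
  assumes "is_monoid V A" "commutative V A"
  defines "a \<equiv> mcarr A" and "\<mu> \<equiv> mmult A"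
  shows "\<mu> \<cdot> (\<mu> \<boxtimes> \<mu>) \<cdot> interchange V a a a a = \<mu> \<cdot> (\<mu> \<boxtimes> \<mu>)"
proof -
  note A = is_monoidD[OF assms(1), folded a_def \<mu>_def]
  note [simp] = A(1-7)
  have c: "\<mu> \<cdot> braid V a a = \<mu>" using assms by (simp add: commutative_def)
  have c': "\<mu> \<cdot> braid V a a \<cdot> f = \<mu> \<cdot> f" if "f \<in> Mor V" "Cod V f = a \<otimes> a" for f
    by (subst Comp_extend[OF c]) (use that in simp_all)
  have as: "\<mu> \<cdot> (\<mu> \<boxtimes> Id V a) \<cdot> f = \<mu> \<cdot> (Id V a \<boxtimes> \<mu>) \<cdot> assoc V a a a \<cdot> f"
    if "f \<in> Mor V" "Cod V f = (a \<otimes> a) \<otimes> a" for f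
    by (subst Comp_extend[OF A(8)]) (use that in simp_all)
  have as': "\<mu> \<cdot> (Id V a \<boxtimes> \<mu>) = \<mu> \<cdot> (\<mu> \<boxtimes> Id V a) \<cdot> assoc_inv a a a"
    by (subst as) simp_all
  \<comment> \<open>In elements, \<open>(x y) (z w) = x ((y z) w)\<close>. With the middle pair
    multiplied first, \<open>interchange\<close> reduces to a braiding of that pair, which
    commutativity absorbs.\<close>
  have m4: "\<mu> \<cdot> (\<mu> \<boxtimes> \<mu>) = \<mu> \<cdot> (Id V a \<boxtimes> (\<mu> \<cdot> (\<mu> \<boxtimes> Id V a) \<cdot> assoc_inv a a a)) \<cdot> assoc V a a (a \<otimes> a)"
  proof -
    have "\<mu> \<cdot> (\<mu> \<boxtimes> \<mu>) = \<mu> \<cdot> (\<mu> \<boxtimes> Id V a) \<cdot> ((Id V a \<boxtimes> Id V a) \<boxtimes> \<mu>)" by simp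
    also have "\<dots> = \<mu> \<cdot> (Id V a \<boxtimes> \<mu>) \<cdot> assoc V a a a \<cdot> ((Id V a \<boxtimes> Id V a) \<boxtimes> \<mu>)"
      by (subst as) simp_all
    also have "\<dots> = \<mu> \<cdot> (Id V a \<boxtimes> (\<mu> \<cdot> (Id V a \<boxtimes> \<mu>))) \<cdot> assoc V a a (a \<otimes> a)"
      by (subst assoc_nat) simp_all
    finally show ?thesis unfolding as' .
  qed
  have "\<mu> \<cdot> (\<mu> \<boxtimes> \<mu>) \<cdot> interchange V a a a a
    = (\<mu> \<cdot> (\<mu> \<boxtimes> \<mu>)) \<cdot> interchange V a a a a" by simp
  also have "\<dots> = \<mu> \<cdot> (Id V a \<boxtimes> (\<mu> \<cdot> ((\<mu> \<cdot> braid V a a) \<boxtimes> Id V a) \<cdot> assoc_inv a a a)) \<cdot> assoc V a a (a \<otimes> a)"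
    unfolding m4 by (simp add: interchange_def)
  also have "\<dots> = \<mu> \<cdot> (\<mu> \<boxtimes> \<mu>)"
    unfolding c m4 ..
  finally show ?thesis .
qed

end

section \<open>Measuring morphisms\<close>

lemma mon_of_simps [simp]:
  "mcarr (mon_of B) = bcarr B" "mmult (mon_of B) = bmult B" "munit (mon_of B) = bunit B"
  by (simp_all add: mon_of_def)

lemma comon_of_simps [simp]:
  "ccarr (comon_of B) = bcarr B" "ccomult (comon_of B) = bcomult B" "ccounit (comon_of B) = bcounit B"
  by (simp_all add: comon_of_def)

text \<open>Sweedler's condition: in elements,
  \<open>\<phi>(x y, c) = \<phi>(x, c1) \<phi>(y, c2)\<close> and
  \<open>\<phi>(1, c) = \<epsilon>(c) 1\<close>. The factor \<open>runit V \<I>\<close> is what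
  \<open>to_ihom_unit\<close> leaves after transposition.\<close>

definition measuring ::
  "('o, 'm, 'z) smcc_data_scheme \<Rightarrow> ('o, 'm) mon \<Rightarrow> ('o, 'm) comon \<Rightarrow> ('o, 'm) mon \<Rightarrow> 'm \<Rightarrow> bool" where
  "measuring V M C A \<phi> \<longleftrightarrow>
     (let m = mcarr M; c = ccarr C; a = mcarr A in
       \<phi> \<in> hom V (m \<otimes>\<^bsub>V\<^esub> c) a \<and>
       \<phi> \<cdot>\<^bsub>V\<^esub> (mmult M \<boxtimes>\<^bsub>V\<^esub> Id V c) =
         mmult A \<cdot>\<^bsub>V\<^esub> (\<phi> \<boxtimes>\<^bsub>V\<^esub> \<phi>) \<cdot>\<^bsub>V\<^esub> interchange V m m c c \<cdot>\<^bsub>V\<^esub> (Id V (m \<otimes>\<^bsub>V\<^esub> m) \<boxtimes>\<^bsub>V\<^esub> ccomult C) \<and>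
       \<phi> \<cdot>\<^bsub>V\<^esub> (munit M \<boxtimes>\<^bsub>V\<^esub> Id V c) = munit A \<cdot>\<^bsub>V\<^esub> runit V \<I>\<^bsub>V\<^esub> \<cdot>\<^bsub>V\<^esub> (Id V \<I>\<^bsub>V\<^esub> \<boxtimes>\<^bsub>V\<^esub> ccounit C))"

text \<open>The measuring morphism \<open>B \<otimes> (C \<otimes> D) \<rightarrow> A\<close> built from \<open>B \<otimes> C \<rightarrow> A\<close> and \<open>B \<otimes> D \<rightarrow> A\<close>;
  it underlies the multiplication of \<open>P(B, A)\<close>.\<close>

definition measuring_tens ::
  "('o, 'm, 'z) smcc_data_scheme \<Rightarrow> ('o, 'm) comon \<Rightarrow> ('o, 'm) mon \<Rightarrow> 'o \<Rightarrow> 'o \<Rightarrow> 'm \<Rightarrow> 'm \<Rightarrow> 'm" where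
  "measuring_tens V B A c d \<phi> \<psi> =
     mmult A \<cdot>\<^bsub>V\<^esub> (\<phi> \<boxtimes>\<^bsub>V\<^esub> \<psi>) \<cdot>\<^bsub>V\<^esub> interchange V (ccarr B) (ccarr B) c d \<cdot>\<^bsub>V\<^esub>
       (ccomult B \<boxtimes>\<^bsub>V\<^esub> Id V (c \<otimes>\<^bsub>V\<^esub> d))"

text \<open>The neutral element for \<open>measuring_tens\<close>, in elements
  \<open>x \<mapsto> \<epsilon>(x) 1\<close>; it underlies the unit of
  \<open>P(B, A)\<close>.\<close>

definition measuring_triv ::
  "('o, 'm, 'z) smcc_data_scheme \<Rightarrow> ('o, 'm) comon \<Rightarrow> ('o, 'm) mon \<Rightarrow> 'm" where
  "measuring_triv V B A = munit A \<cdot>\<^bsub>V\<^esub> ccounit B \<cdot>\<^bsub>V\<^esub> runit V (ccarr B)"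

context symmetric_monoidal_category
begin

lemma measuringD:
  assumes "measuring V M C A \<phi>"
  shows "\<phi> \<in> Mor V" "Dom V \<phi> = mcarr M \<otimes> ccarr C" "Cod V \<phi> = mcarr A"
    "\<phi> \<cdot> (mmult M \<boxtimes> Id V (ccarr C)) = mmult A \<cdot> (\<phi> \<boxtimes> \<phi>) \<cdot>
      interchange V (mcarr M) (mcarr M) (ccarr C) (ccarr C) \<cdot> (Id V (mcarr M \<otimes> mcarr M) \<boxtimes> ccomult C)"
    "\<phi> \<cdot> (munit M \<boxtimes> Id V (ccarr C)) = munit A \<cdot> runit V \<I> \<cdot> (Id V \<I> \<boxtimes> ccounit C)"
  using assms by (auto simp: measuring_def Let_def hom_def)

lemma is_bimonoidD:
  assumes "is_bimonoid V B"
  shows "is_monoid V (mon_of B)" "is_comonoid V (comon_of B)"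
    "bcomult B \<cdot> bmult B = (bmult B \<boxtimes> bmult B) \<cdot>
       interchange V (bcarr B) (bcarr B) (bcarr B) (bcarr B) \<cdot> (bcomult B \<boxtimes> bcomult B)"
    "bcomult B \<cdot> bunit B = (bunit B \<boxtimes> bunit B) \<cdot> lunit_inv \<I>"
    "bcounit B \<cdot> bmult B = lunit V \<I> \<cdot> (bcounit B \<boxtimes> bcounit B)"
    "bcounit B \<cdot> bunit B = Id V \<I>"
proof -
  show M: "is_monoid V (mon_of B)" "is_comonoid V (comon_of B)"
    using assms by (auto simp: is_bimonoid_def)
  note [simp] = is_monoidD(1-7)[OF M(1), simplified] is_comonoidD(1-7)[OF M(2), simplified]
  show "bcomult B \<cdot> bmult B = (bmult B \<boxtimes> bmult B) \<cdot>
       interchange V (bcarr B) (bcarr B) (bcarr B) (bcarr B) \<cdot> (bcomult B \<boxtimes> bcomult B)"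
    "bcomult B \<cdot> bunit B = (bunit B \<boxtimes> bunit B) \<cdot> lunit_inv \<I>"
    "bcounit B \<cdot> bmult B = lunit V \<I> \<cdot> (bcounit B \<boxtimes> bcounit B)"
    "bcounit B \<cdot> bunit B = Id V \<I>"
    using assms by (auto simp: is_bimonoid_def mon_hom_def tens_mon_def unit_mon_def)
qed

lemma mult_unit_unit:
  assumes "is_monoid V A"
  shows "mmult A \<cdot> (munit A \<boxtimes> munit A) = munit A \<cdot> lunit V \<I>"
proof -
  note [simp] = is_monoidD(1-7)[OF assms]
  have "mmult A \<cdot> (munit A \<boxtimes> munit A) = (mmult A \<cdot> (munit A \<boxtimes> Id V (mcarr A))) \<cdot> (Id V \<I> \<boxtimes> munit A)"
    by simp
  also have "\<dots> = munit A \<cdot> lunit V \<I>"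
    by (subst is_monoidD(9)[OF assms]) (simp add: lunit_nat)
  finally show ?thesis .
qed

lemma measuring_tens_simps [simp]:
  assumes "is_comonoid V B" "is_monoid V A"
    and "\<phi> \<in> Mor V" "Dom V \<phi> = ccarr B \<otimes> c" "Cod V \<phi> = mcarr A"
    and "\<psi> \<in> Mor V" "Dom V \<psi> = ccarr B \<otimes> d" "Cod V \<psi> = mcarr A"
    and "c \<in> Obj V" "d \<in> Obj V"
  shows "measuring_tens V B A c d \<phi> \<psi> \<in> Mor V"
    "Dom V (measuring_tens V B A c d \<phi> \<psi>) = ccarr B \<otimes> (c \<otimes> d)"
    "Cod V (measuring_tens V B A c d \<phi> \<psi>) = mcarr A"
proof -
  note [simp] = is_comonoidD(1-7)[OF assms(1)] is_monoidD(1-7)[OF assms(2)] assms(3-)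
  show "measuring_tens V B A c d \<phi> \<psi> \<in> Mor V"
    "Dom V (measuring_tens V B A c d \<phi> \<psi>) = ccarr B \<otimes> (c \<otimes> d)"
    "Cod V (measuring_tens V B A c d \<phi> \<psi>) = mcarr A"
    by (simp_all add: measuring_tens_def)
qed

lemma measuring_triv_simps [simp]:
  assumes "is_comonoid V B" "is_monoid V A"
  shows "measuring_triv V B A \<in> Mor V" "Dom V (measuring_triv V B A) = ccarr B \<otimes> \<I>"
    "Cod V (measuring_triv V B A) = mcarr A"
proof -
  note [simp] = is_comonoidD(1-7)[OF assms(1)] is_monoidD(1-7)[OF assms(2)]
  show "measuring_triv V B A \<in> Mor V" "Dom V (measuring_triv V B A) = ccarr B \<otimes> \<I>"
    "Cod V (measuring_triv V B A) = mcarr A"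
    by (simp_all add: measuring_triv_def)
qed

section \<open>Associativity, unit and symmetry laws of \<open>measuring_tens\<close>\<close>

context
  fixes B :: "('o, 'm) comon" and A :: "('o, 'm) mon" and b a \<Delta> \<epsilon> \<mu> \<iota>
  assumes B: "is_comonoid V B" and A: "is_monoid V A"
  defines b_def: "b \<equiv> ccarr B" and a_def: "a \<equiv> mcarr A" and \<Delta>_def: "\<Delta> \<equiv> ccomult B"
    and \<epsilon>_def: "\<epsilon> \<equiv> ccounit B" and \<mu>_def: "\<mu> \<equiv> mmult A" and \<iota>_def: "\<iota> \<equiv> munit A"
begin

lemmas comonoid_laws = is_comonoidD[OF B, folded b_def \<Delta>_def \<epsilon>_def]
lemmas monoid_laws = is_monoidD[OF A, folded a_def \<mu>_def \<iota>_def]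
lemmas measuring_tens_unfold = measuring_tens_def[of V B A, folded b_def \<Delta>_def \<mu>_def]
lemmas measuring_triv_unfold = measuring_triv_def[of V B A, folded b_def \<epsilon>_def \<iota>_def]

text \<open>Naturality of \<open>interchange\<close> in its last two objects; in this form
  \<open>m \<cdot> (f \<boxtimes> g)\<close> can later be evaluated under the universal measuring
  morphism.\<close>

lemma measuring_tens_Comp:
  assumes [simp]: "\<phi> \<in> Mor V" "Dom V \<phi> = b \<otimes> c" "Cod V \<phi> = a"
    "\<psi> \<in> Mor V" "Dom V \<psi> = b \<otimes> d" "Cod V \<psi> = a"
    "f \<in> Mor V" "g \<in> Mor V"
    and c: "Cod V f = c" "Cod V g = d"
  shows "measuring_tens V B A c d \<phi> \<psi> \<cdot> (Id V b \<boxtimes> (f \<boxtimes> g))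
    = measuring_tens V B A (Dom V f) (Dom V g) (\<phi> \<cdot> (Id V b \<boxtimes> f)) (\<psi> \<cdot> (Id V b \<boxtimes> g))"
proof -
  have [simp]: "c \<in> Obj V" "d \<in> Obj V" using c by auto
  note [simp] = comonoid_laws(1-7) monoid_laws(1-7) c
  have "measuring_tens V B A c d \<phi> \<psi> \<cdot> (Id V b \<boxtimes> (f \<boxtimes> g))
    = \<mu> \<cdot> (\<phi> \<boxtimes> \<psi>) \<cdot> interchange V b b c d \<cdot> ((Id V b \<boxtimes> Id V b) \<boxtimes> (f \<boxtimes> g)) \<cdot>
       (\<Delta> \<boxtimes> Id V (Dom V f \<otimes> Dom V g))"
    by (simp add: measuring_tens_unfold)
  also have "\<dots> = measuring_tens V B A (Dom V f) (Dom V g) (\<phi> \<cdot> (Id V b \<boxtimes> f)) (\<psi> \<cdot> (Id V b \<boxtimes> g))"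
    by (subst interchange_nat_extend) (simp_all add: measuring_tens_unfold)
  finally show ?thesis .
qed

text \<open>Coassociativity of \<open>\<Delta>\<close> and associativity of \<open>\<mu>\<close>;
  between them \<open>interchange_coassoc\<close> changes the bracketing of the six factors.\<close>

lemma measuring_tens_assoc:
  assumes [simp]: "\<phi> \<in> Mor V" "Dom V \<phi> = b \<otimes> c" "Cod V \<phi> = a"
    "\<psi> \<in> Mor V" "Dom V \<psi> = b \<otimes> d" "Cod V \<psi> = a"
    "\<chi> \<in> Mor V" "Dom V \<chi> = b \<otimes> e" "Cod V \<chi> = a"
    "c \<in> Obj V" "d \<in> Obj V" "e \<in> Obj V"
  shows "measuring_tens V B A (c \<otimes> d) e (measuring_tens V B A c d \<phi> \<psi>) \<chi>
    = measuring_tens V B A c (d \<otimes> e) \<phi> (measuring_tens V B A d e \<psi> \<chi>) \<cdot> (Id V b \<boxtimes> assoc V c d e)"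
proof -
  note [simp] = comonoid_laws(1-7) monoid_laws(1-7)
  have as: "\<mu> \<cdot> (\<mu> \<boxtimes> Id V a) \<cdot> f = \<mu> \<cdot> (Id V a \<boxtimes> \<mu>) \<cdot> assoc V a a a \<cdot> f"
    if "f \<in> Mor V" "Cod V f = (a \<otimes> a) \<otimes> a" for f
    by (subst Comp_extend[OF monoid_laws(8)]) (use that in simp_all)
  let ?k = "(((\<Delta> \<boxtimes> Id V b) \<cdot> \<Delta>) \<boxtimes> Id V ((c \<otimes> d) \<otimes> e))"
  have "measuring_tens V B A (c \<otimes> d) e (measuring_tens V B A c d \<phi> \<psi>) \<chi>
    = \<mu> \<cdot> (\<mu> \<boxtimes> Id V a) \<cdot> ((\<phi> \<boxtimes> \<psi>) \<boxtimes> \<chi>) \<cdot> (interchange V b b c d \<boxtimes> Id V (b \<otimes> e)) \<cdot>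
      ((\<Delta> \<boxtimes> Id V (c \<otimes> d)) \<boxtimes> (Id V b \<boxtimes> Id V e)) \<cdot> interchange V b b (c \<otimes> d) e \<cdot> (\<Delta> \<boxtimes> Id V ((c \<otimes> d) \<otimes> e))"
    by (simp add: measuring_tens_unfold)
  also have "\<dots> = \<mu> \<cdot> (\<mu> \<boxtimes> Id V a) \<cdot> ((\<phi> \<boxtimes> \<psi>) \<boxtimes> \<chi>) \<cdot> (interchange V b b c d \<boxtimes> Id V (b \<otimes> e)) \<cdot>
      interchange V (b \<otimes> b) b (c \<otimes> d) e \<cdot> ?k"
    by (subst interchange_nat_rev) simp_all
  also have "\<dots> = \<mu> \<cdot> (Id V a \<boxtimes> \<mu>) \<cdot> assoc V a a a \<cdot> ((\<phi> \<boxtimes> \<psi>) \<boxtimes> \<chi>) \<cdot>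
      (interchange V b b c d \<boxtimes> Id V (b \<otimes> e)) \<cdot> interchange V (b \<otimes> b) b (c \<otimes> d) e \<cdot> ?k"
    by (subst as) simp_all
  also have "\<dots> = \<mu> \<cdot> (Id V a \<boxtimes> \<mu>) \<cdot> (\<phi> \<boxtimes> (\<psi> \<boxtimes> \<chi>)) \<cdot> (assoc V (b \<otimes> c) (b \<otimes> d) (b \<otimes> e) \<cdot>
      (interchange V b b c d \<boxtimes> Id V (b \<otimes> e)) \<cdot> interchange V (b \<otimes> b) b (c \<otimes> d) e) \<cdot> ?k"
    by (subst assoc_nat_extend) simp_all
  also have "\<dots> = \<mu> \<cdot> (Id V a \<boxtimes> \<mu>) \<cdot> (\<phi> \<boxtimes> (\<psi> \<boxtimes> \<chi>)) \<cdot> (Id V (b \<otimes> c) \<boxtimes> interchange V b b d e) \<cdot>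
      interchange V b (b \<otimes> b) c (d \<otimes> e) \<cdot> ((assoc V b b b \<cdot> (\<Delta> \<boxtimes> Id V b) \<cdot> \<Delta>) \<boxtimes> assoc V c d e)"
    by (subst interchange_coassoc) simp_all
  also have "\<dots> = \<mu> \<cdot> (Id V a \<boxtimes> \<mu>) \<cdot> (\<phi> \<boxtimes> (\<psi> \<boxtimes> \<chi>)) \<cdot> (Id V (b \<otimes> c) \<boxtimes> interchange V b b d e) \<cdot>
      interchange V b (b \<otimes> b) c (d \<otimes> e) \<cdot> ((Id V b \<boxtimes> \<Delta>) \<boxtimes> (Id V c \<boxtimes> Id V (d \<otimes> e))) \<cdot> (\<Delta> \<boxtimes> assoc V c d e)"
    by (simp add: comonoid_laws(8))
  also have "\<dots> = \<mu> \<cdot> (Id V a \<boxtimes> \<mu>) \<cdot> (\<phi> \<boxtimes> (\<psi> \<boxtimes> \<chi>)) \<cdot> (Id V (b \<otimes> c) \<boxtimes> interchange V b b d e) \<cdot>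
      ((Id V b \<boxtimes> Id V c) \<boxtimes> (\<Delta> \<boxtimes> Id V (d \<otimes> e))) \<cdot> interchange V b b c (d \<otimes> e) \<cdot> (\<Delta> \<boxtimes> assoc V c d e)"
    by (subst interchange_nat_extend) simp_all
  also have "\<dots> = measuring_tens V B A c (d \<otimes> e) \<phi> (measuring_tens V B A d e \<psi> \<chi>) \<cdot> (Id V b \<boxtimes> assoc V c d e)"
    by (simp add: measuring_tens_unfold)
  finally show ?thesis .
qed

text \<open>The counit law of \<open>B\<close> and the left unit law of \<open>A\<close>, brought
  together by \<open>lunit_interchange\<close>.\<close>

lemma measuring_tens_triv_left:
  assumes [simp]: "\<phi> \<in> Mor V" "Dom V \<phi> = b \<otimes> c" "Cod V \<phi> = a" "c \<in> Obj V"
  shows "measuring_tens V B A \<I> c (measuring_triv V B A) \<phi> = \<phi> \<cdot> (Id V b \<boxtimes> lunit V c)"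
proof -
  note [simp] = comonoid_laws(1-7) monoid_laws(1-7)
  \<comment> \<open>This moves \<open>\<epsilon>\<close> inside, leaving the unit isomorphism as
    \<open>lunit V \<I>\<close>, the form that \<open>lunit_interchange\<close> expects.\<close>
  have e: "\<epsilon> \<cdot> runit V b = lunit V \<I> \<cdot> (\<epsilon> \<boxtimes> Id V \<I>)"
    by (simp add: runit_nat lunit_runit_unit)
  have "measuring_tens V B A \<I> c (measuring_triv V B A) \<phi>
    = (\<mu> \<cdot> (\<iota> \<boxtimes> Id V a)) \<cdot> (Id V \<I> \<boxtimes> \<phi>) \<cdot> ((\<epsilon> \<cdot> runit V b) \<boxtimes> Id V (b \<otimes> c)) \<cdot> interchange V b b \<I> c \<cdot>
       (\<Delta> \<boxtimes> Id V (\<I> \<otimes> c))"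
    by (simp add: measuring_tens_unfold measuring_triv_unfold)
  also have "\<dots> = (lunit V a \<cdot> (Id V \<I> \<boxtimes> \<phi>)) \<cdot> (lunit V \<I> \<boxtimes> Id V (b \<otimes> c)) \<cdot>
      ((\<epsilon> \<boxtimes> Id V \<I>) \<boxtimes> (Id V b \<boxtimes> Id V c)) \<cdot> interchange V b b \<I> c \<cdot> (\<Delta> \<boxtimes> Id V (\<I> \<otimes> c))"
    unfolding e monoid_laws(9) by simp
  also have "\<dots> = \<phi> \<cdot> lunit V (b \<otimes> c) \<cdot> (lunit V \<I> \<boxtimes> Id V (b \<otimes> c)) \<cdot>
      ((\<epsilon> \<boxtimes> Id V \<I>) \<boxtimes> (Id V b \<boxtimes> Id V c)) \<cdot> interchange V b b \<I> c \<cdot> (\<Delta> \<boxtimes> Id V (\<I> \<otimes> c))"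
    by (subst lunit_nat) simp_all
  also have "\<dots> = \<phi> \<cdot> (lunit V (b \<otimes> c) \<cdot> (lunit V \<I> \<boxtimes> Id V (b \<otimes> c)) \<cdot> interchange V \<I> b \<I> c) \<cdot>
      ((\<epsilon> \<boxtimes> Id V b) \<boxtimes> (Id V \<I> \<boxtimes> Id V c)) \<cdot> (\<Delta> \<boxtimes> Id V (\<I> \<otimes> c))"
    by (subst interchange_nat_rev) simp_all
  also have "\<dots> = \<phi> \<cdot> ((lunit V b \<cdot> (\<epsilon> \<boxtimes> Id V b) \<cdot> \<Delta>) \<boxtimes> lunit V c)"
    by (subst lunit_interchange) simp_all
  also have "\<dots> = \<phi> \<cdot> (Id V b \<boxtimes> lunit V c)"
    by (simp only: comonoid_laws(9))
  finally show ?thesis .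
qed

lemma measuring_tens_triv_right:
  assumes [simp]: "\<phi> \<in> Mor V" "Dom V \<phi> = b \<otimes> c" "Cod V \<phi> = a" "c \<in> Obj V"
  shows "measuring_tens V B A c \<I> \<phi> (measuring_triv V B A) = \<phi> \<cdot> (Id V b \<boxtimes> runit V c)"
proof -
  note [simp] = comonoid_laws(1-7) monoid_laws(1-7)
  have e: "\<epsilon> \<cdot> runit V b = lunit V \<I> \<cdot> (\<epsilon> \<boxtimes> Id V \<I>)"
    by (simp add: runit_nat lunit_runit_unit)
  have "measuring_tens V B A c \<I> \<phi> (measuring_triv V B A)
    = (\<mu> \<cdot> (Id V a \<boxtimes> \<iota>)) \<cdot> (\<phi> \<boxtimes> Id V \<I>) \<cdot> (Id V (b \<otimes> c) \<boxtimes> (\<epsilon> \<cdot> runit V b)) \<cdot> interchange V b b c \<I> \<cdot>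
       (\<Delta> \<boxtimes> Id V (c \<otimes> \<I>))"
    by (simp add: measuring_tens_unfold measuring_triv_unfold)
  also have "\<dots> = (runit V a \<cdot> (\<phi> \<boxtimes> Id V \<I>)) \<cdot> (Id V (b \<otimes> c) \<boxtimes> lunit V \<I>) \<cdot>
      ((Id V b \<boxtimes> Id V c) \<boxtimes> (\<epsilon> \<boxtimes> Id V \<I>)) \<cdot> interchange V b b c \<I> \<cdot> (\<Delta> \<boxtimes> Id V (c \<otimes> \<I>))"
    unfolding e monoid_laws(10) by simp
  also have "\<dots> = \<phi> \<cdot> runit V (b \<otimes> c) \<cdot> (Id V (b \<otimes> c) \<boxtimes> lunit V \<I>) \<cdot>
      ((Id V b \<boxtimes> Id V c) \<boxtimes> (\<epsilon> \<boxtimes> Id V \<I>)) \<cdot> interchange V b b c \<I> \<cdot> (\<Delta> \<boxtimes> Id V (c \<otimes> \<I>))"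
    by (subst runit_nat) simp_all
  also have "\<dots> = \<phi> \<cdot> (runit V (b \<otimes> c) \<cdot> (Id V (b \<otimes> c) \<boxtimes> lunit V \<I>) \<cdot> interchange V b \<I> c \<I>) \<cdot>
      ((Id V b \<boxtimes> \<epsilon>) \<boxtimes> (Id V c \<boxtimes> Id V \<I>)) \<cdot> (\<Delta> \<boxtimes> Id V (c \<otimes> \<I>))"
    by (subst interchange_nat_rev) simp_all
  also have "\<dots> = \<phi> \<cdot> ((runit V b \<cdot> (Id V b \<boxtimes> \<epsilon>) \<cdot> \<Delta>) \<boxtimes> runit V c)"
    by (subst runit_interchange) simp_all
  also have "\<dots> = \<phi> \<cdot> (Id V b \<boxtimes> runit V c)"
    by (simp only: comonoid_laws(10))
  finally show ?thesis .
qed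

text \<open>Cocommutativity supplies a braiding of the two copies of \<open>b\<close> to go with
  that of \<open>c\<close> and \<open>d\<close>. Together they pass through
  \<open>interchange\<close> as the braiding of \<open>b \<otimes> c\<close> with
  \<open>b \<otimes> d\<close>, which ends up next to \<open>\<mu>\<close>, where commutativity
  absorbs it.\<close>

lemma measuring_tens_braid:
  assumes "commutative V A" "cocommutative V B"
    and [simp]: "\<phi> \<in> Mor V" "Dom V \<phi> = b \<otimes> c" "Cod V \<phi> = a"
    "\<psi> \<in> Mor V" "Dom V \<psi> = b \<otimes> d" "Cod V \<psi> = a" "c \<in> Obj V" "d \<in> Obj V"
  shows "measuring_tens V B A d c \<psi> \<phi> \<cdot> (Id V b \<boxtimes> braid V c d) = measuring_tens V B A c d \<phi> \<psi>"
proof -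
  note [simp] = comonoid_laws(1-7) monoid_laws(1-7)
  have com: "\<mu> \<cdot> braid V a a = \<mu>" and cocom: "braid V b b \<cdot> \<Delta> = \<Delta>"
    using assms(1,2) by (auto simp: commutative_def cocommutative_def a_def b_def \<mu>_def \<Delta>_def)
  have "measuring_tens V B A d c \<psi> \<phi> \<cdot> (Id V b \<boxtimes> braid V c d)
    = \<mu> \<cdot> (\<psi> \<boxtimes> \<phi>) \<cdot> interchange V b b d c \<cdot> (\<Delta> \<boxtimes> braid V c d)"
    by (simp add: measuring_tens_unfold)
  also have "\<dots> = \<mu> \<cdot> (\<psi> \<boxtimes> \<phi>) \<cdot> (interchange V b b d c \<cdot> (braid V b b \<boxtimes> braid V c d)) \<cdot> (\<Delta> \<boxtimes> Id V (c \<otimes> d))"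
    by (simp add: cocom)
  also have "\<dots> = \<mu> \<cdot> ((\<psi> \<boxtimes> \<phi>) \<cdot> braid V (b \<otimes> c) (b \<otimes> d)) \<cdot> interchange V b b c d \<cdot> (\<Delta> \<boxtimes> Id V (c \<otimes> d))"
    by (subst braid_interchange[symmetric]) simp_all
  also have "\<dots> = \<mu> \<cdot> (braid V a a \<cdot> (\<phi> \<boxtimes> \<psi>)) \<cdot> interchange V b b c d \<cdot> (\<Delta> \<boxtimes> Id V (c \<otimes> d))"
    by (subst braid_nat) simp_all
  also have "\<dots> = (\<mu> \<cdot> braid V a a) \<cdot> (\<phi> \<boxtimes> \<psi>) \<cdot> interchange V b b c d \<cdot> (\<Delta> \<boxtimes> Id V (c \<otimes> d))"
    by simp
  also have "\<dots> = measuring_tens V B A c d \<phi> \<psi>"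
    unfolding com by (simp add: measuring_tens_unfold)
  finally show ?thesis .
qed

end

text \<open>In elements, multiplicativity of \<open>\<Delta>\<close> turns the value at
  \<open>x y\<close> into \<open>\<phi>(x1 y1, c) \<psi>(x2 y2, d)\<close>, which expands to
  \<open>\<phi>(x1, c1) \<phi>(y1, c2) \<psi>(x2, d1) \<psi>(y2, d2)\<close>. Exchanging the middle
  factors in \<open>A\<close> leaves the value at \<open>x\<close> times the value at
  \<open>y\<close>.\<close>

lemma measuring_measuring_tens:
  assumes "is_bimonoid V B" "is_monoid V A" "commutative V A" "is_comonoid V C" "is_comonoid V D"
    and "measuring V (mon_of B) C A \<phi>" "measuring V (mon_of B) D A \<psi>"
  shows "measuring V (mon_of B) (tens_comon V C D) A
    (measuring_tens V (comon_of B) A (ccarr C) (ccarr D) \<phi> \<psi>)"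
proof -
  define b a c d \<mu> \<iota> \<Delta> \<mu>' \<iota>' \<gamma> \<delta> \<epsilon> \<zeta> where defs: "b = bcarr B" "a = mcarr A" "c = ccarr C" "d = ccarr D"
    "\<mu> = mmult A" "\<iota> = munit A" "\<Delta> = bcomult B" "\<mu>' = bmult B" "\<iota>' = bunit B"
    "\<gamma> = ccomult C" "\<delta> = ccomult D" "\<epsilon> = ccounit C" "\<zeta> = ccounit D"
  note B = is_bimonoidD[OF assms(1), folded defs]
  note [simp] = is_monoidD(1-7)[OF B(1), simplified, folded defs] is_comonoidD(1-7)[OF B(2), simplified, folded defs]
    is_monoidD(1-7)[OF assms(2), folded defs] is_comonoidD(1-7)[OF assms(4), folded defs]
    is_comonoidD(1-7)[OF assms(5), folded defs]
  note \<phi> = measuringD[OF assms(6), simplified, folded defs]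
  note \<psi> = measuringD[OF assms(7), simplified, folded defs]
  note [simp] = \<phi>(1-3) \<psi>(1-3)
  define \<chi> where "\<chi> = measuring_tens V (comon_of B) A c d \<phi> \<psi>"
  have \<chi>: "\<chi> = \<mu> \<cdot> (\<phi> \<boxtimes> \<psi>) \<cdot> interchange V b b c d \<cdot> (\<Delta> \<boxtimes> Id V (c \<otimes> d))"
    by (simp add: \<chi>_def measuring_tens_def defs)
  have \<chi>_hom: "\<chi> \<in> hom V (b \<otimes> (c \<otimes> d)) a" by (simp add: \<chi> hom_iff)
  have comm: "\<mu> \<cdot> (\<mu> \<boxtimes> \<mu>) \<cdot> interchange V a a a a \<cdot> f = \<mu> \<cdot> (\<mu> \<boxtimes> \<mu>) \<cdot> f"
    if "f \<in> Mor V" "Cod V f = (a \<otimes> a) \<otimes> (a \<otimes> a)" for f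
    using arg_cong[OF commutative_interchange[OF assms(2,3), folded defs], of "\<lambda>h. h \<cdot> f"] that by simp
  let ?i = "interchange V (b \<otimes> b) (b \<otimes> b)" and ?\<Delta> = "\<Delta> \<boxtimes> \<Delta>"
  have "\<chi> \<cdot> (\<mu>' \<boxtimes> Id V (c \<otimes> d)) = \<mu> \<cdot> (\<phi> \<boxtimes> \<psi>) \<cdot> interchange V b b c d \<cdot> ((\<Delta> \<cdot> \<mu>') \<boxtimes> Id V (c \<otimes> d))"
    by (simp add: \<chi>)
  also have "\<dots> = \<mu> \<cdot> (\<phi> \<boxtimes> \<psi>) \<cdot> interchange V b b c d \<cdot> ((\<mu>' \<boxtimes> \<mu>') \<boxtimes> (Id V c \<boxtimes> Id V d)) \<cdot>
      ((interchange V b b b b \<cdot> ?\<Delta>) \<boxtimes> Id V (c \<otimes> d))"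
    by (simp add: B(3))
  also have "\<dots> = \<mu> \<cdot> ((\<phi> \<cdot> (\<mu>' \<boxtimes> Id V c)) \<boxtimes> (\<psi> \<cdot> (\<mu>' \<boxtimes> Id V d))) \<cdot> ?i c d \<cdot>
      ((interchange V b b b b \<cdot> ?\<Delta>) \<boxtimes> Id V (c \<otimes> d))"
    by (subst interchange_nat_extend) simp_all
  also have "\<dots> = \<mu> \<cdot> (\<mu> \<boxtimes> \<mu>) \<cdot> ((\<phi> \<boxtimes> \<phi>) \<boxtimes> (\<psi> \<boxtimes> \<psi>)) \<cdot>
      (interchange V b b c c \<boxtimes> interchange V b b d d) \<cdot> ((Id V (b \<otimes> b) \<boxtimes> \<gamma>) \<boxtimes> (Id V (b \<otimes> b) \<boxtimes> \<delta>)) \<cdot> ?i c d \<cdot>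
      ((interchange V b b b b \<cdot> ?\<Delta>) \<boxtimes> Id V (c \<otimes> d))"
    by (simp add: \<phi>(4) \<psi>(4))
  also have "\<dots> = \<mu> \<cdot> (\<mu> \<boxtimes> \<mu>) \<cdot> ((\<phi> \<boxtimes> \<phi>) \<boxtimes> (\<psi> \<boxtimes> \<psi>)) \<cdot>
      ((interchange V b b c c \<boxtimes> interchange V b b d d) \<cdot> ?i (c \<otimes> c) (d \<otimes> d) \<cdot>
        (interchange V b b b b \<boxtimes> Id V ((c \<otimes> c) \<otimes> (d \<otimes> d)))) \<cdot> (?\<Delta> \<boxtimes> (\<gamma> \<boxtimes> \<delta>))"
    by (subst interchange_nat_rev) simp_all
  \<comment> \<open>Regroups from values of \<open>\<phi>\<close> and values of
    \<open>\<psi>\<close> to values at the first and at the second element of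
    \<open>B\<close>.\<close>
  also have "\<dots> = \<mu> \<cdot> (\<mu> \<boxtimes> \<mu>) \<cdot> ((\<phi> \<boxtimes> \<phi>) \<boxtimes> (\<psi> \<boxtimes> \<psi>)) \<cdot>
      interchange V (b \<otimes> c) (b \<otimes> d) (b \<otimes> c) (b \<otimes> d) \<cdot>
      (interchange V b b c d \<boxtimes> interchange V b b c d) \<cdot> ?i (c \<otimes> d) (c \<otimes> d) \<cdot>
      (?\<Delta> \<boxtimes> (interchange V c c d d \<cdot> (\<gamma> \<boxtimes> \<delta>)))"
    by (subst interchange_interchange) simp_all
  \<comment> \<open>The exchange of the middle factors is pushed forward into \<open>A\<close>,
    where \<open>comm\<close> removes it.\<close>
  also have "\<dots> = \<mu> \<cdot> (\<mu> \<boxtimes> \<mu>) \<cdot> interchange V a a a a \<cdot> ((\<phi> \<boxtimes> \<psi>) \<boxtimes> (\<phi> \<boxtimes> \<psi>)) \<cdot>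
      (interchange V b b c d \<boxtimes> interchange V b b c d) \<cdot> ?i (c \<otimes> d) (c \<otimes> d) \<cdot>
      (?\<Delta> \<boxtimes> (interchange V c c d d \<cdot> (\<gamma> \<boxtimes> \<delta>)))"
    by (subst interchange_nat_rev) simp_all
  also have "\<dots> = \<mu> \<cdot> (\<mu> \<boxtimes> \<mu>) \<cdot> ((\<phi> \<boxtimes> \<psi>) \<boxtimes> (\<phi> \<boxtimes> \<psi>)) \<cdot>
      (interchange V b b c d \<boxtimes> interchange V b b c d) \<cdot> ?i (c \<otimes> d) (c \<otimes> d) \<cdot>
      (?\<Delta> \<boxtimes> (Id V (c \<otimes> d) \<boxtimes> Id V (c \<otimes> d))) \<cdot> (Id V (b \<otimes> b) \<boxtimes> (interchange V c c d d \<cdot> (\<gamma> \<boxtimes> \<delta>)))"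
    by (subst comm) simp_all
  also have "\<dots> = \<mu> \<cdot> (\<mu> \<boxtimes> \<mu>) \<cdot> ((\<phi> \<boxtimes> \<psi>) \<boxtimes> (\<phi> \<boxtimes> \<psi>)) \<cdot>
      (interchange V b b c d \<boxtimes> interchange V b b c d) \<cdot>
      ((\<Delta> \<boxtimes> Id V (c \<otimes> d)) \<boxtimes> (\<Delta> \<boxtimes> Id V (c \<otimes> d))) \<cdot> interchange V b b (c \<otimes> d) (c \<otimes> d) \<cdot>
      (Id V (b \<otimes> b) \<boxtimes> (interchange V c c d d \<cdot> (\<gamma> \<boxtimes> \<delta>)))"
    by (subst interchange_nat_extend) simp_all
  finally have mult: "\<chi> \<cdot> (\<mu>' \<boxtimes> Id V (c \<otimes> d)) = \<mu> \<cdot> (\<chi> \<boxtimes> \<chi>) \<cdot> interchange V b b (c \<otimes> d) (c \<otimes> d) \<cdot>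
      (Id V (b \<otimes> b) \<boxtimes> (interchange V c c d d \<cdot> (\<gamma> \<boxtimes> \<delta>)))"
    by (simp add: \<chi>)
  have "\<chi> \<cdot> (\<iota>' \<boxtimes> Id V (c \<otimes> d)) = \<mu> \<cdot> (\<phi> \<boxtimes> \<psi>) \<cdot> interchange V b b c d \<cdot> ((\<Delta> \<cdot> \<iota>') \<boxtimes> Id V (c \<otimes> d))"
    by (simp add: \<chi>)
  also have "\<dots> = \<mu> \<cdot> (\<phi> \<boxtimes> \<psi>) \<cdot> interchange V b b c d \<cdot> ((\<iota>' \<boxtimes> \<iota>') \<boxtimes> (Id V c \<boxtimes> Id V d)) \<cdot>
      (lunit_inv \<I> \<boxtimes> Id V (c \<otimes> d))"
    by (simp add: B(4))
  also have "\<dots> = \<mu> \<cdot> ((\<phi> \<cdot> (\<iota>' \<boxtimes> Id V c)) \<boxtimes> (\<psi> \<cdot> (\<iota>' \<boxtimes> Id V d))) \<cdot> interchange V \<I> \<I> c d \<cdot>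
      (lunit_inv \<I> \<boxtimes> Id V (c \<otimes> d))"
    by (subst interchange_nat_extend) simp_all
  also have "\<dots> = \<mu> \<cdot> (\<iota> \<boxtimes> \<iota>) \<cdot> (runit V \<I> \<boxtimes> runit V \<I>) \<cdot> ((Id V \<I> \<boxtimes> \<epsilon>) \<boxtimes> (Id V \<I> \<boxtimes> \<zeta>)) \<cdot> interchange V \<I> \<I> c d \<cdot>
      (lunit_inv \<I> \<boxtimes> Id V (c \<otimes> d))"
    by (simp add: \<phi>(5) \<psi>(5))
  \<comment> \<open>Everything is collected over \<open>\<I>\<close>, so that
    \<open>interchange_lunit\<close> applies with both of its objects equal to
    \<open>\<I>\<close>.\<close>
  also have "\<dots> = (\<mu> \<cdot> (\<iota> \<boxtimes> \<iota>)) \<cdot> ((lunit V \<I> \<boxtimes> lunit V \<I>) \<cdot> interchange V \<I> \<I> \<I> \<I> \<cdot>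
      (lunit_inv \<I> \<boxtimes> Id V (\<I> \<otimes> \<I>))) \<cdot> (Id V \<I> \<boxtimes> (\<epsilon> \<boxtimes> \<zeta>))"
    by (subst interchange_nat_rev) (simp_all add: lunit_runit_unit)
  also have "\<dots> = \<iota> \<cdot> (lunit V \<I> \<cdot> lunit V (\<I> \<otimes> \<I>)) \<cdot> (Id V \<I> \<boxtimes> (\<epsilon> \<boxtimes> \<zeta>))"
    unfolding mult_unit_unit[OF assms(2), folded defs] by (subst interchange_lunit) simp_all
  also have "\<dots> = \<iota> \<cdot> (lunit V \<I> \<cdot> (Id V \<I> \<boxtimes> lunit V \<I>)) \<cdot> (Id V \<I> \<boxtimes> (\<epsilon> \<boxtimes> \<zeta>))"
    by (subst lunit_nat) simp_all
  also have "\<dots> = \<iota> \<cdot> runit V \<I> \<cdot> (Id V \<I> \<boxtimes> (lunit V \<I> \<cdot> (\<epsilon> \<boxtimes> \<zeta>)))"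
    by (simp add: lunit_runit_unit[symmetric])
  finally have unit: "\<chi> \<cdot> (\<iota>' \<boxtimes> Id V (c \<otimes> d)) = \<dots>" .
  show ?thesis
    unfolding measuring_def Let_def tens_comon_simps mon_of_simps defs[symmetric] \<chi>_def[symmetric]
    using \<chi>_hom mult unit by blast
qed

text \<open>The counit of \<open>B\<close> is a monoid morphism, so \<open>\<epsilon>(x y) 1\<close>
  is the product of \<open>\<epsilon>(x) 1\<close> and \<open>\<epsilon>(y) 1\<close> in
  \<open>A\<close>.\<close>

lemma measuring_measuring_triv:
  assumes "is_bimonoid V B" "is_monoid V A"
  shows "measuring V (mon_of B) (unit_comon V) A (measuring_triv V (comon_of B) A)"
proof -
  define b a \<mu> \<iota> \<epsilon> \<mu>' \<iota>' where defs: "b = bcarr B" "a = mcarr A" 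
    "\<mu> = mmult A" "\<iota> = munit A" "\<epsilon> = bcounit B" "\<mu>' = bmult B" "\<iota>' = bunit B"
  note B = is_bimonoidD[OF assms(1), folded defs]
  note [simp] = is_monoidD(1-7)[OF B(1), simplified, folded defs] is_comonoidD(1-7)[OF B(2), simplified, folded defs]
    is_monoidD(1-7)[OF assms(2), folded defs]
  define \<chi> where "\<chi> = measuring_triv V (comon_of B) A"
  have \<chi>: "\<chi> = \<iota> \<cdot> \<epsilon> \<cdot> runit V b"
    by (simp add: \<chi>_def measuring_triv_def defs)
  have \<chi>_hom: "\<chi> \<in> hom V (b \<otimes> \<I>) a" by (simp add: \<chi> hom_iff)
  have "\<chi> \<cdot> (\<mu>' \<boxtimes> Id V \<I>) = \<iota> \<cdot> (\<epsilon> \<cdot> \<mu>') \<cdot> runit V (b \<otimes> b)"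
    by (simp add: \<chi> runit_nat)
  also have "\<dots> = (\<mu> \<cdot> (\<iota> \<boxtimes> \<iota>)) \<cdot> (\<epsilon> \<boxtimes> \<epsilon>) \<cdot> runit V (b \<otimes> b)"
    unfolding B(5) mult_unit_unit[OF assms(2), folded defs] by simp
  also have "\<dots> = \<mu> \<cdot> (\<chi> \<boxtimes> \<chi>) \<cdot> interchange V b b \<I> \<I> \<cdot> (Id V (b \<otimes> b) \<boxtimes> lunit_inv \<I>)"
    by (subst interchange_runit[symmetric]) (simp_all add: \<chi>)
  finally have mult: "\<chi> \<cdot> (\<mu>' \<boxtimes> Id V \<I>) = \<dots>" .
  have "\<chi> \<cdot> (\<iota>' \<boxtimes> Id V \<I>) = \<iota> \<cdot> (\<epsilon> \<cdot> \<iota>') \<cdot> runit V \<I>"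
    by (simp add: \<chi> runit_nat)
  then have unit: "\<chi> \<cdot> (\<iota>' \<boxtimes> Id V \<I>) = \<iota> \<cdot> runit V \<I> \<cdot> (Id V \<I> \<boxtimes> Id V \<I>)"
    unfolding B(6) by simp
  show ?thesis
    unfolding measuring_def Let_def unit_comon_simps mon_of_simps defs[symmetric] \<chi>_def[symmetric]
    using \<chi>_hom mult unit by blast
qed

end

section \<open>Convolution monoids\<close>

context symmetric_monoidal_closed_category
begin

lemma evl_simps [simp]:
  assumes "x \<in> Obj V" "y \<in> Obj V"
  shows "ihom V x y \<in> Obj V" "evl V x y \<in> Mor V" "Dom V (evl V x y) = ihom V x y \<otimes> x"
    "Cod V (evl V x y) = y"
  using ihom_in_Obj[OF assms] evl_in_hom[OF assms] by (auto simp: hom_def)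

text \<open>The inverse of \<open>transpose\<close>. Equations between morphisms into
  \<open>ihom\<close> are checked after applying it, which replaces the internal hom by calculation
  with tensors.\<close>

definition untranspose where
  "untranspose x y g = evl V x y \<cdot> (g \<boxtimes> Id V x)"

lemma transpose_simps [simp]:
  assumes "x \<in> Obj V" "y \<in> Obj V" "z \<in> Obj V" "f \<in> Mor V" "Dom V f = z \<otimes> x" "Cod V f = y"
  shows "transpose V z x y f \<in> Mor V" "Dom V (transpose V z x y f) = z"
    "Cod V (transpose V z x y f) = ihom V x y" "evl V x y \<cdot> (transpose V z x y f \<boxtimes> Id V x) = f"
proof -
  have "\<exists>!g. g \<in> hom V z (ihom V x y) \<and> evl V x y \<cdot> (g \<boxtimes> Id V x) = f"
    using evl_universal[of x y z f] assms by (simp add: hom_iff)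
  from theI'[OF this] show "transpose V z x y f \<in> Mor V" "Dom V (transpose V z x y f) = z"
    "Cod V (transpose V z x y f) = ihom V x y" "evl V x y \<cdot> (transpose V z x y f \<boxtimes> Id V x) = f"
    unfolding transpose_def[symmetric] by (auto simp: hom_iff)
qed

lemma untranspose_simps [simp]:
  assumes "x \<in> Obj V" "y \<in> Obj V" "g \<in> Mor V" "Cod V g = ihom V x y"
  shows "untranspose x y g \<in> Mor V" "Dom V (untranspose x y g) = Dom V g \<otimes> x"
    "Cod V (untranspose x y g) = y"
  using assms by (simp_all add: untranspose_def)

lemma untranspose_inject:
  assumes "untranspose x y g = untranspose x y h" "x \<in> Obj V" "y \<in> Obj V"
    and "g \<in> Mor V" "h \<in> Mor V" "Dom V g = Dom V h" "Cod V g = ihom V x y" "Cod V h = ihom V x y"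
  shows "g = h"
proof -
  have "\<exists>!k. k \<in> hom V (Dom V g) (ihom V x y) \<and> evl V x y \<cdot> (k \<boxtimes> Id V x) = untranspose x y g"
    by (rule evl_universal) (use assms(2-) in \<open>simp_all add: hom_iff\<close>)
  moreover have "g \<in> hom V (Dom V g) (ihom V x y) \<and> evl V x y \<cdot> (g \<boxtimes> Id V x) = untranspose x y g"
    using assms(2-) by (simp add: hom_iff untranspose_def)
  moreover have "h \<in> hom V (Dom V g) (ihom V x y) \<and> evl V x y \<cdot> (h \<boxtimes> Id V x) = untranspose x y g"
    using assms by (simp add: hom_iff untranspose_def)
  ultimately show ?thesis by blast
qed

lemma untranspose_Comp:
  assumes "x \<in> Obj V" "y \<in> Obj V" "f \<in> Mor V" "g \<in> Mor V" "Cod V g = ihom V x y" "Cod V f = Dom V g"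
  shows "untranspose x y (g \<cdot> f) = untranspose x y g \<cdot> (f \<boxtimes> Id V x)"
  using assms by (simp add: untranspose_def)

lemma ihom_mor_simps [simp]:
  assumes "f \<in> Mor V" "g \<in> Mor V"
  shows "ihom_mor V f g \<in> Mor V" "Dom V (ihom_mor V f g) = ihom V (Cod V f) (Dom V g)"
    "Cod V (ihom_mor V f g) = ihom V (Dom V f) (Cod V g)"
  using assms by (simp_all add: ihom_mor_def Let_def)

lemma untranspose_ihom_mor:
  assumes [simp]: "f \<in> Mor V" "h \<in> Mor V" "g \<in> Mor V" 
    and c: "Cod V g = ihom V x y" "Cod V f = x" "Dom V h = y" "Dom V f = x'" "Cod V h = y'"
  shows "untranspose x' y' (ihom_mor V f h \<cdot> g) = h \<cdot> untranspose x y g \<cdot> (Id V (Dom V g) \<boxtimes> f)"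
proof -
  have [simp]: "x \<in> Obj V" "y \<in> Obj V" "x' \<in> Obj V" "y' \<in> Obj V" using c by auto
  note [simp] = c
  have "untranspose x' y' (ihom_mor V f h \<cdot> g) = (evl V x' y' \<cdot> (ihom_mor V f h \<boxtimes> Id V x')) \<cdot> (g \<boxtimes> Id V x')"
    by (simp add: untranspose_def)
  also have "\<dots> = (h \<cdot> evl V x y \<cdot> (Id V (ihom V x y) \<boxtimes> f)) \<cdot> (g \<boxtimes> Id V x')"
    by (simp add: ihom_mor_def)
  also have "\<dots> = h \<cdot> untranspose x y g \<cdot> (Id V (Dom V g) \<boxtimes> f)"
    by (simp add: untranspose_def)
  finally show ?thesis .
qed

lemma ihom_tens_simps [simp]:
  assumes "x \<in> Obj V" "y \<in> Obj V" "x' \<in> Obj V" "y' \<in> Obj V"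
  shows "ihom_tens V x y x' y' \<in> Mor V" "Dom V (ihom_tens V x y x' y') = ihom V x y \<otimes> ihom V x' y'"
    "Cod V (ihom_tens V x y x' y') = ihom V (x \<otimes> x') (y \<otimes> y')"
  using assms by (simp_all add: ihom_tens_def)

lemma untranspose_ihom_tens:
  assumes [simp]: "x \<in> Obj V" "y \<in> Obj V" "x' \<in> Obj V" "y' \<in> Obj V" 
    "g \<in> Mor V" "g' \<in> Mor V" "Cod V g = ihom V x y" "Cod V g' = ihom V x' y'"
  shows "untranspose (x \<otimes> x') (y \<otimes> y') (ihom_tens V x y x' y' \<cdot> (g \<boxtimes> g'))
    = (untranspose x y g \<boxtimes> untranspose x' y' g') \<cdot> interchange V (Dom V g) (Dom V g') x x'"
proof -
  let ?e = "(evl V x y \<boxtimes> evl V x' y') \<cdot> interchange V (ihom V x y) (ihom V x' y') x x'"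
  have "untranspose (x \<otimes> x') (y \<otimes> y') (ihom_tens V x y x' y' \<cdot> (g \<boxtimes> g'))
    = (evl V (x \<otimes> x') (y \<otimes> y') \<cdot> (ihom_tens V x y x' y' \<boxtimes> Id V (x \<otimes> x'))) \<cdot> ((g \<boxtimes> g') \<boxtimes> Id V (x \<otimes> x'))"
    by (simp add: untranspose_def)
  also have "\<dots> = ?e \<cdot> ((g \<boxtimes> g') \<boxtimes> Id V (x \<otimes> x'))"
    by (simp add: ihom_tens_def)
  also have "\<dots> = (evl V x y \<boxtimes> evl V x' y') \<cdot> interchange V (ihom V x y) (ihom V x' y') x x' \<cdot>
      ((g \<boxtimes> g') \<boxtimes> (Id V x \<boxtimes> Id V x'))"
    by simp
  also have "\<dots> = (untranspose x y g \<boxtimes> untranspose x' y' g') \<cdot> interchange V (Dom V g) (Dom V g') x x'"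
    by (subst interchange_nat) (simp_all add: untranspose_def)
  finally show ?thesis .
qed

lemma to_ihom_unit_simps [simp]:
  assumes "y \<in> Obj V"
  shows "to_ihom_unit V y \<in> Mor V" "Dom V (to_ihom_unit V y) = y" "Cod V (to_ihom_unit V y) = ihom V \<I> y"
    "untranspose \<I> y (to_ihom_unit V y) = runit V y"
  using assms by (simp_all add: to_ihom_unit_def untranspose_def)

text \<open>Transposition is injective, so each of the two monoid morphism equations can be
  untransposed separately. From here on, monoid morphisms into the convolution monoid are handled as
  measuring morphisms.\<close>

lemma mon_hom_convolution_iff:
  assumes "is_monoid V M" "is_comonoid V C" "is_monoid V A"
    and f: "f \<in> Mor V" "Dom V f = mcarr M" "Cod V f = ihom V (ccarr C) (mcarr A)"
  shows "f \<in> mon_hom V M (convolution V C A)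
    \<longleftrightarrow> measuring V M C A (untranspose (ccarr C) (mcarr A) f)"
proof -
  define m c a \<mu> \<delta> where defs: "m = mcarr M" "c = ccarr C" "a = mcarr A" "\<mu> = mmult A" "\<delta> = ccomult C"
  note [simp] = is_monoidD(1-7)[OF assms(1), folded defs] is_comonoidD(1-7)[OF assms(2), folded defs]
    is_monoidD(1-7)[OF assms(3), folded defs] f[folded defs]
  have mult: "untranspose c a (mmult (convolution V C A) \<cdot> (f \<boxtimes> f))
    = \<mu> \<cdot> (untranspose c a f \<boxtimes> untranspose c a f) \<cdot> interchange V m m c c \<cdot> (Id V (m \<otimes> m) \<boxtimes> \<delta>)"
    using untranspose_ihom_mor[of \<delta> \<mu> "ihom_tens V c a c a \<cdot> (f \<boxtimes> f)"]
      untranspose_ihom_tens[of c a c a f f]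
    by (simp add: convolution_def defs[symmetric])
  have unit: "untranspose c a (munit (convolution V C A)) = munit A \<cdot> runit V \<I> \<cdot> (Id V \<I> \<boxtimes> ccounit C)"
    using untranspose_ihom_mor[of "ccounit C" "munit A" "to_ihom_unit V \<I>"]
    by (simp add: convolution_def defs[symmetric])
  have carr: "mcarr (convolution V C A) = ihom V c a"
    by (simp add: convolution_def defs)
  have inj: "k = l \<longleftrightarrow> untranspose c a k = untranspose c a l"
    if "k \<in> Mor V" "l \<in> Mor V" "Dom V k = Dom V l" "Cod V k = ihom V c a" "Cod V l = ihom V c a" for k l
    using untranspose_inject[of c a k l] that by auto
  have "f \<cdot> mmult M = mmult (convolution V C A) \<cdot> (f \<boxtimes> f) \<longleftrightarrow>
    untranspose c a (f \<cdot> mmult M) = untranspose c a (mmult (convolution V C A) \<cdot> (f \<boxtimes> f))"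
    by (rule inj) (simp_all add: convolution_def defs[symmetric])
  moreover have "f \<cdot> munit M = munit (convolution V C A) \<longleftrightarrow>
    untranspose c a (f \<cdot> munit M) = untranspose c a (munit (convolution V C A))"
    by (rule inj) (simp_all add: convolution_def defs[symmetric])
  moreover have "untranspose c a (f \<cdot> mmult M) = untranspose c a f \<cdot> (mmult M \<boxtimes> Id V c)"
    "untranspose c a (f \<cdot> munit M) = untranspose c a f \<cdot> (munit M \<boxtimes> Id V c)"
    by (simp_all add: untranspose_Comp)
  ultimately show ?thesis
    unfolding mon_hom_def measuring_def Let_def defs[symmetric]
    by (simp add: hom_iff mult unit carr)
qed

end

section \<open>The bimonoid structure of the universal measuring comonoid\<close>

text \<open>Both \<open>A\<close> and the pair \<open>P\<close>, \<open>\<Phi>\<close> are arbitrary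
  here, so that the finite dual is covered by the instance with \<open>unit_mon\<close> for
  \<open>A\<close>.\<close>

locale universal_measuring = symmetric_monoidal_closed_category V
  for V :: "('o, 'm, 'z) smcc_data_scheme" (structure) +
  fixes B :: "('o, 'm) bimon" and A :: "('o, 'm) mon" and P :: "('o, 'm) comon" and \<Phi>
  assumes bimonoid: "is_bimonoid V B"
    and monoid: "is_monoid V A"
    and comm: "commutative V A"
    and universal: "universal_measuring_comonoid V (mon_of B) A P \<Phi>"
begin

abbreviation "b \<equiv> bcarr B"
abbreviation "p \<equiv> ccarr P"
abbreviation "a \<equiv> mcarr A"
abbreviation "\<eta> \<equiv> \<Phi> P (Id V p)"
abbreviation "\<psi> \<equiv> untranspose p a \<eta>"

section \<open>The universal measuring morphism\<close>

lemma comonoid: "is_comonoid V P"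
  using universal by (simp add: universal_measuring_comonoid_def)

lemmas B_laws = is_bimonoidD[OF bimonoid]

lemmas carrier_simps [simp] = is_comonoidD(1-7)[OF comonoid] is_monoidD(1-7)[OF monoid]
  is_monoidD(1-7)[OF B_laws(1), simplified] is_comonoidD(1-7)[OF B_laws(2), simplified]

lemma \<Phi>_bij: "is_comonoid V C \<Longrightarrow>
    bij_betw (\<Phi> C) (comon_hom V C P) (mon_hom V (mon_of B) (convolution V C A))"
  using universal by (simp add: universal_measuring_comonoid_def)

lemma \<Phi>_simps:
  assumes "is_comonoid V C" "g \<in> comon_hom V C P"
  shows "\<Phi> C g \<in> Mor V" "Dom V (\<Phi> C g) = b" "Cod V (\<Phi> C g) = ihom V (ccarr C) a"
  using bij_betwE[OF \<Phi>_bij[OF assms(1)]] assms(2) by (auto simp: mon_hom_def hom_iff convolution_def)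

lemmas \<eta>_simps [simp] = \<Phi>_simps[OF comonoid Id_comon_hom[OF comonoid]]

lemma measuring_\<psi>: "measuring V (mon_of B) P A \<psi>"
proof -
  have "\<eta> \<in> mon_hom V (mon_of B) (convolution V P A)"
    using bij_betwE[OF \<Phi>_bij[OF comonoid]] Id_comon_hom[OF comonoid] by blast
  then show ?thesis
    using mon_hom_convolution_iff[OF B_laws(1) comonoid monoid, of \<eta>] by simp
qed

text \<open>The Yoneda argument: naturality of \<open>\<Phi>\<close> along \<open>g\<close>, applied
  to the identity of \<open>P\<close>, gives \<open>\<Phi> C g\<close> from
  \<open>\<eta>\<close>.\<close>

lemma untranspose_\<Phi>:
  assumes "is_comonoid V C" "g \<in> comon_hom V C P"
  shows "untranspose (ccarr C) a (\<Phi> C g) = \<psi> \<cdot> (Id V b \<boxtimes> g)"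
proof -
  note [simp] = is_comonoidD(1-7)[OF assms(1)] comon_homD(1-3)[OF assms(2)]
  \<comment> \<open>The identity is written out so that the naturality clause of
    \<open>universal_measuring_comonoid\<close> matches.\<close>
  have "\<Phi> C (Id V p \<cdot> g) = ihom_mor V g (Id V a) \<cdot> \<eta>"
    using universal assms comonoid Id_comon_hom[OF comonoid]
    unfolding universal_measuring_comonoid_def by blast
  then have "\<Phi> C g = ihom_mor V g (Id V a) \<cdot> \<eta>" by simp
  then show ?thesis
    using untranspose_ihom_mor[of g "Id V a" \<eta> p a "ccarr C" a] by simp
qed

text \<open>The uniqueness half of the universal property, from injectivity of
  \<open>\<Phi> C\<close> and of transposition.\<close>

lemma comon_hom_eqI:
  assumes "is_comonoid V C" "g \<in> comon_hom V C P" "h \<in> comon_hom V C P"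
    and "\<psi> \<cdot> (Id V b \<boxtimes> g) = \<psi> \<cdot> (Id V b \<boxtimes> h)"
  shows "g = h"
proof -
  have "\<Phi> C g = \<Phi> C h"
    by (rule untranspose_inject[of "ccarr C" a])
      (use assms \<Phi>_simps[OF assms(1)] is_comonoidD(1)[OF assms(1)] in \<open>simp_all add: untranspose_\<Phi>\<close>)
  then show ?thesis
    using \<Phi>_bij[OF assms(1)] assms(2,3) by (auto simp: bij_betw_def inj_on_def)
qed

text \<open>The existence half; \<open>k\<close> has to be a monoid morphism for its inverse image
  under \<open>\<Phi> C\<close> to exist.\<close>

lemma classifying_comon_hom:
  assumes "is_comonoid V C" "k \<in> mon_hom V (mon_of B) (convolution V C A)"
  defines "g \<equiv> the_inv_into (comon_hom V C P) (\<Phi> C) k"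
  shows "g \<in> comon_hom V C P" "\<psi> \<cdot> (Id V b \<boxtimes> g) = untranspose (ccarr C) a k"
proof -
  have bij: "inj_on (\<Phi> C) (comon_hom V C P)" "k \<in> \<Phi> C ` comon_hom V C P"
    using \<Phi>_bij[OF assms(1)] assms(2) by (auto simp: bij_betw_def)
  show g: "g \<in> comon_hom V C P"
    unfolding g_def by (rule the_inv_into_into[OF bij subset_refl])
  have "\<Phi> C g = k"
    unfolding g_def by (rule f_the_inv_into_f[OF bij])
  then show "\<psi> \<cdot> (Id V b \<boxtimes> g) = untranspose (ccarr C) a k"
    using untranspose_\<Phi>[OF assms(1) g] by simp
qed

section \<open>The multiplication and unit of the universal measuring comonoid\<close>

abbreviation "PP \<equiv> tens_comon V P P"

lemma comonoid_PP: "is_comonoid V PP"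
  by (rule is_comonoid_tens[OF comonoid comonoid])

lemma untranspose_measuring_mult:
  "untranspose (p \<otimes> p) a (measuring_mult V B A P \<Phi>) = measuring_tens V (comon_of B) A p p \<psi> \<psi>"
proof -
  \<comment> \<open>Bracketed with \<open>bcomult B\<close> outermost, so that
    \<open>untranspose_Comp\<close> splits it off.\<close>
  let ?k = "(ihom_tens V p a p a \<cdot> (\<eta> \<boxtimes> \<eta>)) \<cdot> bcomult B"
  have "untranspose (p \<otimes> p) a (measuring_mult V B A P \<Phi>)
    = mmult A \<cdot> untranspose (p \<otimes> p) (a \<otimes> a) ?k"
    using untranspose_ihom_mor[of "Id V (p \<otimes> p)" "mmult A" ?k "p \<otimes> p" "a \<otimes> a" "p \<otimes> p" a]
    by (simp add: measuring_mult_def Let_def)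
  also have "\<dots> = mmult A \<cdot> untranspose (p \<otimes> p) (a \<otimes> a) (ihom_tens V p a p a \<cdot> (\<eta> \<boxtimes> \<eta>)) \<cdot>
      (bcomult B \<boxtimes> Id V (p \<otimes> p))"
    by (subst untranspose_Comp) simp_all
  also have "\<dots> = measuring_tens V (comon_of B) A p p \<psi> \<psi>"
    by (subst untranspose_ihom_tens) (simp_all add: measuring_tens_def)
  finally show ?thesis .
qed

lemma untranspose_measuring_unit:
  "untranspose \<I> a (measuring_unit V B A) = measuring_triv V (comon_of B) A"
proof -
  have "untranspose \<I> a (measuring_unit V B A) = runit V a \<cdot> ((munit A \<cdot> bcounit B) \<boxtimes> Id V \<I>)"
    unfolding measuring_unit_def by (subst untranspose_Comp) simp_all
  also have "\<dots> = measuring_triv V (comon_of B) A"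
    by (subst runit_nat) (simp_all add: measuring_triv_def)
  finally show ?thesis .
qed

lemma measuring_mult_mon_hom: "measuring_mult V B A P \<Phi> \<in> mon_hom V (mon_of B) (convolution V PP A)"
proof -
  have "measuring V (mon_of B) PP A (measuring_tens V (comon_of B) A p p \<psi> \<psi>)"
    by (rule measuring_measuring_tens[OF bimonoid monoid comm comonoid comonoid measuring_\<psi> measuring_\<psi>])
  then show ?thesis
    by (subst mon_hom_convolution_iff[OF B_laws(1) comonoid_PP monoid])
      (simp_all add: untranspose_measuring_mult, simp_all add: measuring_mult_def Let_def)
qed

lemma measuring_unit_mon_hom:
  "measuring_unit V B A \<in> mon_hom V (mon_of B) (convolution V (unit_comon V) A)"
  by (subst mon_hom_convolution_iff[OF B_laws(1) is_comonoid_unit monoid])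
    (simp_all add: untranspose_measuring_unit measuring_measuring_triv[OF bimonoid monoid],
      simp_all add: measuring_unit_def)

definition "m = the_inv_into (comon_hom V PP P) (\<Phi> PP) (measuring_mult V B A P \<Phi>)"
definition "u = the_inv_into (comon_hom V (unit_comon V) P) (\<Phi> (unit_comon V)) (measuring_unit V B A)"

lemma m_hom: "m \<in> comon_hom V PP P"
  and \<psi>_m: "\<psi> \<cdot> (Id V b \<boxtimes> m) = measuring_tens V (comon_of B) A p p \<psi> \<psi>"
  using classifying_comon_hom[OF comonoid_PP measuring_mult_mon_hom]
  by (simp_all add: m_def untranspose_measuring_mult)

lemma u_hom: "u \<in> comon_hom V (unit_comon V) P"
  and \<psi>_u: "\<psi> \<cdot> (Id V b \<boxtimes> u) = measuring_triv V (comon_of B) A"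
  using classifying_comon_hom[OF is_comonoid_unit measuring_unit_mon_hom]
  by (simp_all add: u_def untranspose_measuring_unit)

lemmas m_simps [simp] = comon_homD(1-3)[OF m_hom, simplified]
lemmas u_simps [simp] = comon_homD(1-3)[OF u_hom, simplified]

text \<open>Under \<open>\<psi>\<close>, multiplication by \<open>m\<close> becomes the product
  \<open>measuring_tens\<close>; the laws of \<open>m\<close> are reduced to those of that product
  by this rule.\<close>

lemma \<psi>_m_Comp:
  assumes "f \<in> Mor V" "g \<in> Mor V" "Cod V f = p" "Cod V g = p"
  shows "\<psi> \<cdot> (Id V b \<boxtimes> (m \<cdot> (f \<boxtimes> g)))
    = measuring_tens V (comon_of B) A (Dom V f) (Dom V g) (\<psi> \<cdot> (Id V b \<boxtimes> f)) (\<psi> \<cdot> (Id V b \<boxtimes> g))"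
proof -
  have "\<psi> \<cdot> (Id V b \<boxtimes> (m \<cdot> (f \<boxtimes> g))) = (\<psi> \<cdot> (Id V b \<boxtimes> m)) \<cdot> (Id V b \<boxtimes> (f \<boxtimes> g))"
    using assms by simp
  also have "\<dots> = measuring_tens V (comon_of B) A (Dom V f) (Dom V g) (\<psi> \<cdot> (Id V b \<boxtimes> f)) (\<psi> \<cdot> (Id V b \<boxtimes> g))"
    unfolding \<psi>_m using measuring_tens_Comp[OF B_laws(2) monoid, of \<psi> p \<psi> p f g] assms by simp
  finally show ?thesis .
qed

section \<open>The bimonoid laws\<close>

lemma m_assoc: "m \<cdot> (m \<boxtimes> Id V p) = m \<cdot> (Id V p \<boxtimes> m) \<cdot> assoc V p p p"
proof (rule comon_hom_eqI)
  let ?C = "tens_comon V PP P" and ?D = "tens_comon V P PP"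
  note id = Id_comon_hom[OF comonoid]
  show C: "is_comonoid V ?C" by (rule is_comonoid_tens[OF comonoid_PP comonoid])
  have D: "is_comonoid V ?D" by (rule is_comonoid_tens[OF comonoid comonoid_PP])
  have 1: "m \<boxtimes> Id V p \<in> comon_hom V ?C PP"
    by (rule tens_comon_hom[OF comonoid_PP comonoid comonoid comonoid m_hom id])
  have 2: "Id V p \<boxtimes> m \<in> comon_hom V ?D PP"
    by (rule tens_comon_hom[OF comonoid comonoid_PP comonoid comonoid id m_hom])
  show "m \<cdot> (m \<boxtimes> Id V p) \<in> comon_hom V ?C P"
    by (rule Comp_comon_hom[OF C comonoid_PP comonoid 1 m_hom])
  show "m \<cdot> (Id V p \<boxtimes> m) \<cdot> assoc V p p p \<in> comon_hom V ?C P"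
    by (rule Comp_comon_hom[OF C comonoid_PP comonoid
      Comp_comon_hom[OF C D comonoid_PP assoc_comon_hom[OF comonoid comonoid comonoid] 2] m_hom])
  let ?t = "measuring_tens V (comon_of B) A"
  \<comment> \<open>Under \<open>\<psi>\<close> the two sides are the two bracketings of the
    threefold product of \<open>\<psi>\<close> with itself.\<close>
  have "\<psi> \<cdot> (Id V b \<boxtimes> (m \<cdot> (m \<boxtimes> Id V p))) = ?t (p \<otimes> p) p (?t p p \<psi> \<psi>) \<psi>"
    using \<psi>_m_Comp[of m "Id V p"] by (simp add: \<psi>_m)
  also have "\<dots> = ?t p (p \<otimes> p) \<psi> (?t p p \<psi> \<psi>) \<cdot> (Id V b \<boxtimes> assoc V p p p)"
    using measuring_tens_assoc[OF B_laws(2) monoid, of \<psi> p \<psi> p \<psi> p] by simp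
  also have "\<dots> = (\<psi> \<cdot> (Id V b \<boxtimes> (m \<cdot> (Id V p \<boxtimes> m)))) \<cdot> (Id V b \<boxtimes> assoc V p p p)"
    using \<psi>_m_Comp[of "Id V p" m] by (simp add: \<psi>_m)
  also have "\<dots> = \<psi> \<cdot> (Id V b \<boxtimes> (m \<cdot> (Id V p \<boxtimes> m) \<cdot> assoc V p p p))"
    by simp
  finally show "\<psi> \<cdot> (Id V b \<boxtimes> (m \<cdot> (m \<boxtimes> Id V p))) = \<dots>" .
qed

lemma m_unit_left: "m \<cdot> (u \<boxtimes> Id V p) = lunit V p"
proof (rule comon_hom_eqI)
  let ?C = "tens_comon V (unit_comon V) P"
  show C: "is_comonoid V ?C" by (rule is_comonoid_tens[OF is_comonoid_unit comonoid])
  show "m \<cdot> (u \<boxtimes> Id V p) \<in> comon_hom V ?C P"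
    by (rule Comp_comon_hom[OF C comonoid_PP comonoid
      tens_comon_hom[OF is_comonoid_unit comonoid comonoid comonoid u_hom Id_comon_hom[OF comonoid]] m_hom])
  show "lunit V p \<in> comon_hom V ?C P" by (rule lunit_comon_hom[OF comonoid])
  show "\<psi> \<cdot> (Id V b \<boxtimes> (m \<cdot> (u \<boxtimes> Id V p))) = \<psi> \<cdot> (Id V b \<boxtimes> lunit V p)"
    using \<psi>_m_Comp[of u "Id V p"] measuring_tens_triv_left[OF B_laws(2) monoid, of \<psi> p]
    by (simp add: \<psi>_u)
qed

lemma m_unit_right: "m \<cdot> (Id V p \<boxtimes> u) = runit V p"
proof (rule comon_hom_eqI)
  let ?C = "tens_comon V P (unit_comon V)"
  show C: "is_comonoid V ?C" by (rule is_comonoid_tens[OF comonoid is_comonoid_unit])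
  show "m \<cdot> (Id V p \<boxtimes> u) \<in> comon_hom V ?C P"
    by (rule Comp_comon_hom[OF C comonoid_PP comonoid
      tens_comon_hom[OF comonoid is_comonoid_unit comonoid comonoid Id_comon_hom[OF comonoid] u_hom] m_hom])
  show "runit V p \<in> comon_hom V ?C P" by (rule runit_comon_hom[OF comonoid])
  show "\<psi> \<cdot> (Id V b \<boxtimes> (m \<cdot> (Id V p \<boxtimes> u))) = \<psi> \<cdot> (Id V b \<boxtimes> runit V p)"
    using \<psi>_m_Comp[of "Id V p" u] measuring_tens_triv_right[OF B_laws(2) monoid, of \<psi> p]
    by (simp add: \<psi>_u)
qed

lemma m_commutative:
  assumes "cocommutative V (comon_of B)"
  shows "m \<cdot> braid V p p = m"
proof (rule comon_hom_eqI[OF comonoid_PP _ m_hom])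
  show "m \<cdot> braid V p p \<in> comon_hom V PP P"
    by (rule Comp_comon_hom[OF comonoid_PP comonoid_PP comonoid braid_comon_hom[OF comonoid comonoid] m_hom])
  have "\<psi> \<cdot> (Id V b \<boxtimes> (m \<cdot> braid V p p)) = (\<psi> \<cdot> (Id V b \<boxtimes> m)) \<cdot> (Id V b \<boxtimes> braid V p p)"
    by simp
  also have "\<dots> = \<psi> \<cdot> (Id V b \<boxtimes> m)"
    unfolding \<psi>_m using measuring_tens_braid[OF B_laws(2) monoid comm assms, of \<psi> p \<psi> p] by simp
  finally show "\<psi> \<cdot> (Id V b \<boxtimes> (m \<cdot> braid V p p)) = \<psi> \<cdot> (Id V b \<boxtimes> m)" .
qed

lemma canonical_bimonoid_eq: "canonical_bimonoid V B A P \<Phi> =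
    \<lparr>bcarr = p, bmult = m, bunit = u, bcomult = ccomult P, bcounit = ccounit P\<rparr>"
  by (simp add: canonical_bimonoid_def m_def u_def)

lemma is_bimonoid_canonical: "is_bimonoid V (canonical_bimonoid V B A P \<Phi>)"
proof -
  let ?Q = "canonical_bimonoid V B A P \<Phi>"
  have M: "is_monoid V (mon_of ?Q)"
    by (simp add: is_monoid_def Let_def hom_iff canonical_bimonoid_eq m_assoc m_unit_left m_unit_right)
  have "comon_of ?Q = P"
    by (simp add: comon_of_def canonical_bimonoid_eq)
  then have C: "is_comonoid V (comon_of ?Q)" using comonoid by simp
  \<comment> \<open>The four equations saying that \<open>m\<close> and \<open>u\<close> are
    comonoid morphisms are, read the other way, the equations saying that the comultiplication and
    counit of \<open>P\<close> are monoid morphisms.\<close>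
  show ?thesis
    using M C comon_homD[OF m_hom] comon_homD[OF u_hom]
    by (simp add: is_bimonoid_def mon_hom_def hom_iff tens_mon_def unit_mon_def canonical_bimonoid_eq)
qed

lemma has_canonical_structure: "has_canonical_bimonoid_structure V B A P \<Phi>"
  unfolding has_canonical_bimonoid_structure_def
  using comonoid_PP measuring_mult_mon_hom is_comonoid_unit measuring_unit_mon_hom is_bimonoid_canonical
  by blast

lemma commutative_canonical:
  "cocommutative V (comon_of B) \<Longrightarrow> commutative V (mon_of (canonical_bimonoid V B A P \<Phi>))"
  by (simp add: commutative_def canonical_bimonoid_eq m_commutative)

end

theorem corollary5p4:
  fixes \<kappa> :: "'u rel"
    and V :: "('o, 'm) smcc_data"
    and B :: "('o, 'm) bimon"
    and A :: "('o, 'm) mon"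
  assumes "inaccessible \<kappa>"
    and "symmetric_monoidal_closed_category V"
    and "locally_presentable \<kappa> V"
    and "is_bimonoid V B"
    and "is_monoid V A" and "commutative V A"
  shows "(\<forall>P \<Phi>. universal_measuring_comonoid V (mon_of B) A P \<Phi> \<longrightarrow>
            has_canonical_bimonoid_structure V B A P \<Phi> \<and>
            (cocommutative V (comon_of B) \<longrightarrow>
               commutative V (mon_of (canonical_bimonoid V B A P \<Phi>)))) \<and>
         (\<forall>P \<Phi>. finite_dual V (mon_of B) P \<Phi> \<longrightarrow>
            has_canonical_bimonoid_structure V B (unit_mon V) P \<Phi> \<and>
            (cocommutative V (comon_of B) \<longrightarrow>
               commutative V (mon_of (canonical_bimonoid V B (unit_mon V) P \<Phi>))))"
proof -
  interpret symmetric_monoidal_closed_category V by fact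
  \<comment> \<open>Stated for an arbitrary commutative monoid \<open>M\<close>, because it is
    applied both to \<open>A\<close> and to \<open>unit_mon\<close>.\<close>
  have main: "has_canonical_bimonoid_structure V B M P \<Phi> \<and>
      (cocommutative V (comon_of B) \<longrightarrow> commutative V (mon_of (canonical_bimonoid V B M P \<Phi>)))"
    if "is_monoid V M" "commutative V M" "universal_measuring_comonoid V (mon_of B) M P \<Phi>" for M P \<Phi>
  proof -
    interpret universal_measuring V B M P \<Phi>
      by unfold_locales (use assms that in auto)
    show ?thesis using has_canonical_structure commutative_canonical by blast
  qed
  show ?thesis
    unfolding finite_dual_def using main assms is_monoid_unit commutative_unit by blast
qed

end
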